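(* Let $d\ge1$, $2<p<\infty$, $1<q<\infty$, $q'=\frac{q}{q-1}$. Let $\Phi$ be a regular function such that $\Phi(t)/t^{q'/2}\to0$ as $t\to0$. Then there exist a compact set $S\subset\mathbb{R}^d$ and a probability measure $\mu$ with $\operatorname{supp}\mu\subset S$, $\hat\mu\in L_{p,q}(\mathbb{R}^d)$ and $\mathcal{H}_{\frac{2d}{p},\Phi}(S)=0$.
   Context: A continuous non-decreasing function $g:\mathbb{R}_+\to\mathbb{R}_+$ is regular if $g(0)=0$ and for some fixed $c>1$, $g(x)\asymp g(cx)$ (two-sided bound with constants independent of $x$). With $\Delta_k=[2^{-k-1},2^{-k})$, $k\in\mathbb{Z}$, for $F\subset\mathbb{R}^d$, $\alpha>0$, $\delta>0$: $\mathcal{H}_{\alpha,\Phi}(F,\delta)=\inf\big\{\sum_k\Phi\big(\sum_{j:\,\operatorname{diam}B_j\in\Delta_k}(\operatorname{diam}B_j)^\alpha\big): F\subset\bigcup_jB_j,\ \operatorname{diam}B_j<\delta\big\}$ (countable covers) and $\mathcal{H}_{\alpha,\Phi}(F)=\lim_{\delta\to0}\mathcal{H}_{\alpha,\Phi}(F,\delta)$. Lorentz space: $\|f\|^q_{L_{p,q}}=q\int_0^\infty (m_f(t)t^p)^{q/p}\frac{dt}{t}$, with $m_f(t)$ the Lebesgue measure of $\{|f|\geqslant t\}$. *)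

theory Defs
  imports "HOL-Analysis.Analysis" "HOL-Probability.Probability"
begin

definition regular_fun :: "(real \<Rightarrow> real) \<Rightarrow> bool" where
  "regular_fun g \<longleftrightarrow>
     continuous_on {0..} g \<and> mono_on {0..} g \<and> (\<forall>x\<ge>0. g x \<ge> 0) \<and> g 0 = 0 \<and>
     (\<exists>c>1. \<exists>A>0. \<exists>B>0. \<forall>x\<ge>0. A * g x \<le> g (c * x) \<and> g (c * x) \<le> B * g x)"

definition dyadic_interval :: "int \<Rightarrow> real set" where
  "dyadic_interval k = {2 powr (- real_of_int k - 1) ..< 2 powr (- real_of_int k)}"

text \<open>For a countable family of open balls ball (c j) (r j), r j \<ge> 0 (r j = 0 gives the
  empty ball, which allows finite covers), diameter 2 r j: the inner sums
  sum_{j : diam B_j in Delta_k} (diam B_j)^alpha.\<close>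
definition dyadic_block_sum :: "real \<Rightarrow> (nat \<Rightarrow> real) \<Rightarrow> int \<Rightarrow> ennreal" where
  "dyadic_block_sum \<alpha> r k =
     (\<Sum>j. if 2 * r j \<in> dyadic_interval k then ennreal ((2 * r j) powr \<alpha>) else 0)"

definition H_content_delta ::
  "real \<Rightarrow> (real \<Rightarrow> real) \<Rightarrow> ('a::euclidean_space) set \<Rightarrow> real \<Rightarrow> ennreal" where
  "H_content_delta \<alpha> \<Phi> F \<delta> =
     Inf {(if (\<forall>k. dyadic_block_sum \<alpha> r k < \<top>)
           then (\<integral>\<^sup>+ k. ennreal (\<Phi> (enn2real (dyadic_block_sum \<alpha> r k))) \<partial>count_space (UNIV :: int set))
           else \<top>)
          | (c :: nat \<Rightarrow> 'a) (r :: nat \<Rightarrow> real).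
            (\<forall>j. 0 \<le> r j \<and> 2 * r j < \<delta>) \<and> F \<subseteq> (\<Union>j. ball (c j) (r j))}"

text \<open>H_{alpha,Phi}(F) = lim_{delta -> 0} H(F,delta); the map is antitone in delta, so the
  limit is the supremum over delta > 0.\<close>
definition H_content :: "real \<Rightarrow> (real \<Rightarrow> real) \<Rightarrow> ('a::euclidean_space) set \<Rightarrow> ennreal" where
  "H_content \<alpha> \<Phi> F = (SUP \<delta>\<in>{0<..}. H_content_delta \<alpha> \<Phi> F \<delta>)"

definition fourier_measure :: "('a::euclidean_space) measure \<Rightarrow> 'a \<Rightarrow> complex" where
  "fourier_measure \<mu> \<xi> = (\<integral>x. cis (- 2 * pi * (x \<bullet> \<xi>)) \<partial>\<mu>)"

text \<open>Lorentz space L_{p,q}: ||f||^q = q * int_0^oo (m_f(t) t^p)^(q/p) dt/t < oo,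
  m_f(t) = Lebesgue measure of {|f| >= t} (required finite, else the norm is infinite).\<close>
definition in_Lorentz :: "real \<Rightarrow> real \<Rightarrow> (('a::euclidean_space) \<Rightarrow> complex) \<Rightarrow> bool" where
  "in_Lorentz p q f \<longleftrightarrow>
     f \<in> borel_measurable lborel \<and>
     (\<forall>t>0. emeasure lborel {x. t \<le> norm (f x)} < \<top>) \<and>
     (\<integral>\<^sup>+ t\<in>{0<..}. ennreal ((measure lborel {x. t \<le> norm (f x)} * t powr p) powr (q / p) / t) \<partial>lborel) < \<top>"

definition measure_support :: "('a::metric_space) measure \<Rightarrow> 'a set" where
  "measure_support \<mu> = {x. \<forall>e>0. emeasure \<mu> (ball x e) > 0}"

end

theory Submission
  imports Defs
begin

text \<open>
  Let $d$ be the dimension, $\alpha = 2d/p$. Start from a finite convex combination of translated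
  and rescaled copies of a fixed compactly supported noise whose Fourier transform decays fast. One
  step of the construction replaces it by an average of $M$ measures of mass $1/M$; the $i$-th one
  consists of about $s 2^{k_i \alpha}$ random samples of the old measure, each smoothed at scale
  $2^{-k_i}$, with distinct $k_i$. Sub-Gaussian moment bounds show that the $i$-th error has Fourier
  transform of size $M^{-1} s^{-1/2} 2^{-k_i d/p}$ around frequency $2^{k_i}$, so its contribution to
  the $q$-th power of the $L_{p,q}$ norm is $(M^{-1} s^{-1/2})^q$, whereas the natural cover of the
  new support costs $M \Phi(C s)$. For $s = \sigma M^{-2/q'}$ the total error
  is $\sigma^{-q/2}$, small for large $\sigma$, while the cover costs $o(1)$ as $M$ grows, because
  $\Phi(t) = o(t^{q'/2})$. Iterating with summable errors, the measures converge.

  Membership in $L_{p,q}$ is read off the $L^r$ norms outside the balls of radius $2^j$, for one even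
  $r > p$; unlike the Lorentz functional these obey the triangle inequality.
\<close>

section \<open>A compactly supported noise\<close>

text \<open>A single scale cannot work: its error s^(-1/2) is small only for large s, while its
  cover is cheap only for small s. Several scales break the tie because their errors live at
  different frequencies and add in l^q: weights 1/M leave M^(1-q) s^(-q/2), and as q > 1 this lets s
  tend to 0 while M grows. Balancing forces s^(q'/2) to be of order 1/M, which is where the exponent
  q'/2 of the hypothesis comes from.

  The separation of frequencies has two sources. Below 2^k a sampling error is flat, and measuring
  it in L^r with r > p makes its normalised tails decay as j falls below k; above 2^k the noise of
  scale 2^-k damps it. Smoothing also perturbs the old measure, by 2^-k times a constant that
  depends on the old configuration; hence the new scales are chosen last.

  Weights are encoded by repeating cells, so that each generation is a list of equal cells refining
  the preceding one. All generations then live on the unit interval, and the limit measure is the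
  law of a pointwise limit of cell centres.\<close>

lemma one_plus_sum_le_prod:
  fixes f :: "'a \<Rightarrow> real"
  assumes "finite A" "\<And>a. a \<in> A \<Longrightarrow> 0 \<le> f a"
  shows "1 + sum f A \<le> (\<Prod>a\<in>A. 1 + f a)"
  using assms
proof (induction A rule: finite_induct)
  case (insert a A)
  have "1 + sum f (insert a A) \<le> (1 + f a) * (1 + sum f A)"
    using insert by (simp add: algebra_simps sum_nonneg)
  also have "\<dots> \<le> (1 + f a) * (\<Prod>a\<in>A. 1 + f a)"
    using insert by (intro mult_left_mono) auto
  finally show ?case using insert by simp
qed simp

lemma cis_sum: "finite A \<Longrightarrow> cis (sum f A) = (\<Prod>a\<in>A. cis (f a))"
  by (induction A rule: finite_induct) (auto simp flip: cis_mult)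

lemma borel_measurable_cis [measurable]: "cis \<in> borel_measurable borel"
  by (intro borel_measurable_continuous_onI continuous_intros)

lemma norm_cis_diff_one_le: "norm (cis t - 1) \<le> \<bar>t\<bar>"
  using iexp_approx1[of t 0] by (simp add: cis_conv_exp)

text \<open>Uniform law on [-w, w]: integrating \<open>cis\<close> leaves two boundary terms of
  modulus 1/|t|, divided by the length 2w. The product form of the bound also covers t = 0.\<close>

lemma uniform_characteristic_decay:
  assumes w: "0 < w"
  shows "\<exists>U :: real measure. prob_space U \<and> sets U = sets borel \<and> (AE u in U. \<bar>u\<bar> \<le> w) \<and>
    (\<forall>t. norm (\<integral>u. cis (t * u) \<partial>U) * \<bar>t\<bar> \<le> 1 / w)"
proof -
  define U where "U = density lborel (\<lambda>x::real. ennreal (indicator {-w..w} x / (2*w)))"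
  have 1: "prob_space U"
  proof
    have "emeasure U (space U) = (\<integral>\<^sup>+x. ennreal (1/(2*w)) * indicator {-w..w} x \<partial>lborel)"
      by (auto simp: U_def emeasure_density intro!: nn_integral_cong split: split_indicator)
    also have "\<dots> = 1"
      using w by (subst nn_integral_cmult_indicator) (auto simp flip: ennreal_mult)
    finally show "emeasure U (space U) = 1" .
  qed
  have 2: "AE u in U. \<bar>u\<bar> \<le> w"
    unfolding U_def using w by (subst AE_density) (auto split: split_indicator simp: indicator_def)
  have 3: "norm (\<integral>u. cis (t * u) \<partial>U) * \<bar>t\<bar> \<le> 1 / w" for t
  proof (cases "t = 0")
    case False
    have "(\<integral>u. cis (t * u) \<partial>U) = (\<integral>u. (indicator {-w..w} u / (2*w)) *\<^sub>R cis (t * u) \<partial>lborel)"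
      unfolding U_def using w by (subst integral_density) auto
    also have "\<dots> = (1/(2*w)) *\<^sub>R (\<integral>u. indicator {-w..w} u *\<^sub>R cis (t * u) \<partial>lborel)"
      by (subst integral_scaleR_right[symmetric]) (auto intro!: Bochner_Integration.integral_cong)
    also have "(\<integral>u. indicator {-w..w} u *\<^sub>R cis (t * u) \<partial>lborel)
      = cis (t * w) / (\<i> * t) - cis (t * (-w)) / (\<i> * t)"
    proof (rule integral_FTC_atLeastAtMost)
      show "((\<lambda>u. cis (t * u) / (\<i> * t)) has_vector_derivative cis (t * x)) (at x within {- w..w})" for x
        using False unfolding cis_conv_exp
        by (auto intro!: derivative_eq_intros has_vector_derivative_real_field simp: field_simps)
    qed (use w in \<open>auto intro!: continuous_intros\<close>)
    also have "norm ((1/(2*w)) *\<^sub>R (cis (t * w) / (\<i> * t) - cis (t * (-w)) / (\<i> * t))) \<le> (1/(2*w)) * (2 / \<bar>t\<bar>)"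
    proof -
      have "norm (cis (t * w) / (\<i> * t) - cis (t * (-w)) / (\<i> * t)) \<le> 1 / \<bar>t\<bar> + 1 / \<bar>t\<bar>"
        by (rule order_trans[OF norm_triangle_ineq4]) (simp add: norm_divide norm_mult)
      then have "(1/(2*w)) * norm (cis (t * w) / (\<i> * t) - cis (t * (-w)) / (\<i> * t)) \<le> (1/(2*w)) * (2 / \<bar>t\<bar>)"
        using w by (intro mult_left_mono) auto
      then show ?thesis using w by simp
    qed
    finally show ?thesis using w False by (simp add: field_simps)
  qed (use w in auto)
  show ?thesis using 1 2 3 by (intro exI[of _ U]) (auto simp: U_def)
qed

lemma integral_inverse_square_finite: "(\<integral>\<^sup>+t. ennreal (1 / (1 + \<bar>t\<bar>)^2) \<partial>(lborel::real measure)) < \<infinity>"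
proof -
  have "(\<integral>\<^sup>+t. ennreal (1 / (1 + \<bar>t\<bar>)^2) \<partial>(lborel::real measure)) \<le> (\<integral>\<^sup>+t. ennreal (norm (inverse (1+t^2))) \<partial>(lborel::real measure))"
  proof (intro nn_integral_mono ennreal_leI)
    fix t :: real
    have "1 + t^2 \<le> (1 + \<bar>t\<bar>)^2" by (simp add: power2_eq_square algebra_simps)
    moreover have "0 < 1 + t^2" by (simp add: add_pos_nonneg)
    ultimately show "1 / (1 + \<bar>t\<bar>)^2 \<le> norm (inverse (1+t^2))"
      by (simp add: divide_simps)
  qed
  also have "\<dots> < \<infinity>"
    using integrable_inverse_1_plus_square by (simp add: set_integrable_def integrable_iff_bounded)
  finally show ?thesis .
qed

text \<open>The Fourier transform is a product over coordinates of m-th powers, each of order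
  (1+|t|)^-m. As 1 + norm \<xi> is at most the product of the 1 + |\<xi> $ c|, the weight uses up
  CARD('n)+1 of the m = CARD('n)+2 powers and one is left for integrability. Within the weight, the
  exponent CARD('n) later drives the decay above the noise frequency, and the extra 1 absorbs the
  factor norm \<xi> of the smoothing error.\<close>

lemma compactly_supported_noise:
  fixes r :: nat
  assumes r: "2 \<le> r"
  obtains \<phi> :: "(real^'n) measure" where "prob_space \<phi>" "sets \<phi> = sets borel"
    "AE y in \<phi>. norm y \<le> 1"
    "(\<integral>\<^sup>+\<xi>. ennreal ((norm (fourier_measure \<phi> \<xi>) * (1 + norm \<xi>)^(CARD('n)+1))^r) \<partial>lborel) < \<infinity>"
proof -
  \<comment> \<open>The noise is a sum of \<open>m\<close> independent uniform variables in each coordinate.\<close>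
  define m where "m = CARD('n) + 2"
  define w where "w = 1 / (real CARD('n) * real m)"
  have w: "w > 0" by (auto simp: w_def m_def)
  obtain U :: "real measure" where U: "prob_space U" "sets U = sets borel" "AE u in U. \<bar>u\<bar> \<le> w"
    and Ud: "\<And>t. norm (\<integral>u. cis (t * u) \<partial>U) * \<bar>t\<bar> \<le> 1 / w"
    using uniform_characteristic_decay[OF w] by metis
  note [measurable_cong] = U(2)
  interpret U: prob_space U by fact
  define J where "J = (UNIV :: 'n set) \<times> {..<m}"
  have J: "finite J" by (auto simp: J_def)
  interpret P: product_prob_space "\<lambda>_. U" J by standard
  define P where "P = Pi\<^sub>M J (\<lambda>_. U)"
  interpret PP: prob_space P unfolding P_def by (rule prob_space_PiM) (rule U(1))
  define Y where "Y = (\<lambda>\<omega>::'n \<times> nat \<Rightarrow> real. (\<chi> c. \<Sum>s<m. \<omega> (c, s)) :: real^'n)"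
  have Y_inner: "Y \<omega> \<bullet> \<xi> = (\<Sum>z\<in>J. \<omega> z * \<xi> $ fst z)" for \<omega> \<xi>
    by (simp add: Y_def J_def inner_vec_def sum_distrib_right sum.cartesian_product case_prod_unfold)
  have Ym [measurable]: "Y \<in> borel_measurable P"
  proof (subst borel_measurable_euclidean_space, intro ballI)
    fix b :: "real^'n"
    have "(\<lambda>\<omega>. \<Sum>z\<in>J. \<omega> z * b $ fst z) \<in> borel_measurable P"
      unfolding P_def by measurable
    then show "(\<lambda>\<omega>. Y \<omega> \<bullet> b) \<in> borel_measurable P" by (simp add: Y_inner)
  qed
  define \<phi> where "\<phi> = distr P borel Y"
  have p1: "prob_space \<phi>" unfolding \<phi>_def by (rule PP.prob_space_distr) (rule Ym)
  have p2: "sets \<phi> = sets borel" by (simp add: \<phi>_def)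
  have p3: "AE y in \<phi>. norm y \<le> 1"
  proof -
    have "AE \<omega> in P. \<bar>\<omega> z\<bar> \<le> w" if "z \<in> J" for z
      unfolding P_def using U(1,3) that by (intro AE_PiM_component) auto
    then have "AE \<omega> in P. \<forall>z\<in>J. \<bar>\<omega> z\<bar> \<le> w"
      using J by (simp add: AE_finite_all)
    then have "AE \<omega> in P. norm (Y \<omega>) \<le> 1"
    proof eventually_elim
      case (elim \<omega>)
      have "norm (Y \<omega>) \<le> (\<Sum>c\<in>UNIV. \<bar>Y \<omega> $ c\<bar>)" by (rule norm_le_l1_cart)
      also have "\<dots> \<le> (\<Sum>c\<in>(UNIV::'n set). \<Sum>s<m. w)"
      proof (rule sum_mono)
        fix c
        have "\<bar>Y \<omega> $ c\<bar> \<le> (\<Sum>s<m. \<bar>\<omega> (c,s)\<bar>)" by (simp add: Y_def)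
        also have "\<dots> \<le> (\<Sum>s<m. w)" using elim by (intro sum_mono) (auto simp: J_def)
        finally show "\<bar>Y \<omega> $ c\<bar> \<le> (\<Sum>s<m. w)" .
      qed
      also have "\<dots> = 1" by (simp add: w_def m_def)
      finally show ?case .
    qed
    then show ?thesis unfolding \<phi>_def by (subst AE_distr_iff) auto
  qed
  define u where "u = (\<lambda>t::real. \<integral>x. cis (-2 * pi * t * x) \<partial>U)"
  have u1: "norm (u t) \<le> 1" for t
  proof -
    have "norm (u t) \<le> (\<integral>x. norm (cis (-2 * pi * t * x)) \<partial>U)"
      unfolding u_def by (rule integral_norm_bound)
    then show ?thesis by (simp add: U.prob_space)
  qed
  define C where "C = 1 + 1 / w"
  have C: "C > 0" using w by (simp add: C_def add_pos_pos)
  have u2: "norm (u t) \<le> C / (1 + \<bar>t\<bar>)" for t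
  proof -
    have "norm (u t) * \<bar>t\<bar> \<le> norm (u t) * \<bar>-2 * pi * t\<bar>"
      using pi_gt3 by (intro mult_left_mono) (auto simp: abs_mult intro!: mult_right_mono[of 1 "2*pi" "\<bar>t\<bar>", simplified])
    also have "\<dots> \<le> 1 / w" using Ud[of "-2 * pi * t"] by (simp add: u_def)
    finally have "norm (u t) * (1 + \<bar>t\<bar>) \<le> C" using u1[of t] by (simp add: C_def algebra_simps)
    then show ?thesis by (simp add: pos_le_divide_eq)
  qed
  have four: "fourier_measure \<phi> \<xi> = (\<Prod>c\<in>UNIV. u (\<xi> $ c) ^ m)" for \<xi>
  proof -
    have "fourier_measure \<phi> \<xi> = (\<integral>\<omega>. cis (-2 * pi * (Y \<omega> \<bullet> \<xi>)) \<partial>P)"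
      unfolding fourier_measure_def \<phi>_def by (rule integral_distr) (measurable)
    also have "\<dots> = (\<integral>\<omega>. (\<Prod>z\<in>J. cis (-2 * pi * \<xi> $ fst z * \<omega> z)) \<partial>P)"
      by (simp add: Y_inner sum_distrib_left cis_sum[OF J, symmetric] mult_ac sum_negf)
    also have "\<dots> = (\<Prod>z\<in>J. u (\<xi> $ fst z))"
      unfolding P_def u_def
      by (rule P.product_integral_prod[OF J]) (auto intro!: U.integrable_const_bound[of _ 1])
    also have "\<dots> = (\<Prod>c\<in>UNIV. u (\<xi> $ c) ^ m)"
      using prod.cartesian_product[of "\<lambda>c s. u (\<xi> $ c)" "{..<m}" UNIV] by (simp add: J_def case_prod_unfold)
    finally show ?thesis .
  qed
  define D where "D = (C^m)^CARD('n)"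
  have bound: "norm (fourier_measure \<phi> \<xi>) * (1 + norm \<xi>)^(CARD('n)+1) \<le> D * (\<Prod>c\<in>UNIV. 1 / (1 + \<bar>\<xi> $ c\<bar>))" for \<xi>
  proof -
    have "norm (fourier_measure \<phi> \<xi>) \<le> (\<Prod>c\<in>(UNIV::'n set). (C / (1 + \<bar>\<xi> $ c\<bar>))^m)"
      unfolding four by (auto simp: norm_power prod_norm[symmetric] intro!: prod_mono power_mono u2)
    also have "\<dots> = D / (\<Prod>c\<in>UNIV. 1 + \<bar>\<xi> $ c\<bar>) ^ m"
      by (simp add: power_divide prod_dividef D_def prod_power_distrib)
    finally have a: "norm (fourier_measure \<phi> \<xi>) \<le> D / (\<Prod>c\<in>UNIV. 1 + \<bar>\<xi> $ c\<bar>) ^ m" .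
    have "1 + norm \<xi> \<le> 1 + (\<Sum>c\<in>UNIV. \<bar>\<xi> $ c\<bar>)" using norm_le_l1_cart[of \<xi>] by simp
    also have "\<dots> \<le> (\<Prod>c\<in>UNIV. 1 + \<bar>\<xi> $ c\<bar>)" by (rule one_plus_sum_le_prod) auto
    finally have "(1 + norm \<xi>)^(CARD('n)+1) \<le> (\<Prod>c\<in>UNIV. 1 + \<bar>\<xi> $ c\<bar>)^(CARD('n)+1)"
      by (intro power_mono) auto
    then have "norm (fourier_measure \<phi> \<xi>) * (1 + norm \<xi>)^(CARD('n)+1) \<le>
       D / (\<Prod>c\<in>UNIV. 1 + \<bar>\<xi> $ c\<bar>) ^ m * (\<Prod>c\<in>UNIV. 1 + \<bar>\<xi> $ c\<bar>)^(CARD('n)+1)"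
      using C a by (intro mult_mono) (auto simp: D_def intro!: divide_nonneg_nonneg prod_nonneg zero_le_power)
    also have "(\<Prod>c\<in>UNIV. 1 + \<bar>\<xi> $ c\<bar>) > 0" by (intro prod_pos) (auto simp: add_pos_nonneg)
    then have "D / (\<Prod>c\<in>UNIV. 1 + \<bar>\<xi> $ c\<bar>) ^ m * (\<Prod>c\<in>UNIV. 1 + \<bar>\<xi> $ c\<bar>)^(CARD('n)+1)
      = D * (\<Prod>c\<in>UNIV. 1 / (1 + \<bar>\<xi> $ c\<bar>))"
      by (simp add: m_def prod_dividef divide_simps)
    finally show ?thesis .
  qed
  have "(\<integral>\<^sup>+\<xi>. ennreal ((norm (fourier_measure \<phi> \<xi>) * (1 + norm \<xi>)^(CARD('n)+1))^r) \<partial>lborel)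
     \<le> (\<integral>\<^sup>+\<xi>. ennreal (D^r) * (\<Prod>b\<in>Basis. ennreal (1 / (1 + \<bar>\<xi> \<bullet> b\<bar>)^2)) \<partial>(lborel::(real^'n) measure))"
  proof (intro nn_integral_mono)
    fix \<xi> :: "real^'n"
    have z: "0 \<le> (\<Prod>c\<in>UNIV. 1 / (1 + \<bar>\<xi> $ c\<bar>))" "(\<Prod>c\<in>UNIV. 1 / (1 + \<bar>\<xi> $ c\<bar>)) \<le> 1"
      by (auto intro!: prod_nonneg prod_le_1)
    have "(norm (fourier_measure \<phi> \<xi>) * (1 + norm \<xi>)^(CARD('n)+1))^r
       \<le> (D * (\<Prod>c\<in>UNIV. 1 / (1 + \<bar>\<xi> $ c\<bar>)))^r"
      by (intro power_mono bound) auto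
    \<comment> \<open>The remaining product lies in [0, 1], so r >= 2 allows passing from its r-th
      power to its square, which factors into integrable functions of one variable.\<close>
    also have "\<dots> \<le> D^r * (\<Prod>c\<in>UNIV. 1 / (1 + \<bar>\<xi> $ c\<bar>))^2"
      unfolding power_mult_distrib using C r z
      by (intro mult_left_mono power_decreasing) (auto simp: D_def)
    also have "(\<Prod>c\<in>UNIV. 1 / (1 + \<bar>\<xi> $ c\<bar>))^2 = (\<Prod>b\<in>Basis. 1 / (1 + \<bar>\<xi> \<bullet> b\<bar>)^2)"
      by (simp add: Basis_vec_def prod_power_distrib power_divide cart_eq_inner_axis UNION_singleton_eq_range
          prod.reindex inj_on_def axis_eq_axis)
    finally show "ennreal ((norm (fourier_measure \<phi> \<xi>) * (1 + norm \<xi>)^(CARD('n)+1))^r) \<le>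
      ennreal (D^r) * (\<Prod>b\<in>Basis. ennreal (1 / (1 + \<bar>\<xi> \<bullet> b\<bar>)^2))"
      using C by (subst prod_ennreal) (auto simp: D_def simp flip: ennreal_mult' intro!: ennreal_leI)
  qed
  also have "\<dots> = ennreal (D^r) * (\<Prod>b\<in>(Basis::(real^'n) set). \<integral>\<^sup>+t. ennreal (1 / (1 + \<bar>t\<bar>)^2) \<partial>lborel)"
    using nn_integral_lborel_prod[where 'a = "real^'n", of "\<lambda>_ t. ennreal (1 / (1 + \<bar>t\<bar>)^2)"]
    by (subst nn_integral_cmult) auto
  also have "\<dots> < \<infinity>"
    using integral_inverse_square_finite by (simp add: ennreal_mult_less_top power_less_top_ennreal)
  finally show ?thesis using that p1 p2 p3 by blast
qed

section \<open>Random sampling\<close>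

lemma power_even_le_exp_add_exp:
  fixes x :: real
  shows "x ^ (2*h) \<le> fact (2*h) * (exp x + exp (-x))"
proof -
  have "\<bar>x\<bar> ^ (2*h) / fact (2*h) \<le> exp \<bar>x\<bar>"
    using sum_le_suminf[OF summable_exp_generic[of "\<bar>x\<bar>"], of "{2*h}"]
    by (simp add: exp_def divide_inverse mult.commute)
  also have "\<dots> \<le> exp x + exp (-x)" by (cases "x \<ge> 0") auto
  finally have "\<bar>x\<bar> ^ (2*h) \<le> fact (2*h) * (exp x + exp (-x))" by (simp add: field_simps)
  then show ?thesis by (simp add: power_mult)
qed

text \<open>Hoeffding's lemma for values in [-1, 1] bounds each factor by exp(l^2). With l = 1 /
  sqrt(card J) the card J independent factors multiply to a bound that is free of card J.\<close>

lemma exp_centered_sum_bound: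
  fixes P :: "'i \<Rightarrow> 'a measure" and g :: "'i \<Rightarrow> 'a \<Rightarrow> real"
  assumes J: "finite J" "J \<noteq> {}" and P: "\<And>i. prob_space (P i)"
    and g: "\<And>i. i \<in> J \<Longrightarrow> g i \<in> borel_measurable (P i)" "\<And>i y. \<bar>g i y\<bar> \<le> 1"
  shows "(\<integral>\<^sup>+\<omega>. exp ((\<Sum>i\<in>J. g i (\<omega> i) - (\<integral>y. g i y \<partial>P i)) / sqrt (card J)) \<partial>Pi\<^sub>M J P) \<le> ennreal (exp 1)"
proof -
  interpret P: product_prob_space P J by (intro product_prob_spaceI P)
  define l where "l = 1 / sqrt (card J)"
  have l: "l > 0" and l2: "card J * l^2 = 1" using J by (auto simp: l_def card_gt_0_iff power_divide)
  have "(\<integral>\<^sup>+\<omega>. exp ((\<Sum>i\<in>J. g i (\<omega> i) - (\<integral>y. g i y \<partial>P i)) / sqrt (card J)) \<partial>Pi\<^sub>M J P)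
    = (\<integral>\<^sup>+\<omega>. (\<Prod>i\<in>J. ennreal (exp (l * (g i (\<omega> i) - (\<integral>y. g i y \<partial>P i))))) \<partial>Pi\<^sub>M J P)"
    using J by (intro nn_integral_cong) (simp add: prod_ennreal exp_sum[symmetric] l_def sum_divide_distrib)
  also have "\<dots> = (\<Prod>i\<in>J. \<integral>\<^sup>+y. ennreal (exp (l * (g i y - (\<integral>y. g i y \<partial>P i)))) \<partial>P i)"
    using g(1) by (intro P.product_nn_integral_prod J) auto
  also have "\<dots> \<le> (\<Prod>i\<in>J. ennreal (exp (l^2)))"
  proof (intro prod_mono_ennreal)
    fix i assume i: "i \<in> J"
    interpret Pi: prob_space "P i" by (rule P)
    interpret I: interval_bounded_random_variable "P i" "g i" "-1" 1
      using g(1)[OF i] g(2)[of i] by unfold_locales (auto simp: abs_le_iff minus_le_iff)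
    have "(\<integral>\<^sup>+y. ennreal (exp (l * (g i y - (\<integral>y. g i y \<partial>P i)))) \<partial>P i) \<le> ennreal (exp (l\<^sup>2 * (1 - (-1))\<^sup>2 / 8))"
      by (rule I.Hoeffdings_lemma_nn_integral) (rule l)
    also have "\<dots> \<le> ennreal (exp (l^2))" by (intro ennreal_leI) (auto simp: power2_eq_square)
    finally show "(\<integral>\<^sup>+y. ennreal (exp (l * (g i y - (\<integral>y. g i y \<partial>P i)))) \<partial>P i) \<le> ennreal (exp (l^2))" .
  qed
  also have "\<dots> = ennreal (exp 1)"
    using l2 by (simp add: ennreal_power exp_of_nat_mult[symmetric])
  finally show ?thesis .
qed

text \<open>Square-root cancellation: the 2h-th moment is of order card J ^ h, with a constant
  independent of the laws P i. It comes from the exponential moments of the sum and of its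
  negative.\<close>

lemma even_moment_centered_sum:
  fixes P :: "'i \<Rightarrow> 'a measure" and g :: "'i \<Rightarrow> 'a \<Rightarrow> real"
  assumes J: "finite J" "J \<noteq> {}" and P: "\<And>i. prob_space (P i)"
    and g: "\<And>i. i \<in> J \<Longrightarrow> g i \<in> borel_measurable (P i)" "\<And>i y. \<bar>g i y\<bar> \<le> 1"
  shows "(\<integral>\<^sup>+\<omega>. ennreal ((\<Sum>i\<in>J. g i (\<omega> i) - (\<integral>y. g i y \<partial>P i)) ^ (2*h)) \<partial>Pi\<^sub>M J P)
    \<le> ennreal (2 * fact (2*h) * exp 1 * real (card J) ^ h)"
proof -
  define S where "S = (\<lambda>\<omega>. \<Sum>i\<in>J. g i (\<omega> i) - (\<integral>y. g i y \<partial>P i))"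
  define N where "N = real (card J)"
  have N: "N > 0" using J by (simp add: N_def card_gt_0_iff)
  have [measurable]: "(\<lambda>\<omega>. g i (\<omega> i)) \<in> borel_measurable (Pi\<^sub>M J P)" if "i \<in> J" for i
    by (rule measurable_compose[OF measurable_component_singleton[of i J P] g(1)]) (use that in auto)
  have [measurable]: "S \<in> borel_measurable (Pi\<^sub>M J P)"
    unfolding S_def by measurable
  have e1: "(\<integral>\<^sup>+\<omega>. exp (S \<omega> / sqrt N) \<partial>Pi\<^sub>M J P) \<le> ennreal (exp 1)"
    unfolding S_def N_def by (rule exp_centered_sum_bound) (use assms in auto)
  have e2: "(\<integral>\<^sup>+\<omega>. exp (- S \<omega> / sqrt N) \<partial>Pi\<^sub>M J P) \<le> ennreal (exp 1)"
    using exp_centered_sum_bound[OF J P, where g = "\<lambda>i y. - g i y"] g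
    unfolding S_def N_def by (simp add: sum_negf[symmetric] sum_subtractf)
  have pt: "S \<omega> ^ (2*h) \<le> fact (2*h) * N^h * (exp (S \<omega> / sqrt N) + exp (- S \<omega> / sqrt N))" for \<omega>
  proof -
    have "S \<omega> ^ (2*h) = N^h * (S \<omega> / sqrt N) ^ (2*h)"
      using N by (simp add: power_divide power_mult)
    also have "\<dots> \<le> N^h * (fact (2*h) * (exp (S \<omega> / sqrt N) + exp (- (S \<omega> / sqrt N))))"
      using N by (intro mult_left_mono power_even_le_exp_add_exp) auto
    finally show ?thesis by (simp add: mult_ac)
  qed
  have "(\<integral>\<^sup>+\<omega>. ennreal (S \<omega> ^ (2*h)) \<partial>Pi\<^sub>M J P) \<le>
    (\<integral>\<^sup>+\<omega>. ennreal (fact (2*h) * N^h) * (ennreal (exp (S \<omega> / sqrt N)) + ennreal (exp (- S \<omega> / sqrt N))) \<partial>Pi\<^sub>M J P)"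
    using N pt by (intro nn_integral_mono) (simp flip: ennreal_mult' ennreal_plus)
  also have "\<dots> = ennreal (fact (2*h) * N^h) * ((\<integral>\<^sup>+\<omega>. exp (S \<omega> / sqrt N) \<partial>Pi\<^sub>M J P) + (\<integral>\<^sup>+\<omega>. exp (- S \<omega> / sqrt N) \<partial>Pi\<^sub>M J P))"
    by (simp add: nn_integral_cmult nn_integral_add)
  also have "\<dots> \<le> ennreal (fact (2*h) * N^h) * (ennreal (exp 1) + ennreal (exp 1))"
    by (intro mult_left_mono add_mono e1 e2) auto
  also have "\<dots> = ennreal (2 * fact (2*h) * exp 1 * N ^ h)"
    using N by (simp add: mult_ac flip: ennreal_mult' ennreal_plus)
  finally show ?thesis unfolding S_def N_def .
qed

lemma norm_complex_even_power_le:
  "norm (z::complex) ^ (2*h) \<le> 2^h * (Re z ^ (2*h) + Im z ^ (2*h))"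
proof -
  define a b where "a = (Re z)^2" and "b = (Im z)^2"
  have ab: "a \<ge> 0" "b \<ge> 0" by (auto simp: a_def b_def)
  have "norm z ^ (2*h) = (a + b)^h" by (simp add: power_mult cmod_power2 a_def b_def)
  also have "\<dots> \<le> (2 * max a b)^h" using ab by (intro power_mono) auto
  also have "\<dots> = 2^h * (max a b)^h" by (simp add: power_mult_distrib)
  also have "(max a b)^h \<le> a^h + b^h" using ab by (auto simp: max_def)
  finally show ?thesis by (simp add: power_mult a_def b_def)
qed

text \<open>First-moment method, retaining an almost sure property of the chosen point.\<close>

lemma (in prob_space) exists_le_nn_integral:
  assumes [measurable]: "f \<in> borel_measurable M" and le: "(\<integral>\<^sup>+x. f x \<partial>M) \<le> c" and c: "c < \<infinity>"
    and Q: "AE x in M. Q x"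
  shows "\<exists>x\<in>space M. Q x \<and> f x \<le> c"
proof (rule ccontr)
  assume *: "\<not> ?thesis"
  then have gt: "AE x in M. c < f x" using Q by (rule_tac AE_mp[OF Q]) (auto simp: not_le intro!: AE_I2)
  have "(\<integral>\<^sup>+x. c \<partial>M) < (\<integral>\<^sup>+x. f x \<partial>M)"
  proof (rule nn_integral_less)
    show "\<not> (AE x in M. f x \<le> c)"
    proof
      assume "AE x in M. f x \<le> c"
      with gt have "AE x in M. False" by eventually_elim auto
      then show False using AE_False emeasure_space_1 by auto
    qed
  qed (use gt c in \<open>auto simp: emeasure_space_1 elim!: eventually_mono\<close>)
  then show False using le by (simp add: emeasure_space_1)
qed

text \<open>The 4 counts real and imaginary part, each with the two exponentials behind
  \<open>even_moment_centered_sum\<close>; 2^h is the price of the splitting.\<close>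

definition selection_const :: "nat \<Rightarrow> real" where
  "selection_const h = 2^h * (4 * fact (2*h) * exp 1)"

lemma selection_const_pos: "selection_const h > 0"
  by (simp add: selection_const_def)

lemma norm_fourier_measure_le_1:
  assumes "prob_space \<mu>" shows "norm (fourier_measure \<mu> \<xi>) \<le> 1"
proof -
  interpret prob_space \<mu> by fact
  have "norm (fourier_measure \<mu> \<xi>) \<le> (\<integral>x. norm (cis (- 2 * pi * (x \<bullet> \<xi>))) \<partial>\<mu>)"
    unfolding fourier_measure_def by (rule integral_norm_bound)
  then show ?thesis by (simp add: prob_space)
qed

lemma borel_measurable_fourier_measure:
  assumes "prob_space \<mu>" "sets \<mu> = sets borel" shows "fourier_measure \<mu> \<in> borel_measurable borel"
proof -
  interpret prob_space \<mu> by fact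
  note [measurable_cong] = assms(2)
  show ?thesis unfolding fourier_measure_def by measurable
qed

text \<open>Fubini reduces the expected weighted integral to the moment at one fixed frequency, and
  that bound is uniform in \<xi>. One choice of points is therefore good for all frequencies in the
  integrated sense. The property Q will keep each sample near the centre of its cell.\<close>

lemma random_frequency_selection:
  fixes P :: "'i \<Rightarrow> ('a::euclidean_space) measure" and W :: "'a \<Rightarrow> ennreal"
  assumes J: "finite J" "J \<noteq> {}" and P: "\<And>i. prob_space (P i)" "\<And>i. sets (P i) = sets borel"
    and B: "\<And>i. i \<in> J \<Longrightarrow> AE y in P i. Q i y"
    and W [measurable]: "W \<in> borel_measurable borel" and Wfin: "(\<integral>\<^sup>+\<xi>. W \<xi> \<partial>lborel) < \<infinity>"
  shows "\<exists>y. (\<forall>i\<in>J. Q i (y i)) \<and>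
    (\<integral>\<^sup>+\<xi>. ennreal (norm (\<Sum>i\<in>J. cis (-2 * pi * (y i \<bullet> \<xi>)) - fourier_measure (P i) \<xi>) ^ (2*h)) * W \<xi> \<partial>lborel)
      \<le> ennreal (selection_const h * real (card J) ^ h) * (\<integral>\<^sup>+\<xi>. W \<xi> \<partial>lborel)"
proof -
  note [measurable_cong] = P(2)
  interpret P: product_prob_space P J by (intro product_prob_spaceI P)
  have PJ: "prob_space (Pi\<^sub>M J P)" by (rule prob_space_PiM) (rule P)
  interpret pair_sigma_finite "lborel :: 'a measure" "Pi\<^sub>M J P" by standard
  define E where "E = (\<lambda>\<xi> y. \<Sum>i\<in>J. cis (-2 * pi * (y i \<bullet> \<xi>)) - fourier_measure (P i) \<xi>)"
  note [measurable] = borel_measurable_fourier_measure[OF P]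
  have [measurable]: "(\<lambda>(\<xi>, y). E \<xi> y) \<in> borel_measurable (lborel \<Otimes>\<^sub>M Pi\<^sub>M J P)"
    unfolding E_def by measurable
  have moment: "(\<integral>\<^sup>+y. ennreal (norm (E \<xi> y) ^ (2*h)) \<partial>Pi\<^sub>M J P) \<le> ennreal (selection_const h * real (card J) ^ h)" for \<xi>
  proof -
    define c s where "c = (\<lambda>y::'a. cos (-2 * pi * (y \<bullet> \<xi>)))" and "s = (\<lambda>y::'a. sin (-2 * pi * (y \<bullet> \<xi>)))"
    have [measurable]: "c \<in> borel_measurable borel" "s \<in> borel_measurable borel"
      unfolding c_def s_def by measurable
    have int: "integrable (P i) (\<lambda>y. cis (-2 * pi * (y \<bullet> \<xi>)))" for i
    proof -
      interpret prob_space "P i" by (rule P)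
      show ?thesis by (rule Bochner_Integration.integrable_bound[of "P i" "\<lambda>_. 1::real"]) auto
    qed
    have Re: "Re (E \<xi> y) = (\<Sum>i\<in>J. c (y i) - (\<integral>z. c z \<partial>P i))" for y
      using integral_Re[OF int] by (simp add: E_def fourier_measure_def c_def)
    have Im: "Im (E \<xi> y) = (\<Sum>i\<in>J. s (y i) - (\<integral>z. s z \<partial>P i))" for y
      using integral_Im[OF int] by (simp add: E_def fourier_measure_def s_def)
    have mR: "(\<integral>\<^sup>+y. ennreal (Re (E \<xi> y) ^ (2*h)) \<partial>Pi\<^sub>M J P) \<le> ennreal (2 * fact (2*h) * exp 1 * real (card J) ^ h)"
      unfolding Re by (rule even_moment_centered_sum) (use J P in \<open>auto simp: c_def\<close>)
    have mI: "(\<integral>\<^sup>+y. ennreal (Im (E \<xi> y) ^ (2*h)) \<partial>Pi\<^sub>M J P) \<le> ennreal (2 * fact (2*h) * exp 1 * real (card J) ^ h)"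
      unfolding Im by (rule even_moment_centered_sum) (use J P in \<open>auto simp: s_def\<close>)
    have [measurable]: "(\<lambda>y. Re (E \<xi> y)) \<in> borel_measurable (Pi\<^sub>M J P)" "(\<lambda>y. Im (E \<xi> y)) \<in> borel_measurable (Pi\<^sub>M J P)"
      unfolding E_def by measurable
    have "(\<integral>\<^sup>+y. ennreal (norm (E \<xi> y) ^ (2*h)) \<partial>Pi\<^sub>M J P) \<le>
      (\<integral>\<^sup>+y. ennreal (2^h) * (ennreal (Re (E \<xi> y) ^ (2*h)) + ennreal (Im (E \<xi> y) ^ (2*h))) \<partial>Pi\<^sub>M J P)"
      by (intro nn_integral_mono)
        (auto simp: norm_complex_even_power_le simp flip: ennreal_mult' ennreal_plus)
    also have "\<dots> = ennreal (2^h) * ((\<integral>\<^sup>+y. ennreal (Re (E \<xi> y) ^ (2*h)) \<partial>Pi\<^sub>M J P) + (\<integral>\<^sup>+y. ennreal (Im (E \<xi> y) ^ (2*h)) \<partial>Pi\<^sub>M J P))"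
      by (simp add: nn_integral_cmult nn_integral_add)
    also have "\<dots> \<le> ennreal (2^h) * (ennreal (2 * fact (2*h) * exp 1 * real (card J) ^ h) + ennreal (2 * fact (2*h) * exp 1 * real (card J) ^ h))"
      by (intro mult_left_mono add_mono mR mI) auto
    also have "\<dots> = ennreal (selection_const h * real (card J) ^ h)"
      by (simp add: selection_const_def mult_ac flip: ennreal_mult' ennreal_plus)
    finally show ?thesis .
  qed
  have "(\<integral>\<^sup>+y. (\<integral>\<^sup>+\<xi>. ennreal (norm (E \<xi> y) ^ (2*h)) * W \<xi> \<partial>lborel) \<partial>Pi\<^sub>M J P)
    = (\<integral>\<^sup>+\<xi>. (\<integral>\<^sup>+y. ennreal (norm (E \<xi> y) ^ (2*h)) * W \<xi> \<partial>Pi\<^sub>M J P) \<partial>lborel)"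
    by (rule Fubini') measurable
  also have "\<dots> = (\<integral>\<^sup>+\<xi>. (\<integral>\<^sup>+y. ennreal (norm (E \<xi> y) ^ (2*h)) \<partial>Pi\<^sub>M J P) * W \<xi> \<partial>lborel)"
    by (intro nn_integral_cong nn_integral_multc) measurable
  also have "\<dots> \<le> (\<integral>\<^sup>+\<xi>. ennreal (selection_const h * real (card J) ^ h) * W \<xi> \<partial>lborel)"
    by (intro nn_integral_mono mult_right_mono moment) auto
  also have "\<dots> = ennreal (selection_const h * real (card J) ^ h) * (\<integral>\<^sup>+\<xi>. W \<xi> \<partial>lborel)"
    by (rule nn_integral_cmult) simp
  finally have main: "(\<integral>\<^sup>+y. (\<integral>\<^sup>+\<xi>. ennreal (norm (E \<xi> y) ^ (2*h)) * W \<xi> \<partial>lborel) \<partial>Pi\<^sub>M J P)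
    \<le> ennreal (selection_const h * real (card J) ^ h) * (\<integral>\<^sup>+\<xi>. W \<xi> \<partial>lborel)" .
  have "AE y in Pi\<^sub>M J P. \<forall>i\<in>J. Q i (y i)"
    using J P(1) B by (auto simp: AE_finite_all intro!: AE_PiM_component)
  from prob_space.exists_le_nn_integral[OF PJ _ main _ this] Wfin show ?thesis
    unfolding E_def by (auto simp: ennreal_mult_less_top)
qed

section \<open>Tail norms and Lorentz spaces\<close>

text \<open>The factor in front of $b_j$ is normalised so that $L_{p,q}$ membership becomes $b \in \ell^q$.\<close>
definition tail_bound :: "nat \<Rightarrow> real \<Rightarrow> ('a::euclidean_space \<Rightarrow> complex) \<Rightarrow> (nat \<Rightarrow> real) \<Rightarrow> bool" where
  "tail_bound r p f b \<longleftrightarrow> f \<in> borel_measurable borel \<and> (\<forall>j. 0 < b j \<and>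
     (\<integral>\<^sup>+\<xi>\<in>{\<xi>. 2^j \<le> norm \<xi>}. ennreal (norm (f \<xi>) ^ r) \<partial>lborel)
       \<le> ennreal ((2 powr (real j * real DIM('a) * (1/real r - 1/p)) * b j) ^ r))"

lemma tail_boundD:
  fixes f :: "'a::euclidean_space \<Rightarrow> complex"
  assumes "tail_bound r p f b"
  shows "f \<in> borel_measurable borel" "0 < b j"
    "(\<integral>\<^sup>+\<xi>\<in>{\<xi>. 2^j \<le> norm \<xi>}. ennreal (norm (f \<xi>) ^ r) \<partial>lborel)
       \<le> ennreal ((2 powr (real j * real DIM('a) * (1/real r - 1/p)) * b j) ^ r)"
  using assms by (auto simp: tail_bound_def)

section \<open>Calculus of tail bounds\<close>

lemma two_powr_power: "((2::real) powr x) ^ n = 2 powr (x * real n)"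
  by (simp add: powr_realpow[symmetric] powr_powr)

text \<open>Convexity of t^r with weights a i / A, applied to the normalised functions f i / a i,
  gives a pointwise bound whose integral is at most A^r. Only upper bounds a i occur, never norms;
  dividing by them is why \<open>tail_bound\<close> asks for positive sequences.\<close>

lemma nn_integral_Minkowski:
  fixes f :: "'i \<Rightarrow> 'a \<Rightarrow> complex"
  assumes I: "finite I" "I \<noteq> {}" and r: "even r"
    and f: "\<And>i. i \<in> I \<Longrightarrow> f i \<in> borel_measurable M"
    and a: "\<And>i. i \<in> I \<Longrightarrow> 0 < a i"
    and le: "\<And>i. i \<in> I \<Longrightarrow> (\<integral>\<^sup>+x. ennreal (norm (f i x) ^ r) \<partial>M) \<le> ennreal (a i ^ r)"
  shows "(\<integral>\<^sup>+x. ennreal (norm (\<Sum>i\<in>I. f i x) ^ r) \<partial>M) \<le> ennreal (sum a I ^ r)"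
proof -
  define A where "A = sum a I"
  have A: "A > 0" unfolding A_def using I a by (intro sum_pos) auto
  have pt: "norm (\<Sum>i\<in>I. f i x) ^ r \<le> (\<Sum>i\<in>I. (A^r * (a i / A) / a i ^ r) * norm (f i x) ^ r)" for x
  proof -
    have "norm (\<Sum>i\<in>I. f i x) ^ r \<le> (A * (\<Sum>i\<in>I. (a i / A) *\<^sub>R (norm (f i x) / a i)))^r"
    proof (rule power_mono)
      have "A * (\<Sum>i\<in>I. (a i / A) *\<^sub>R (norm (f i x) / a i)) = (\<Sum>i\<in>I. norm (f i x))"
        unfolding sum_distrib_left using A a by (intro sum.cong) (auto simp: less_imp_neq[symmetric])
      then show "norm (\<Sum>i\<in>I. f i x) \<le> A * (\<Sum>i\<in>I. (a i / A) *\<^sub>R (norm (f i x) / a i))"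
        using norm_sum[of "\<lambda>i. f i x" I] by linarith
    qed auto
    also have "\<dots> = A^r * (\<Sum>i\<in>I. (a i / A) *\<^sub>R (norm (f i x) / a i))^r" by (simp add: power_mult_distrib)
    also have "\<dots> \<le> A^r * (\<Sum>i\<in>I. (a i / A) * (norm (f i x) / a i)^r)"
      using A a I
      by (intro mult_left_mono convex_on_sum[OF I convex_power_even[OF r]])
        (auto simp: A_def sum_divide_distrib[symmetric] less_imp_le)
    also have "\<dots> = (\<Sum>i\<in>I. (A^r * (a i / A) / a i ^ r) * norm (f i x) ^ r)"
      by (simp add: sum_distrib_left power_divide mult_ac)
    finally show ?thesis .
  qed
  have nn: "0 \<le> A^r * (a i / A) / a i ^ r" if "i \<in> I" for i
    using A a[OF that] by (intro divide_nonneg_nonneg mult_nonneg_nonneg) auto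
  have "(\<integral>\<^sup>+x. ennreal (norm (\<Sum>i\<in>I. f i x) ^ r) \<partial>M)
    \<le> (\<integral>\<^sup>+x. (\<Sum>i\<in>I. ennreal (A^r * (a i / A) / a i ^ r) * ennreal (norm (f i x) ^ r)) \<partial>M)"
  proof (intro nn_integral_mono)
    fix x
    have "(\<Sum>i\<in>I. ennreal (A^r * (a i / A) / a i ^ r) * ennreal (norm (f i x) ^ r))
      = ennreal (\<Sum>i\<in>I. (A^r * (a i / A) / a i ^ r) * norm (f i x) ^ r)"
      by (subst sum_ennreal[symmetric], intro mult_nonneg_nonneg nn zero_le_power norm_ge_zero, assumption)
        (intro sum.cong refl ennreal_mult'[symmetric] nn)
    then show "ennreal (norm (\<Sum>i\<in>I. f i x) ^ r) \<le> (\<Sum>i\<in>I. ennreal (A^r * (a i / A) / a i ^ r) * ennreal (norm (f i x) ^ r))"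
      using pt[of x] by (simp add: ennreal_leI)
  qed
  also have "\<dots> = (\<Sum>i\<in>I. ennreal (A^r * (a i / A) / a i ^ r) * (\<integral>\<^sup>+x. ennreal (norm (f i x) ^ r) \<partial>M))"
    using f by (subst nn_integral_sum) (auto simp: nn_integral_cmult)
  also have "\<dots> \<le> (\<Sum>i\<in>I. ennreal (A^r * (a i / A) / a i ^ r) * ennreal (a i ^ r))"
    by (intro sum_mono mult_left_mono le) auto
  also have "\<dots> = ennreal (\<Sum>i\<in>I. A^r * (a i / A))"
    using nn a A by (subst sum_ennreal[symmetric]) (auto simp: less_imp_neq[symmetric] less_imp_le simp flip: ennreal_mult' intro!: sum.cong)
  also have "(\<Sum>i\<in>I. A^r * (a i / A)) = A^r"
    using A by (simp add: sum_distrib_left[symmetric] sum_divide_distrib[symmetric] A_def)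
  finally show ?thesis unfolding A_def .
qed

lemma tail_bound_sum:
  fixes f :: "'i \<Rightarrow> 'a::euclidean_space \<Rightarrow> complex"
  assumes I: "finite I" "I \<noteq> {}" and r: "even r" "r > 0"
    and f: "\<And>i. i \<in> I \<Longrightarrow> tail_bound r p (f i) (b i)"
  shows "tail_bound r p (\<lambda>\<xi>. \<Sum>i\<in>I. f i \<xi>) (\<lambda>j. \<Sum>i\<in>I. b i j)"
proof -
  note fm = tail_boundD(1)[OF f]
  have "(\<integral>\<^sup>+\<xi>\<in>{\<xi>. 2^j \<le> norm \<xi>}. ennreal (norm (\<Sum>i\<in>I. f i \<xi>) ^ r) \<partial>lborel)
       \<le> ennreal ((2 powr (real j * real DIM('a) * (1/real r - 1/p)) * (\<Sum>i\<in>I. b i j)) ^ r)" for j :: nat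
  proof -
    define T where "T = {\<xi>::'a. 2^j \<le> norm \<xi>}"
    have [measurable]: "T \<in> sets borel" unfolding T_def by measurable
    have ind: "ennreal (norm (z::complex) ^ r) * indicator T \<xi> = ennreal (norm (indicator T \<xi> * z) ^ r)" for z \<xi>
      using r by (auto split: split_indicator)
    have "(\<integral>\<^sup>+\<xi>. ennreal (norm (\<Sum>i\<in>I. indicator T \<xi> * f i \<xi>) ^ r) \<partial>lborel)
      \<le> ennreal ((\<Sum>i\<in>I. 2 powr (real j * real DIM('a) * (1/real r - 1/p)) * b i j) ^ r)"
    proof (rule nn_integral_Minkowski[OF I r(1)])
      fix i assume i: "i \<in> I"
      show "(\<lambda>\<xi>. indicator T \<xi> * f i \<xi>) \<in> borel_measurable lborel" using fm[OF i] by simp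
      show "0 < 2 powr (real j * real DIM('a) * (1/real r - 1/p)) * b i j" using tail_boundD(2)[OF f[OF i]] by simp
      show "(\<integral>\<^sup>+\<xi>. ennreal (norm (indicator T \<xi> * f i \<xi>) ^ r) \<partial>lborel) \<le> ennreal ((2 powr (real j * real DIM('a) * (1/real r - 1/p)) * b i j)^r)"
        using tail_boundD(3)[OF f[OF i], of j] by (simp add: T_def[symmetric] ind)
    qed
    then show ?thesis by (simp add: T_def[symmetric] ind sum_distrib_left)
  qed
  moreover have "0 < (\<Sum>i\<in>I. b i j)" for j
    using I tail_boundD(2)[OF f] by (intro sum_pos) auto
  ultimately show ?thesis using fm by (auto simp: tail_bound_def)
qed

lemma tail_bound_add:
  assumes "tail_bound r p f b" "tail_bound r p g c" "even r" "r > 0"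
  shows "tail_bound r p (\<lambda>\<xi>. f \<xi> + g \<xi>) (\<lambda>j. b j + c j)"
  using tail_bound_sum[of "UNIV :: bool set" r p "\<lambda>i. if i then f else g" "\<lambda>i. if i then b else c"] assms
  by (simp add: UNIV_bool add.commute)

lemma tail_bound_mono:
  fixes f g :: "'a::euclidean_space \<Rightarrow> complex"
  assumes f: "tail_bound r p f b" and g: "g \<in> borel_measurable borel" "\<And>\<xi>. norm (g \<xi>) \<le> norm (f \<xi>)"
    and c: "\<And>j. b j \<le> c j"
  shows "tail_bound r p g c"
  unfolding tail_bound_def
proof (intro conjI allI g(1))
  fix j
  show "0 < c j" using tail_boundD(2)[OF f, of j] c[of j] by linarith
  have "(\<integral>\<^sup>+\<xi>\<in>{\<xi>. 2^j \<le> norm \<xi>}. ennreal (norm (g \<xi>) ^ r) \<partial>lborel) \<le> (\<integral>\<^sup>+\<xi>\<in>{\<xi>. 2^j \<le> norm \<xi>}. ennreal (norm (f \<xi>) ^ r) \<partial>lborel)"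
    by (intro nn_integral_mono mult_right_mono ennreal_leI power_mono g) auto
  also have "\<dots> \<le> ennreal ((2 powr (real j * real DIM('a) * (1/real r - 1/p)) * b j) ^ r)" by (rule tail_boundD(3)[OF f])
  also have "\<dots> \<le> ennreal ((2 powr (real j * real DIM('a) * (1/real r - 1/p)) * c j) ^ r)"
    using tail_boundD(2)[OF f, of j] by (intro ennreal_leI power_mono mult_left_mono c) auto
  finally show "(\<integral>\<^sup>+\<xi>\<in>{\<xi>. 2^j \<le> norm \<xi>}. ennreal (norm (g \<xi>) ^ r) \<partial>lborel) \<le> \<dots>" .
qed

lemma tail_bound_cmult:
  fixes f :: "'a::euclidean_space \<Rightarrow> complex"
  assumes f: "tail_bound r p f b" and k: "k \<noteq> 0"
  shows "tail_bound r p (\<lambda>\<xi>. k * f \<xi>) (\<lambda>j. norm k * b j)"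
  unfolding tail_bound_def
proof (intro conjI allI)
  note [measurable] = tail_boundD(1)[OF f]
  show "(\<lambda>\<xi>. k * f \<xi>) \<in> borel_measurable borel" by measurable
  fix j :: nat
  show "0 < norm k * b j" using tail_boundD(2)[OF f, of j] k by simp
  have "(\<integral>\<^sup>+\<xi>\<in>{\<xi>. 2^j \<le> norm \<xi>}. ennreal (norm (k * f \<xi>) ^ r) \<partial>lborel)
    = (\<integral>\<^sup>+\<xi>. ennreal (norm k ^ r) * (ennreal (norm (f \<xi>) ^ r) * indicator {\<xi>. 2^j \<le> norm \<xi>} \<xi>) \<partial>lborel)"
    by (simp add: norm_mult power_mult_distrib ennreal_mult' mult_ac)
  also have "\<dots> = ennreal (norm k ^ r) * (\<integral>\<^sup>+\<xi>\<in>{\<xi>. 2^j \<le> norm \<xi>}. ennreal (norm (f \<xi>) ^ r) \<partial>lborel)"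
    by (rule nn_integral_cmult) measurable
  also have "\<dots> \<le> ennreal (norm k ^ r) * ennreal ((2 powr (real j * real DIM('a) * (1/real r - 1/p)) * b j) ^ r)"
    by (intro mult_left_mono tail_boundD(3)[OF f]) auto
  also have "\<dots> = ennreal ((2 powr (real j * real DIM('a) * (1/real r - 1/p)) * (norm k * b j)) ^ r)"
    by (simp add: power_mult_distrib mult_ac flip: ennreal_mult')
  finally show "(\<integral>\<^sup>+\<xi>\<in>{\<xi>. 2^j \<le> norm \<xi>}. ennreal (norm (k * f \<xi>) ^ r) \<partial>lborel) \<le> \<dots>" .
qed

text \<open>Fatou's lemma on each exterior region. It will carry the bound over to the limit
  measure, whose transform arises as a pointwise limit.\<close>

lemma tail_bound_LIMSEQ:
  fixes f :: "nat \<Rightarrow> 'a::euclidean_space \<Rightarrow> complex"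
  assumes f: "\<And>n. tail_bound r p (f n) b" and lim: "\<And>\<xi>. (\<lambda>n. f n \<xi>) \<longlonglongrightarrow> g \<xi>"
  shows "tail_bound r p g b"
  unfolding tail_bound_def
proof (intro conjI allI)
  note [measurable] = tail_boundD(1)[OF f]
  show "g \<in> borel_measurable borel" by (rule borel_measurable_LIMSEQ_metric[OF _ lim]) measurable
  fix j :: nat
  show "0 < b j" using tail_boundD(2)[OF f] by simp
  have "liminf (\<lambda>n. ennreal (norm (f n \<xi>) ^ r) * indicator {\<xi>. 2^j \<le> norm \<xi>} \<xi>) = ennreal (norm (g \<xi>) ^ r) * indicator {\<xi>. 2^j \<le> norm \<xi>} \<xi>" for \<xi>
    by (intro lim_imp_Liminf) (auto split: split_indicator intro!: tendsto_ennrealI tendsto_intros lim)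
  then have "(\<integral>\<^sup>+\<xi>\<in>{\<xi>. 2^j \<le> norm \<xi>}. ennreal (norm (g \<xi>) ^ r) \<partial>lborel)
    = (\<integral>\<^sup>+\<xi>. liminf (\<lambda>n. ennreal (norm (f n \<xi>) ^ r) * indicator {\<xi>. 2^j \<le> norm \<xi>} \<xi>) \<partial>lborel)" by simp
  also have "\<dots> \<le> liminf (\<lambda>n. \<integral>\<^sup>+\<xi>\<in>{\<xi>. 2^j \<le> norm \<xi>}. ennreal (norm (f n \<xi>) ^ r) \<partial>lborel)"
    by (rule nn_integral_liminf) measurable
  also have "\<dots> \<le> liminf (\<lambda>n::nat. ennreal ((2 powr (real j * real DIM('a) * (1/real r - 1/p)) * b j) ^ r))"
    by (intro Liminf_mono always_eventually allI tail_boundD(3)[OF f])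
  also have "\<dots> = ennreal ((2 powr (real j * real DIM('a) * (1/real r - 1/p)) * b j) ^ r)" by (simp add: Liminf_const)
  finally show "(\<integral>\<^sup>+\<xi>\<in>{\<xi>. 2^j \<le> norm \<xi>}. ennreal (norm (g \<xi>) ^ r) \<partial>lborel) \<le> \<dots>" .
qed

text \<open>The hypothesis describes a function living at frequencies up to 2^k and decaying like
  the power -d beyond. For j <= k the full integral is used, and the mismatch of 1/p and 1/r yields
  exactly the stated decay. For j > k the weight gains 2^(-d(j-k)), which is more than required
  because p >= 2.\<close>

lemma tail_bound_of_weighted_integral:
  fixes g :: "'a::euclidean_space \<Rightarrow> complex" and k :: nat
  assumes g [measurable]: "g \<in> borel_measurable borel" and p: "2 \<le> p" and r: "r > 0" and V: "V > 0"
    and le: "(\<integral>\<^sup>+\<xi>. ennreal ((norm (g \<xi>) * (1 + 2 powr (- real k) * norm \<xi>) ^ DIM('a)) ^ r) \<partial>lborel) \<le> ennreal (V^r * 2 powr (real k * real DIM('a)))"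
  shows "tail_bound r p g (\<lambda>j. V * 2 powr (real k * real DIM('a) / p) * 2 powr (- (real DIM('a) * (1/p - 1/real r)) * \<bar>real j - real k\<bar>))"
  unfolding tail_bound_def
proof (intro conjI allI g)
  fix j :: nat
  define d where "d = real DIM('a)"
  have d: "d > 0" by (simp add: d_def)
  \<comment> \<open>The number of octaves by which j exceeds k; outside the ball of radius 2^j the
    weight is at least 2^(s d).\<close>
  define s where "s = (if j \<le> k then 0 else real j - real k)"
  show "0 < V * 2 powr (real k * real DIM('a) / p) * 2 powr (- (real DIM('a) * (1/p - 1/real r)) * \<bar>real j - real k\<bar>)" using V by simp
  have w: "(1 + 2 powr (- real k) * norm \<xi>) ^ DIM('a) \<ge> 2 powr (s * d)" if "2^j \<le> norm \<xi>" for \<xi> :: 'a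
  proof -
    have "2 powr s \<le> 1 + 2 powr (- real k) * norm \<xi>"
    proof (cases "j \<le> k")
      case False
      have "2 powr s = 2 powr (- real k) * 2^j" using False by (simp add: s_def powr_diff powr_minus powr_realpow divide_simps)
      also have "\<dots> \<le> 2 powr (- real k) * norm \<xi>" using that by (intro mult_left_mono) auto
      finally show ?thesis by simp
    qed (simp add: s_def)
    then have "(2 powr s) ^ DIM('a) \<le> (1 + 2 powr (- real k) * norm \<xi>) ^ DIM('a)" by (intro power_mono) auto
    then show ?thesis by (simp add: d_def two_powr_power)
  qed
  have "(\<integral>\<^sup>+\<xi>\<in>{\<xi>. 2^j \<le> norm \<xi>}. ennreal (norm (g \<xi>) ^ r) \<partial>lborel)
     \<le> (\<integral>\<^sup>+\<xi>. ennreal ((2 powr (- s * d)) ^ r) * ennreal ((norm (g \<xi>) * (1 + 2 powr (- real k) * norm \<xi>) ^ DIM('a)) ^ r) \<partial>lborel)"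
  proof (intro nn_integral_mono)
    fix \<xi> :: 'a
    have "norm (g \<xi>) ^ r \<le> (2 powr (- s * d)) ^ r * (norm (g \<xi>) * (1 + 2 powr (- real k) * norm \<xi>) ^ DIM('a)) ^ r"
      if "2^j \<le> norm \<xi>"
    proof -
      have "norm (g \<xi>) = 2 powr (- s * d) * (norm (g \<xi>) * 2 powr (s * d))" by (simp add: powr_minus)
      also have "\<dots> \<le> 2 powr (- s * d) * (norm (g \<xi>) * (1 + 2 powr (- real k) * norm \<xi>) ^ DIM('a))"
        using w[OF that] by (intro mult_left_mono) auto
      finally have "norm (g \<xi>) ^ r \<le> (2 powr (- s * d) * (norm (g \<xi>) * (1 + 2 powr (- real k) * norm \<xi>) ^ DIM('a)))^r"
        by (intro power_mono) auto
      then show ?thesis by (simp add: power_mult_distrib)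
    qed
    then show "ennreal (norm (g \<xi>) ^ r) * indicator {\<xi>. 2^j \<le> norm \<xi>} \<xi> \<le> ennreal ((2 powr (- s * d)) ^ r) * ennreal ((norm (g \<xi>) * (1 + 2 powr (- real k) * norm \<xi>) ^ DIM('a)) ^ r)"
      by (auto split: split_indicator simp flip: ennreal_mult' intro!: ennreal_leI)
  qed
  also have "\<dots> \<le> ennreal ((2 powr (- s * d)) ^ r) * ennreal (V^r * 2 powr (real k * real DIM('a)))"
    by (subst nn_integral_cmult) (auto intro!: mult_left_mono le)
  also have "\<dots> = ennreal (V^r * 2 powr (k * d - s * d * r))"
    using V by (simp add: two_powr_power d_def powr_add[symmetric] algebra_simps flip: ennreal_mult')
  also have "\<dots> \<le> ennreal (V^r * 2 powr ((j * d * (1/real r - 1/p) + (k * d / p) - (d * (1/p - 1/real r)) * \<bar>real j - real k\<bar>) * r))"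
  proof (intro ennreal_leI mult_left_mono)
    have "k * d - s * d * r \<le> (j * d * (1/real r - 1/p) + (k * d / p) - (d * (1/p - 1/real r)) * \<bar>real j - real k\<bar>) * r"
    proof (cases "j \<le> k")
      case True
      then show ?thesis using r p by (simp add: s_def field_simps)
    next
      case False
      define x where "x = real j - real k"
      have x: "x \<ge> 0" "real j = real k + x" "s = x" "\<bar>real j - real k\<bar> = x" using False by (auto simp: x_def s_def)
      have eq: "(j * d * (1/real r - 1/p) + (k * d / p) - (d * (1/p - 1/real r)) * \<bar>real j - real k\<bar>) * r
        = k * d + d * x * (2 - 2 * real r / p)"
        using r p unfolding x(4) unfolding x(2) by (simp add: field_simps)
      have "real r * 2 \<le> real r * p" using p by (intro mult_left_mono) auto
      then have "2 * real r / p \<le> real r" using p by (simp add: divide_le_eq mult.commute)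
      then have "- real r \<le> 2 - 2 * real r / p" by linarith
      then have "d * x * (- real r) \<le> d * x * (2 - 2 * real r / p)" using d x by (intro mult_left_mono) auto
      then show ?thesis unfolding eq x(3) by (simp add: mult_ac)
    qed
    then show "2 powr (k * d - s * d * r) \<le> 2 powr ((j * d * (1/real r - 1/p) + (k * d / p) - (d * (1/p - 1/real r)) * \<bar>real j - real k\<bar>) * r)"
      by simp
  qed (use V in auto)
  also have "V^r * 2 powr ((j * d * (1/real r - 1/p) + (k * d / p) - (d * (1/p - 1/real r)) * \<bar>real j - real k\<bar>) * r)
    = (2 powr (real j * real DIM('a) * (1/real r - 1/p)) * (V * 2 powr (real k * real DIM('a) / p) * 2 powr (- (real DIM('a) * (1/p - 1/real r)) * \<bar>real j - real k\<bar>))) ^ r"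
    unfolding power_mult_distrib two_powr_power by (simp add: d_def powr_add[symmetric] algebra_simps)
  finally show "(\<integral>\<^sup>+\<xi>\<in>{\<xi>. 2^j \<le> norm \<xi>}. ennreal (norm (g \<xi>) ^ r) \<partial>lborel) \<le> ennreal \<dots>" .
qed

section \<open>From tail bounds to Lorentz membership\<close>

lemma nn_integral_powr_Ioc:
  fixes q T :: real
  assumes q: "0 < q" and T: "0 \<le> T"
  shows "(\<integral>\<^sup>+t\<in>{0<..T}. ennreal (t powr (q - 1)) \<partial>lborel) \<le> ennreal (T powr q / q)"
proof -
  have "(\<integral>\<^sup>+t\<in>{0<..T}. ennreal (t powr (q - 1)) \<partial>lborel) \<le> (\<integral>\<^sup>+t. ennreal (indicator {0..T} t * t powr (q - 1)) \<partial>lborel)"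
    by (intro nn_integral_mono) (auto split: split_indicator)
  also have "\<dots> = ennreal (T powr (q - 1 + 1) / (q - 1 + 1))"
    using q T by (intro nn_integral_has_integral_lebesgue has_integral_powr_from_0) auto
  finally show ?thesis by simp
qed

lemma powr_nonpos_le_one: "x \<le> 0 \<Longrightarrow> (2::real) powr x \<le> 1"
  using powr_mono[of x 0 "2::real"] by simp

text \<open>For levels t >= T j, Chebyshev's inequality outside the ball of radius 2^j and the
  volume of that ball both give O(2^(j d)) for the measure of {|f| >= t}. Slicing the integral over
  t at the levels T j then turns the Lorentz functional into the sum of the b j powr q.\<close>

lemma in_Lorentz_of_tail_bound:
  fixes f :: "'a::euclidean_space \<Rightarrow> complex"
  assumes f: "tail_bound r p f b" and p: "0 < p" and r: "0 < r" and q: "0 < q"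
    and b: "summable (\<lambda>j. b j powr q)" and f1: "\<And>\<xi>. norm (f \<xi>) \<le> 1"
  shows "in_Lorentz p q f"
proof -
  define d where "d = real DIM('a)"
  \<comment> \<open>\<open>T j\<close> bounds the decreasing rearrangement of \<open>f\<close> at a multiple of \<open>2 powr (j * d)\<close>.\<close>
  define T where "T = (\<lambda>j::nat. 2 powr (- j * d / p) * b j)"
  define C where "C = 1 + unit_ball_vol d"
  have d: "d > 0" by (simp add: d_def)
  have C: "C \<ge> 1" by (simp add: C_def d_def)
  have fm [measurable]: "f \<in> borel_measurable borel" by (rule tail_boundD(1)[OF f])
  have bpos: "b j > 0" for j by (rule tail_boundD(2)[OF f])
  have Tpos: "T j > 0" for j using bpos[of j] by (simp add: T_def)
  define E where "E = (\<lambda>t. {x. t \<le> norm (f x)})"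
  have [measurable]: "E t \<in> sets borel" for t unfolding E_def by measurable
  have level: "emeasure lborel (E t) \<le> ennreal (C * 2 powr (j * d))" if t: "T j \<le> t" for t j
  proof -
    have t0: "t > 0" using t Tpos[of j] by linarith
    define A where "A = {\<xi>::'a. 2^j \<le> norm \<xi>}"
    have [measurable]: "A \<in> sets borel" unfolding A_def by measurable
    have "emeasure lborel (E t \<inter> A) = (\<integral>\<^sup>+x. indicator (E t \<inter> A) x \<partial>lborel)" by simp
    also have "\<dots> \<le> (\<integral>\<^sup>+x. ennreal ((1/t)^r) * (ennreal (norm (f x) ^ r) * indicator A x) \<partial>lborel)"
    proof (intro nn_integral_mono)
      fix x
      have "1 \<le> (1/t)^r * norm (f x)^r" if "t \<le> norm (f x)"
        using that t0 by (simp add: power_divide power_mono)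
      then have "1 \<le> ennreal ((1/t)^r) * ennreal (norm (f x)^r)" if "t \<le> norm (f x)"
        using that t0 by (simp flip: ennreal_mult' ennreal_1)
      then show "(indicator (E t \<inter> A) x :: ennreal) \<le> ennreal ((1/t)^r) * (ennreal (norm (f x) ^ r) * indicator A x)"
        by (auto simp: E_def split: split_indicator)
    qed
    also have "\<dots> = ennreal ((1/t)^r) * (\<integral>\<^sup>+x\<in>A. ennreal (norm (f x) ^ r) \<partial>lborel)"
      by (rule nn_integral_cmult) measurable
    also have "\<dots> \<le> ennreal ((1/t)^r) * ennreal ((2 powr (real j * real DIM('a) * (1/real r - 1/p)) * b j) ^ r)"
      unfolding A_def by (intro mult_left_mono tail_boundD(3)[OF f]) auto
    also have "\<dots> = ennreal (((2 powr (real j * real DIM('a) * (1/real r - 1/p)) * b j) / t) ^ r)"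
      using t0 by (simp add: power_divide flip: ennreal_mult')
    also have "2 powr (real j * real DIM('a) * (1/real r - 1/p)) * b j = 2 powr (j * d / r) * T j"
    proof -
      have "real j * real DIM('a) * (1/real r - 1/p) = j * d / r + (- j * d / p)"
        by (simp add: d_def algebra_simps)
      then show ?thesis by (simp only: T_def powr_add mult.assoc)
    qed
    also have "(2 powr (j * d / r) * T j / t) ^ r \<le> (2 powr (j * d / r)) ^ r"
      using t0 t Tpos[of j] by (intro power_mono) (auto simp: divide_le_eq)
    also have "(2 powr (j * d / r)) ^ r = 2 powr (j * d)"
      using r by (simp add: powr_realpow[symmetric] powr_powr)
    finally have 1: "emeasure lborel (E t \<inter> A) \<le> ennreal (2 powr (j * d))" by (simp add: ennreal_leI)
    have 2: "emeasure lborel (cball (0::'a) (2^j)) = ennreal (unit_ball_vol d * 2 powr (j * d))"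
      by (subst emeasure_cball) (auto simp: d_def powr_realpow[symmetric] powr_powr)
    have "emeasure lborel (E t) \<le> emeasure lborel ((E t \<inter> A) \<union> cball 0 (2^j))"
      by (rule emeasure_mono) (auto simp: A_def)
    also have "\<dots> \<le> emeasure lborel (E t \<inter> A) + emeasure lborel (cball (0::'a) (2^j))"
      by (rule emeasure_subadditive) auto
    also have "\<dots> \<le> ennreal (2 powr (j * d)) + ennreal (unit_ball_vol d * 2 powr (j * d))"
      using 1 2 by (intro add_mono) auto
    also have "\<dots> = ennreal (C * 2 powr (j * d))"
      by (simp add: C_def d_def algebra_simps flip: ennreal_plus)
    finally show ?thesis .
  qed
  have Tlim: "T \<longlonglongrightarrow> 0"
  proof -
    have "(\<lambda>j. b j powr q) \<longlonglongrightarrow> 0" by (rule summable_LIMSEQ_zero[OF b])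
    then have "(\<lambda>j. (b j powr q) powr (1/q)) \<longlonglongrightarrow> 0 powr (1/q)"
      using q by (intro tendsto_powr') auto
    then have "b \<longlonglongrightarrow> 0" using q bpos by (simp add: powr_powr less_imp_le)
    then have "(\<lambda>j. 1 * b j) \<longlonglongrightarrow> 0" by simp
    then show ?thesis
    proof (rule Lim_null_comparison[rotated])
      show "\<forall>\<^sub>F j in sequentially. norm (T j) \<le> 1 * b j"
        using bpos d p by (intro always_eventually allI) (auto simp: T_def abs_mult less_imp_le intro!: mult_left_le_one_le powr_nonpos_le_one)
    qed
  qed
  have ex: "\<exists>j. T j \<le> t" if "t > 0" for t
    using order_tendstoD(2)[OF Tlim that] by (auto simp: eventually_sequentially intro: less_imp_le)
  have m: "measure lborel (E t) \<le> C * 2 powr (j * d)" if "T j \<le> t" for t j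
    unfolding measure_def using level[OF that] C
    by (intro enn2real_leI) auto
  define G where "G = (\<lambda>t. ennreal ((measure lborel (E t) * t powr p) powr (q / p) / t) * indicator {0<..} t)"
  define K where "K = (\<lambda>j::nat. (C * 2 powr (j * d)) powr (q/p))"
  have g: "(measure lborel (E t) * t powr p) powr (q / p) / t \<le> K j * t powr (q - 1)" if "T j \<le> t" "t > 0" for t j
  proof -
    have "(measure lborel (E t) * t powr p) powr (q / p) \<le> (C * 2 powr (j * d) * t powr p) powr (q / p)"
      using m[OF that(1)] p q by (intro powr_mono2 mult_right_mono) auto
    also have "\<dots> = K j * t powr q" using C p by (simp add: K_def powr_mult powr_powr)
    finally show ?thesis using that(2) by (simp add: powr_diff divide_right_mono)
  qed
  \<comment> \<open>Levels above 1 are empty as norm f <= 1, so the slice j = 0 only concerns t <=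
    1. A level t whose first index is i + 1 lies below T i and is charged to the i-th
    summand.\<close>
  have Gle: "G t \<le> ennreal (K 0) * (ennreal (t powr (q - 1)) * indicator {0<..1} t)
      + (\<Sum>i. ennreal (K (Suc i)) * (ennreal (t powr (q - 1)) * indicator {0<..T i} t))" for t
  proof (cases "0 < t \<and> t \<le> 1")
    case False
    then have "G t = 0"
    proof (cases "0 < t")
      case True
      with False have "E t = {}" using f1 by (auto simp: E_def not_le intro: le_less_trans)
      then show ?thesis by (simp add: G_def)
    qed (auto simp: G_def)
    then show ?thesis by simp
  next
    case True
    \<comment> \<open>T need not be decreasing; the least index provides both T j <= t and t < T i
      for every smaller i.\<close>
    define j where "j = (LEAST j. T j \<le> t)"
    have j: "T j \<le> t" unfolding j_def using LeastI_ex[of "\<lambda>j. T j \<le> t"] ex True by auto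
    have less: "t < T i" if "i < j" for i using not_less_Least[of i "\<lambda>j. T j \<le> t"] that by (auto simp: j_def)
    have G: "G t \<le> ennreal (K j) * ennreal (t powr (q - 1))"
      using g[OF j] True by (auto simp: G_def K_def simp flip: ennreal_mult' intro!: ennreal_leI)
    show ?thesis
    proof (cases j)
      case 0
      then have "G t \<le> ennreal (K 0) * (ennreal (t powr (q - 1)) * indicator {0<..1} t)" using G True by simp
      then show ?thesis by (rule add_increasing2[OF zero_le])
    next
      case (Suc i)
      have "ennreal (K (Suc i)) * (ennreal (t powr (q - 1)) * indicator {0<..T i} t)
        \<le> (\<Sum>i. ennreal (K (Suc i)) * (ennreal (t powr (q - 1)) * indicator {0<..T i} t))"
        using sum_le_suminf[of "\<lambda>i. ennreal (K (Suc i)) * (ennreal (t powr (q - 1)) * indicator {0<..T i} t)" "{i}"] by simp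
      moreover have "t \<in> {0<..T i}" using less[of i] Suc True by auto
      ultimately have "G t \<le> (\<Sum>i. ennreal (K (Suc i)) * (ennreal (t powr (q - 1)) * indicator {0<..T i} t))"
        using G Suc by simp
      then show ?thesis by (rule add_increasing[OF zero_le])
    qed
  qed
  have [measurable]: "(\<lambda>t::real. ennreal (t powr (q - 1))) \<in> borel_measurable borel" by measurable
  have "(\<integral>\<^sup>+t. G t \<partial>lborel) \<le> (\<integral>\<^sup>+t. ennreal (K 0) * (ennreal (t powr (q - 1)) * indicator {0<..1} t)
      + (\<Sum>i. ennreal (K (Suc i)) * (ennreal (t powr (q - 1)) * indicator {0<..T i} t)) \<partial>lborel)"
    by (intro nn_integral_mono Gle)
  also have "\<dots> = ennreal (K 0) * (\<integral>\<^sup>+t\<in>{0<..1}. ennreal (t powr (q - 1)) \<partial>lborel)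
      + (\<Sum>i. ennreal (K (Suc i)) * (\<integral>\<^sup>+t\<in>{0<..T i}. ennreal (t powr (q - 1)) \<partial>lborel))"
    by (simp add: nn_integral_add nn_integral_cmult nn_integral_suminf)
  also have "\<dots> \<le> ennreal (K 0) * ennreal (1 powr q / q) + (\<Sum>i. ennreal (K (Suc i)) * ennreal (T i powr q / q))"
    using q Tpos by (intro add_mono mult_left_mono suminf_le nn_integral_powr_Ioc) (auto simp: less_imp_le)
  \<comment> \<open>The growth of K cancels the factor 2^(-i d q / p) of T i powr q up to one
    octave, so that only b i powr q remains.\<close>
  also have "(\<lambda>i. ennreal (K (Suc i)) * ennreal (T i powr q / q)) = (\<lambda>i. ennreal (C powr (q/p) * 2 powr (d * q / p) / q * b i powr q))"
  proof
    fix i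
    have "K (Suc i) * (T i powr q / q) = C powr (q/p) * 2 powr (d * q / p) / q * b i powr q"
    proof -
      have K: "K (Suc i) = C powr (q/p) * 2 powr (real (Suc i) * d * (q / p))"
        using C by (simp add: K_def powr_mult powr_powr)
      have T: "T i powr q = 2 powr (- i * d / p * q) * b i powr q"
        using bpos[of i] by (simp add: T_def powr_mult powr_powr)
      have *: "2 powr (real (Suc i) * d * (q / p)) * 2 powr (- i * d / p * q) = 2 powr (d * q / p)"
        unfolding powr_add[symmetric] by (simp add: algebra_simps add_divide_distrib)
      from K T have "K (Suc i) * (T i powr q / q)
        = C powr (q/p) * (2 powr (real (Suc i) * d * (q / p)) * 2 powr (- i * d / p * q)) / q * b i powr q"
        by simp
      with * show ?thesis by simp
    qed
    moreover have "K (Suc i) \<ge> 0" by (simp add: K_def)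
    ultimately show "ennreal (K (Suc i)) * ennreal (T i powr q / q) = ennreal (C powr (q/p) * 2 powr (d * q / p) / q * b i powr q)"
      by (metis ennreal_mult')
  qed
  also have "(\<Sum>i. ennreal (C powr (q/p) * 2 powr (d * q / p) / q * b i powr q)) < \<infinity>"
    using b q by (subst suminf_ennreal2) (auto intro!: summable_mult)
  then have "ennreal (K 0) * ennreal (1 powr q / q) + (\<Sum>i. ennreal (C powr (q/p) * 2 powr (d * q / p) / q * b i powr q)) < \<infinity>"
    by (simp add: ennreal_mult_less_top)
  finally have "(\<integral>\<^sup>+t. G t \<partial>lborel) < \<infinity>" .
  moreover have "emeasure lborel (E t) < \<top>" if t: "t > 0" for t
  proof -
    obtain j where "T j \<le> t" using ex[OF t] by auto
    from le_less_trans[OF level[OF this]] show ?thesis by simp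
  qed
  ultimately show ?thesis unfolding in_Lorentz_def G_def E_def by simp
qed

section \<open>Contents of finite covers\<close>

text \<open>Balls of radius 2^(1-k) have diameter 2^(2-k), which is the included left endpoint of
  the dyadic interval of index k - 3.\<close>

lemma two_powr_in_dyadic_interval_iff:
  "2 powr (2 - real k) \<in> dyadic_interval z \<longleftrightarrow> z = int k - 3"
proof -
  have "2 powr (2 - real k) \<in> dyadic_interval z \<longleftrightarrow> - real_of_int z - 1 \<le> 2 - real k \<and> 2 - real k < - real_of_int z"
    by (simp add: dyadic_interval_def)
  also have "\<dots> \<longleftrightarrow> z = int k - 3" by linarith
  finally show ?thesis .
qed

lemma zero_notin_dyadic_interval: "0 \<notin> dyadic_interval z"
  by (simp add: dyadic_interval_def not_le)

text \<open>Balls of distinct scales fall into distinct dyadic intervals, so the cost separates by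
  scale. The cover is padded to a sequence by balls of radius 0, whose diameter lies in no dyadic
  interval, and \<Phi> 0 = 0 makes the empty blocks free.\<close>

lemma H_content_delta_finite_cover:
  fixes c :: "'t \<Rightarrow> 'a::euclidean_space" and k :: "'t \<Rightarrow> nat"
  assumes J: "finite J" and \<delta>: "\<delta> > 0" "\<And>t. t \<in> J \<Longrightarrow> 2 powr (2 - real (k t)) < \<delta>" and \<Phi>: "\<Phi> 0 = 0"
    and U: "U \<subseteq> (\<Union>t\<in>J. ball (c t) (2 powr (1 - real (k t))))"
  shows "H_content_delta \<alpha> \<Phi> U \<delta> \<le> (\<Sum>i\<in>k ` J. ennreal (\<Phi> (card {t\<in>J. k t = i} * (2 powr (2 - real i)) powr \<alpha>)))"
proof -
  obtain e where e: "bij_betw e {0..<card J} J" using ex_bij_betw_nat_finite[OF J] by blast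
  have eJ: "e j \<in> J" if "j < card J" for j using e that by (auto simp: bij_betw_def)
  define r where "r = (\<lambda>j. if j < card J then 2 powr (1 - real (k (e j))) else 0)"
  have r2: "2 * r j = (if j < card J then 2 powr (2 - real (k (e j))) else 0)" for j
    by (simp add: r_def powr_diff)
  define f where "f = (\<lambda>i. real (card {t\<in>J. k t = i}) * (2 powr (2 - real i)) powr \<alpha>)"
  have block: "dyadic_block_sum \<alpha> r z = (\<Sum>t\<in>J. if z = int (k t) - 3 then ennreal ((2 powr (2 - real (k t))) powr \<alpha>) else 0)" for z
  proof -
    have "dyadic_block_sum \<alpha> r z = (\<Sum>j. if j < card J \<and> z = int (k (e j)) - 3 then ennreal ((2 powr (2 - real (k (e j)))) powr \<alpha>) else 0)"
      unfolding dyadic_block_sum_def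
      by (intro suminf_cong) (auto simp: r2 two_powr_in_dyadic_interval_iff zero_notin_dyadic_interval)
    also have "\<dots> = (\<Sum>j\<in>{0..<card J}. if j < card J \<and> z = int (k (e j)) - 3 then ennreal ((2 powr (2 - real (k (e j)))) powr \<alpha>) else 0)"
      by (intro suminf_finite) auto
    also have "\<dots> = (\<Sum>j\<in>{0..<card J}. if z = int (k (e j)) - 3 then ennreal ((2 powr (2 - real (k (e j)))) powr \<alpha>) else 0)"
      by (intro sum.cong) auto
    also have "\<dots> = (\<Sum>t\<in>J. if z = int (k t) - 3 then ennreal ((2 powr (2 - real (k t))) powr \<alpha>) else 0)"
      by (rule sum.reindex_bij_betw[OF e])
    finally show ?thesis .
  qed
  have block_f: "dyadic_block_sum \<alpha> r (int i - 3) = ennreal (f i)" for i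
  proof -
    have "dyadic_block_sum \<alpha> r (int i - 3) = (\<Sum>t\<in>J. if k t = i then ennreal ((2 powr (2 - real i)) powr \<alpha>) else 0)"
      unfolding block by (intro sum.cong) auto
    also have "\<dots> = (\<Sum>t\<in>{t\<in>J. k t = i}. ennreal ((2 powr (2 - real i)) powr \<alpha>))"
      using J by (subst sum.inter_filter) auto
    also have "\<dots> = ennreal (f i)" by (simp add: f_def ennreal_mult' ennreal_of_nat_eq_real_of_nat)
    finally show ?thesis .
  qed
  have block_0: "dyadic_block_sum \<alpha> r z = 0" if "z \<notin> (\<lambda>i. int i - 3) ` k ` J" for z
    unfolding block using that by (intro sum.neutral) auto
  have fin: "dyadic_block_sum \<alpha> r z < \<top>" for z
    using J by (auto simp: block less_top)
  have "(\<integral>\<^sup>+ z. ennreal (\<Phi> (enn2real (dyadic_block_sum \<alpha> r z))) \<partial>count_space (UNIV :: int set))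
    = (\<Sum>z\<in>(\<lambda>i. int i - 3) ` k ` J. ennreal (\<Phi> (enn2real (dyadic_block_sum \<alpha> r z))))"
    using J by (intro nn_integral_count_space') (auto simp: block_0 \<Phi>)
  also have "\<dots> = (\<Sum>i\<in>k ` J. ennreal (\<Phi> (f i)))"
    by (subst sum.reindex) (auto simp: inj_on_def block_f f_def intro!: sum.cong)
  finally have eq: "(if (\<forall>z. dyadic_block_sum \<alpha> r z < \<top>)
           then (\<integral>\<^sup>+ z. ennreal (\<Phi> (enn2real (dyadic_block_sum \<alpha> r z))) \<partial>count_space (UNIV :: int set))
           else \<top>) = (\<Sum>i\<in>k ` J. ennreal (\<Phi> (f i)))" using fin by simp
  have "U \<subseteq> (\<Union>j. ball (c (e j)) (r j))"
  proof
    fix x assume "x \<in> U"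
    then obtain t where t: "t \<in> J" "x \<in> ball (c t) (2 powr (1 - real (k t)))" using U by auto
    then obtain j where "j < card J" "t = e j" using e by (auto simp: bij_betw_def image_iff Bex_def) (metis atLeastLessThan_iff imageE)
    then show "x \<in> (\<Union>j. ball (c (e j)) (r j))" using t by (auto simp: r_def intro!: exI[of _ j])
  qed
  moreover have "0 \<le> r j \<and> 2 * r j < \<delta>" for j
    using \<delta> eJ unfolding r2 by (auto simp: r_def)
  ultimately have "H_content_delta \<alpha> \<Phi> U \<delta> \<le> (\<Sum>i\<in>k ` J. ennreal (\<Phi> (f i)))"
    unfolding H_content_delta_def eq[symmetric]
    by (intro Inf_lower CollectI exI[of _ "\<lambda>j. c (e j)"] exI[of _ r]) auto
  then show ?thesis by (simp add: f_def)
qed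

lemma H_content_delta_mono:
  assumes "F \<subseteq> G" "\<delta>' \<le> \<delta>"
  shows "H_content_delta \<alpha> \<Phi> F \<delta> \<le> H_content_delta \<alpha> \<Phi> G \<delta>'"
  unfolding H_content_delta_def
proof (rule Inf_superset_mono, safe)
  fix c and r :: "nat \<Rightarrow> real" assume "\<forall>j. 0 \<le> r j \<and> 2 * r j < \<delta>'" "G \<subseteq> (\<Union>j. ball (c j) (r j))"
  then show "\<exists>c' r'. (if \<forall>k. dyadic_block_sum \<alpha> r k < \<top>
           then (\<integral>\<^sup>+ k. ennreal (\<Phi> (enn2real (dyadic_block_sum \<alpha> r k))) \<partial>count_space UNIV) else \<top>) =
          (if \<forall>k. dyadic_block_sum \<alpha> r' k < \<top>
           then (\<integral>\<^sup>+ k. ennreal (\<Phi> (enn2real (dyadic_block_sum \<alpha> r' k))) \<partial>count_space UNIV) else \<top>) \<and>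
          (\<forall>j. 0 \<le> r' j \<and> 2 * r' j < \<delta>) \<and> F \<subseteq> (\<Union>j. ball (c' j) (r' j))"
    using assms by (intro exI[of _ c] exI[of _ r]) (auto intro: less_le_trans)
qed

section \<open>Sums and parameters\<close>

lemma sum_div_mod:
  fixes f :: "nat \<Rightarrow> nat \<Rightarrow> 'b::comm_monoid_add"
  assumes n: "n > 0"
  shows "(\<Sum>c<m * n. f (c div n) (c mod n)) = (\<Sum>a<m. \<Sum>b<n. f a b)"
  unfolding sum.cartesian_product
proof (rule sum.reindex_bij_witness[of _ "\<lambda>(a, b). a * n + b" "\<lambda>c. (c div n, c mod n)"])
  fix z assume "z \<in> {..<m} \<times> {..<n}"
  then obtain a b where z: "z = (a, b)" "a < m" "b < n" by auto
  have "a * n + b < (a + 1) * n" using z by simp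
  also have "\<dots> \<le> m * n" using z by (intro mult_le_mono1) auto
  finally show "(case z of (a, b) \<Rightarrow> a * n + b) \<in> {..<m * n}" using z by simp
qed (use n in \<open>auto simp: less_mult_imp_div_less\<close>)

text \<open>The index c of a new cell is read in digits: the parent a, the scale i, and a counter
  below P whose residue modulo n i selects the sample. As P is a common multiple of all n i, each
  sample of scale i is repeated P / n i times; scales with very different numbers of samples thus
  all receive weight 1/M in a list of equal cells.\<close>

lemma average_over_digits:
  fixes G :: "nat \<Rightarrow> nat \<Rightarrow> nat \<Rightarrow> complex" and n :: "nat \<Rightarrow> nat"
  assumes M: "M \<ge> 1" and L: "L \<ge> 1" and n: "\<And>i. i < M \<Longrightarrow> n i \<ge> 1"
  defines "P \<equiv> \<Prod>i<M. n i"
  defines "B \<equiv> P * M"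
  shows "(\<Sum>c<L * B. G (c div B) (c mod B mod M) (c mod B div M mod n (c mod B mod M))) / of_nat (L * B)
    = (\<Sum>i<M. (\<Sum>a<L. \<Sum>l<n i. G a i l) / of_nat (L * n i)) / of_nat M"
proof -
  have P: "P > 0" unfolding P_def using n by (intro prod_pos) (auto simp: Suc_le_eq)
  have B: "B > 0" using P M by (simp add: B_def)
  have period: "(\<Sum>e<P. G a i (e mod n i)) = of_nat P * ((\<Sum>l<n i. G a i l) / of_nat (n i))" if i: "i < M" for a i
  proof -
    have "n i dvd P" unfolding P_def using i by (intro dvd_prodI) auto
    then obtain m where m: "P = m * n i" by (metis dvd_def mult.commute)
    have "(\<Sum>e<P. G a i (e mod n i)) = (\<Sum>_<m. \<Sum>l<n i. G a i l)"
      unfolding m using n[OF i] by (intro sum_div_mod[of "n i" "\<lambda>_ l. G a i l"]) auto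
    then show ?thesis using n[OF i] by (simp add: m)
  qed
  have "(\<Sum>c<L * B. G (c div B) (c mod B mod M) (c mod B div M mod n (c mod B mod M)))
    = (\<Sum>a<L. \<Sum>b<B. G a (b mod M) (b div M mod n (b mod M)))"
    by (rule sum_div_mod[OF B, of "\<lambda>a b. G a (b mod M) (b div M mod n (b mod M))"])
  also have "\<dots> = (\<Sum>a<L. \<Sum>e<P. \<Sum>i<M. G a i (e mod n i))"
    unfolding B_def using M by (intro sum.cong refl sum_div_mod[of M "\<lambda>e i. G _ i (e mod n i)"]) auto
  also have "\<dots> = (\<Sum>a<L. \<Sum>i<M. \<Sum>e<P. G a i (e mod n i))"
    by (intro sum.cong refl sum.swap)
  also have "\<dots> = (\<Sum>i<M. \<Sum>a<L. \<Sum>e<P. G a i (e mod n i))" by (rule sum.swap)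
  also have "\<dots> = (\<Sum>i<M. \<Sum>a<L. of_nat P * ((\<Sum>l<n i. G a i l) / of_nat (n i)))"
    by (intro sum.cong refl period) auto
  also have "\<dots> = (\<Sum>i<M. of_nat (L * P) * ((\<Sum>a<L. \<Sum>l<n i. G a i l) / of_nat (L * n i)))"
    using L by (simp add: sum_distrib_left sum_divide_distrib)
  also have "\<dots> = of_nat (L * B) * ((\<Sum>i<M. (\<Sum>a<L. \<Sum>l<n i. G a i l) / of_nat (L * n i)) / of_nat M)"
    unfolding sum_distrib_left[symmetric] using M by (simp add: B_def)
  finally show ?thesis using B L by simp
qed

lemma two_sided_geometric_sum_le:
  assumes g: "0 < g" and S: "finite S"
  shows "(\<Sum>i\<in>S. 2 powr (- g * \<bar>real i - real k\<bar>)) \<le> 2 / (1 - 2 powr (- g))"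
proof -
  define \<rho> where "\<rho> = 2 powr (- g)"
  have \<rho>: "0 < \<rho>" "\<rho> < 1" using g by (auto simp: \<rho>_def powr_less_one)
  have pw: "\<rho> ^ n = 2 powr (- g * real n)" for n by (simp add: \<rho>_def two_powr_power)
  have one: "(\<Sum>i\<in>A. 2 powr (- g * \<bar>real i - real k\<bar>)) \<le> 1 / (1 - \<rho>)"
    if A: "finite A" "inj_on f A" "\<And>i. i \<in> A \<Longrightarrow> \<bar>real i - real k\<bar> = real (f i)" for A f
  proof -
    have "(\<Sum>i\<in>A. 2 powr (- g * \<bar>real i - real k\<bar>)) = (\<Sum>n\<in>f ` A. \<rho> ^ n)"
      using A by (subst sum.reindex) (auto simp: pw)
    also have "\<dots> \<le> (\<Sum>n. \<rho> ^ n)" using A \<rho> by (intro sum_le_suminf) auto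
    also have "\<dots> = 1 / (1 - \<rho>)" using \<rho> by (intro suminf_geometric) auto
    finally show ?thesis .
  qed
  have "(\<Sum>i\<in>S. 2 powr (- g * \<bar>real i - real k\<bar>))
    = (\<Sum>i\<in>{i\<in>S. k \<le> i}. 2 powr (- g * \<bar>real i - real k\<bar>)) + (\<Sum>i\<in>{i\<in>S. i < k}. 2 powr (- g * \<bar>real i - real k\<bar>))"
    using S by (subst sum.union_disjoint[symmetric]) (auto intro!: sum.cong)
  also have "\<dots> \<le> 1 / (1 - \<rho>) + 1 / (1 - \<rho>)"
    using S by (intro add_mono one[where f = "\<lambda>i. i - k"] one[where f = "\<lambda>i. k - i"]) (auto simp: inj_on_def)
  finally show ?thesis by (simp add: \<rho>_def)
qed

text \<open>With sqrt s = c M^(-1/q') the error term equals \<epsilon> for every M, because 1 - 1/q'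
  = 1/q. This leaves M free to be so large that all t <= 4^\<alpha> s lie in the range where \<Phi>
  t is below (\<epsilon>/Z) t^(q'/2). The factor 4^\<alpha> is the one produced by balls of diameter
  4 * 2^-k.\<close>

lemma scale_parameters:
  fixes \<Phi> :: "real \<Rightarrow> real"
  assumes q: "1 < q" and C: "0 < C" and \<epsilon>: "0 < \<epsilon>"
    and lim: "((\<lambda>t. \<Phi> t / t powr ((q / (q - 1)) / 2)) \<longlongrightarrow> 0) (at_right 0)"
  obtains M :: nat and s where "M \<ge> 1" "s > 0" "M * (C / (M * sqrt s)) powr q \<le> \<epsilon>"
    "\<And>t. 0 < t \<Longrightarrow> t \<le> 4 powr \<alpha> * s \<Longrightarrow> M * \<Phi> t \<le> \<epsilon>"
proof -
  define q' where "q' = q / (q - 1)"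
  have q': "q' > 0" using q by (simp add: q'_def)
  define c where "c = C / \<epsilon> powr (1/q)"
  have c: "c > 0" using C \<epsilon> by (simp add: c_def)
  define u where "u = (\<lambda>M::nat. c * real M powr (- (1/q')))"
  \<comment> \<open>Chosen so that (4^\<alpha> s)^(q'/2) = Z / M.\<close>
  define Z where "Z = (4 powr \<alpha>) powr (q'/2) * c powr q'"
  have Z: "Z > 0" using c by (simp add: Z_def)
  have "eventually (\<lambda>t. \<Phi> t / t powr (q'/2) < \<epsilon> / Z) (at_right 0)"
    using order_tendstoD(2)[OF lim, of "\<epsilon> / Z"] \<epsilon> Z by (simp add: q'_def)
  then obtain \<delta> where \<delta>: "\<delta> > 0" "\<And>t. 0 < t \<Longrightarrow> t < \<delta> \<Longrightarrow> \<Phi> t / t powr (q'/2) < \<epsilon> / Z"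
    by (auto simp: eventually_at_right_field)
  have "(\<lambda>M. 4 powr \<alpha> * (u M)^2) \<longlonglongrightarrow> 4 powr \<alpha> * (c * 0)^2"
    unfolding u_def using q' by (intro tendsto_intros tendsto_neg_powr filterlim_real_sequentially) auto
  then have "eventually (\<lambda>M. 4 powr \<alpha> * (u M)^2 < \<delta>) sequentially"
    using \<delta>(1) by (intro order_tendstoD(2)) auto
  then obtain M where M: "M \<ge> 1" "4 powr \<alpha> * (u M)^2 < \<delta>"
    using eventually_conj[OF eventually_ge_at_top[of 1]] by (metis (mono_tags, lifting) eventually_happens' sequentially_bot)
  define s where "s = (u M)^2"
  have u: "u M > 0" using c M by (simp add: u_def)
  have s: "s > 0" "sqrt s = u M" using u by (auto simp: s_def)
  have "C / (M * sqrt s) = \<epsilon> powr (1/q) * real M powr (- (1/q))"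
  proof -
    have "1/q' = 1 - 1/q" using q by (simp add: q'_def field_simps)
    then have "1/q = 1 + - (1/q')" by simp
    then have "real M * real M powr (- (1/q')) = real M powr (1/q)"
      using M by (simp only: powr_add) simp
    moreover have "M * sqrt s = c * (real M * real M powr (- (1/q')))" by (simp add: s u_def)
    ultimately have "M * sqrt s = c * real M powr (1/q)" by simp
    then have "C / (M * sqrt s) = C / (c * real M powr (1/q))" by (simp only:)
    then show ?thesis using C \<epsilon> by (simp add: c_def powr_minus divide_inverse)
  qed
  then have "(C / (M * sqrt s)) powr q = \<epsilon> * real M powr (-1)"
    using q \<epsilon> by (simp add: powr_mult powr_powr)
  then have 1: "M * (C / (M * sqrt s)) powr q \<le> \<epsilon>" using M by (simp add: powr_minus field_simps)
  have 2: "M * \<Phi> t \<le> \<epsilon>" if t: "0 < t" "t \<le> 4 powr \<alpha> * s" for t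
  proof -
    have "\<Phi> t / t powr (q'/2) < \<epsilon> / Z" using t M(2) by (intro \<delta>(2)) (auto simp: s_def)
    then have "\<Phi> t \<le> \<epsilon> / Z * t powr (q'/2)" using t by (simp add: divide_less_eq)
    also have "\<dots> \<le> \<epsilon> / Z * (4 powr \<alpha> * s) powr (q'/2)"
      using t q' \<epsilon> Z by (intro mult_left_mono powr_mono2) auto
    also have "(4 powr \<alpha> * s) powr (q'/2) = (4 powr \<alpha>) powr (q'/2) * u M powr q'"
    proof -
      have "s = u M powr 2" using u by (simp add: s_def powr_numeral)
      then show ?thesis by (simp add: powr_mult powr_powr)
    qed
    also have "u M powr q' = c powr q' * real M powr (-1)"
      using c q' by (simp add: u_def powr_mult powr_powr)
    finally have "\<Phi> t \<le> \<epsilon> / Z * (Z * real M powr (-1))"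
      by (simp add: Z_def mult.assoc)
    then show ?thesis using M Z by (simp add: powr_minus field_simps)
  qed
  show ?thesis by (rule that[OF M(1) s(1) 1 2])
qed

section \<open>Superposition of errors in l^q\<close>

lemma add_powr_le:
  fixes a b :: real
  assumes "0 \<le> a" "0 \<le> b" "0 \<le> q"
  shows "(a + b) powr q \<le> 2 powr q * (a powr q + b powr q)"
proof -
  have "(a + b) powr q \<le> (2 * max a b) powr q" using assms by (intro powr_mono2) auto
  also have "\<dots> = 2 powr q * max a b powr q" using assms by (simp add: powr_mult)
  also have "max a b powr q \<le> a powr q + b powr q" by (auto simp: max_def)
  finally show ?thesis by simp
qed

text \<open>Triangle inequality for a series of sequences of l^q norm at most 4^-n. Half of the
  decay is spent on weights 2^n: with S j = sum_n (2^n \<beta> n j)^q one has \<beta> n j <= 2^-n (S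
  j)^(1/q), and the sum of S j over j is at most sum_n 2^(-n q).\<close>

lemma summable_superposition:
  fixes \<beta> :: "nat \<Rightarrow> nat \<Rightarrow> real"
  assumes q: "1 < q" and \<beta>0: "\<And>n j. 0 \<le> \<beta> n j"
    and \<beta>: "\<And>n m. (\<Sum>j<m. \<beta> n j powr q) \<le> 4 powr (- (real n * q))"
  shows "summable (\<lambda>n. \<beta> n j)" "summable (\<lambda>j. (\<Sum>n. \<beta> n j) powr q)"
proof -
  define \<rho> where "\<rho> = 2 powr (- q)"
  have \<rho>: "0 < \<rho>" "\<rho> < 1" using q by (auto simp: \<rho>_def powr_less_one)
  have \<rho>n: "(2 ^ n) powr q * 4 powr (- (real n * q)) = \<rho> ^ n" for n
  proof -
    have "(4::real) powr (- (real n * q)) = (2 powr 2) powr (- (real n * q))" by simp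
    also have "\<dots> = 2 powr (- 2 * (real n * q))" by (simp only: powr_powr) simp
    finally have "(2 ^ n) powr q * 4 powr (- (real n * q)) = 2 powr (real n * q) * 2 powr (- 2 * (real n * q))"
      by (simp add: powr_realpow[symmetric] powr_powr)
    also have "\<dots> = 2 powr (- q * real n)" by (simp add: powr_add[symmetric] algebra_simps)
    finally show ?thesis by (simp add: \<rho>_def two_powr_power)
  qed
  define w where "w = (\<lambda>j n. (2 ^ n * \<beta> n j) powr q)"
  have w0: "w j n \<ge> 0" for j n by (simp add: w_def)
  have w_eq: "w j n = (2 ^ n) powr q * \<beta> n j powr q" for j n using \<beta>0 by (simp add: w_def powr_mult)
  have sumw: "(\<Sum>j<m. w j n) \<le> \<rho> ^ n" for m n
  proof -
    have "(\<Sum>j<m. w j n) = (2 ^ n) powr q * (\<Sum>j<m. \<beta> n j powr q)" by (simp add: w_eq sum_distrib_left)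
    also have "\<dots> \<le> (2 ^ n) powr q * 4 powr (- (real n * q))" by (intro mult_left_mono \<beta>) auto
    finally show ?thesis by (simp add: \<rho>n)
  qed
  have w_le: "w j n \<le> \<rho> ^ n" for j n
    using member_le_sum[of j "{..<Suc j}" "\<lambda>j. w j n"] w0 sumw[of n "Suc j"] by fastforce
  have w_summable: "summable (w j)" for j
    using w0 w_le \<rho> by (intro summable_comparison_test[OF _ summable_geometric[of \<rho>]]) auto
  define S where "S = (\<lambda>j. \<Sum>n. w j n)"
  have \<beta>S: "\<beta> n j \<le> (1/2) ^ n * S j powr (1/q)" for n j
  proof -
    have "w j n \<le> S j" unfolding S_def using sum_le_suminf[OF w_summable, of "{n}"] w0 by auto
    then have "w j n powr (1/q) \<le> S j powr (1/q)" using q w0 by (intro powr_mono2) auto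
    moreover have "w j n powr (1/q) = 2 ^ n * \<beta> n j" using q \<beta>0 by (simp add: w_def powr_powr)
    ultimately show ?thesis by (simp add: power_one_over field_simps)
  qed
  have geo: "(\<lambda>n. (1/2) ^ n * S j powr (1/q)) sums (2 * S j powr (1/q))" for j
    using sums_mult2[OF geometric_sums[of "1/2::real"], of "S j powr (1/q)"] by simp
  show sm: "summable (\<lambda>n. \<beta> n j)" for j
    using \<beta>S \<beta>0 by (intro summable_comparison_test[OF _ sums_summable[OF geo]]) auto
  have le: "(\<Sum>n. \<beta> n j) powr q \<le> 2 powr q * S j" for j
  proof -
    have S0: "S j \<ge> 0" unfolding S_def by (intro suminf_nonneg w_summable w0)
    have "(\<Sum>n. \<beta> n j) \<le> 2 * S j powr (1/q)"
      using suminf_le[OF \<beta>S sm sums_summable[OF geo]] sums_unique[OF geo, of j] by simp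
    then have "(\<Sum>n. \<beta> n j) powr q \<le> (2 * S j powr (1/q)) powr q"
      using q \<beta>0 by (intro powr_mono2 suminf_nonneg sm) auto
    also have "\<dots> = 2 powr q * S j" using q S0 by (simp add: powr_mult powr_powr)
    finally show ?thesis .
  qed
  show "summable (\<lambda>j. (\<Sum>n. \<beta> n j) powr q)"
  proof (rule summableI_nonneg_bounded)
    fix m
    have "(\<Sum>j<m. (\<Sum>n. \<beta> n j) powr q) \<le> (\<Sum>j<m. 2 powr q * S j)" by (intro sum_mono le)
    also have "\<dots> = 2 powr q * (\<Sum>n. \<Sum>j<m. w j n)"
      unfolding S_def sum_distrib_left[symmetric] by (subst suminf_sum) (auto intro: w_summable)
    also have "\<dots> \<le> 2 powr q * (\<Sum>n. \<rho> ^ n)"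
      using \<rho> by (intro mult_left_mono suminf_le sumw summable_sum w_summable summable_geometric) auto
    finally show "(\<Sum>j<m. (\<Sum>n. \<beta> n j) powr q) \<le> 2 powr q * (\<Sum>n. \<rho> ^ n)" .
  qed auto
qed

text \<open>Realises an average over L cells as an integral over the unit interval, cell c being
  [c/L, (c+1)/L). This puts every generation on the same probability space.\<close>

lemma integral_floor_average:
  fixes g :: "nat \<Rightarrow> complex"
  assumes L: "L \<ge> 1"
  shows "(\<integral>u. g (nat \<lfloor>u * real L\<rfloor>) \<partial>restrict_space lborel {0..<1::real}) = (\<Sum>c<L. g c) / of_nat L"
proof -
  define A where "A = (\<lambda>c::nat. {real c / L ..< (real c + 1) / L})"
  have mem: "u \<in> A c \<longleftrightarrow> \<lfloor>u * real L\<rfloor> = int c" for u c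
    using L by (auto simp: A_def field_simps floor_eq_iff)
  have pt: "indicator {0..<1} u *\<^sub>R g (nat \<lfloor>u * real L\<rfloor>) = (\<Sum>c<L. indicator (A c) u *\<^sub>R g c)" for u :: real
  proof (cases "u \<in> {0..<1}")
    case True
    define c\<^sub>0 where "c\<^sub>0 = nat \<lfloor>u * real L\<rfloor>"
    have "0 \<le> \<lfloor>u * real L\<rfloor>" using True by auto
    moreover have "u * real L < real L" using True L by auto
    then have "\<lfloor>u * real L\<rfloor> < int L" by (simp add: floor_less_iff)
    ultimately have c0: "c\<^sub>0 < L" "\<lfloor>u * real L\<rfloor> = int c\<^sub>0" unfolding c\<^sub>0_def by linarith+
    then have "(\<Sum>c<L. indicator (A c) u *\<^sub>R g c) = (\<Sum>c<L. if c = c\<^sub>0 then g c else 0)"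
      by (intro sum.cong) (auto simp: indicator_def mem)
    also have "\<dots> = g c\<^sub>0" using c0 by simp
    finally show ?thesis using True by (simp add: c\<^sub>0_def)
  next
    case False
    have "u \<notin> A c" if "c < L" for c
    proof
      assume "u \<in> A c"
      moreover have "(real c + 1) / L \<le> 1" using that L by (simp add: divide_le_eq)
      moreover have "0 \<le> real c / L" by simp
      ultimately show False using False unfolding A_def atLeastLessThan_iff by linarith
    qed
    then show ?thesis using False by simp
  qed
  have intA: "integrable lborel (indicator (A c) :: real \<Rightarrow> real)" for c
  proof (rule integrable_real_indicator)
    have "real c / L \<le> (real c + 1) / L" by (simp add: divide_right_mono)
    then show "emeasure lborel (A c) < \<infinity>" unfolding A_def by (subst emeasure_lborel_Ico) auto
  qed (simp add: A_def)
  have "(\<integral>u. g (nat \<lfloor>u * real L\<rfloor>) \<partial>restrict_space lborel {0..<1::real}) = (\<integral>u. indicator {0..<1} u *\<^sub>R g (nat \<lfloor>u * real L\<rfloor>) \<partial>lborel)"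
    by (subst integral_restrict_space) auto
  also have "\<dots> = (\<integral>u. (\<Sum>c<L. indicator (A c) u *\<^sub>R g c) \<partial>lborel)" by (simp only: pt)
  also have "\<dots> = (\<Sum>c<L. \<integral>u. indicator (A c) u *\<^sub>R g c \<partial>lborel)"
    by (intro Bochner_Integration.integral_sum integrable_scaleR_left intA)
  also have "\<dots> = (\<Sum>c<L. (1 / real L) *\<^sub>R g c)"
  proof (intro sum.cong refl)
    fix c
    have "measure lborel (A c) = 1 / L" using L by (simp add: A_def divide_right_mono add_divide_distrib)
    then show "(\<integral>u. indicator (A c) u *\<^sub>R g c \<partial>lborel) = (1 / real L) *\<^sub>R g c"
      using intA[of c] by (subst integral_scaleR_left) auto
  qed
  also have "\<dots> = (\<Sum>c<L. g c) / of_nat L"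
    by (simp add: scaleR_conv_of_real sum_divide_distrib)
  finally show ?thesis .
qed

text \<open>The intervals of successive generations are nested, and integer division by B finds the
  parent.\<close>

lemma floor_mult_div:
  assumes "u \<ge> 0" "B \<ge> 1"
  shows "nat \<lfloor>u * real (L * B)\<rfloor> div B = nat \<lfloor>u * real L\<rfloor>"
proof -
  have "\<lfloor>u * real L\<rfloor> = \<lfloor>(u * real (L * B)) / real_of_int (int B)\<rfloor>" using assms by simp
  also have "\<dots> = \<lfloor>u * real (L * B)\<rfloor> div int B" by (rule floor_divide_real_eq_div) simp
  finally have "nat \<lfloor>u * real L\<rfloor> = nat (\<lfloor>u * real (L * B)\<rfloor> div int B)" by simp
  also have "\<dots> = nat \<lfloor>u * real (L * B)\<rfloor> div B" using assms by (subst nat_div_distrib) auto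
  finally show ?thesis by simp
qed

section \<open>Refinement of noisy configurations\<close>

lemma fourier_measure_affine:
  assumes "prob_space \<mu>" "sets \<mu> = sets borel"
  shows "fourier_measure (distr \<mu> borel (\<lambda>y. x + s *\<^sub>R y)) \<xi> = cis (-2 * pi * (x \<bullet> \<xi>)) * fourier_measure \<mu> (s *\<^sub>R \<xi>)"
proof -
  note [measurable_cong] = assms(2)
  have "fourier_measure (distr \<mu> borel (\<lambda>y. x + s *\<^sub>R y)) \<xi> = (\<integral>y. cis (-2 * pi * ((x + s *\<^sub>R y) \<bullet> \<xi>)) \<partial>\<mu>)"
    unfolding fourier_measure_def by (rule integral_distr) measurable
  also have "\<dots> = (\<integral>y. cis (-2 * pi * (x \<bullet> \<xi>)) * cis (-2 * pi * (y \<bullet> (s *\<^sub>R \<xi>))) \<partial>\<mu>)"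
    by (intro Bochner_Integration.integral_cong refl) (simp add: cis_mult inner_add_left algebra_simps)
  finally show ?thesis unfolding fourier_measure_def by simp
qed

lemma nn_integral_scale:
  fixes f :: "'a::euclidean_space \<Rightarrow> ennreal"
  assumes [measurable]: "f \<in> borel_measurable borel" and c: "c > 0"
  shows "(\<integral>\<^sup>+x. f (c *\<^sub>R x) \<partial>lborel) = ennreal ((1/c) ^ DIM('a)) * (\<integral>\<^sup>+x. f x \<partial>lborel)"
proof -
  have "(\<integral>\<^sup>+x. f x \<partial>lborel) = (\<integral>\<^sup>+x. f x \<partial>density (distr lborel borel (\<lambda>x. 0 + c *\<^sub>R x)) (\<lambda>_. ennreal (\<bar>c\<bar>^DIM('a))))"
    using c by (subst lborel_affine[of c 0]) auto
  also have "\<dots> = ennreal (c^DIM('a)) * (\<integral>\<^sup>+x. f (c *\<^sub>R x) \<partial>lborel)"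
    using c by (simp add: nn_integral_density nn_integral_distr nn_integral_cmult)
  finally show ?thesis using c
    by (simp add: mult.assoc[symmetric] power_divide flip: ennreal_mult')
qed

locale smoothing_noise =
  fixes \<phi> :: "(real^'n) measure" and r :: nat and p :: real
  assumes prob_space_\<phi>: "prob_space \<phi>" and sets_\<phi>: "sets \<phi> = sets borel"
    and \<phi>_bounded: "AE y in \<phi>. norm y \<le> 1"
    and \<phi>_decay: "(\<integral>\<^sup>+\<xi>. ennreal ((norm (fourier_measure \<phi> \<xi>) * (1 + norm \<xi>)^(CARD('n)+1))^r) \<partial>lborel) < \<infinity>"
    and even_r: "even r" and p_less_r: "p < real r" and p_gt_2: "2 < p"
begin

lemma r_pos: "r > 0" using p_less_r p_gt_2 by (cases r) auto

definition d :: real where "d = real CARD('n)"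
text \<open>Rate per octave at which the tail bound of an error of scale 2^-k decays away from j =
  k; positive because r > p.\<close>

definition \<gamma> :: real where "\<gamma> = d * (1/p - 1/real r)"
definition \<psi> :: "nat \<Rightarrow> real^'n \<Rightarrow> complex" where "\<psi> k \<xi> = fourier_measure \<phi> (2 powr (- real k) *\<^sub>R \<xi>)"
text \<open>Adding 1 makes the constant at least 1, so its r-th power dominates the integral and no
  r-th root has to be taken.\<close>

definition I\<^sub>\<psi> :: real where
  "I\<^sub>\<psi> = 1 + enn2real (\<integral>\<^sup>+\<xi>. ennreal ((norm (fourier_measure \<phi> \<xi>) * (1 + norm \<xi>)^(CARD('n)+1))^r) \<partial>lborel)"

lemma d_pos: "d > 0" by (simp add: d_def)

lemma \<gamma>_pos: "\<gamma> > 0"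
  unfolding \<gamma>_def using d_pos p_less_r p_gt_2 by (intro mult_pos_pos) (auto simp: field_simps)

lemma I\<psi>_pos: "I\<^sub>\<psi> > 0" by (simp add: I\<^sub>\<psi>_def add_pos_nonneg)

lemma \<psi>_measurable [measurable]: "\<psi> k \<in> borel_measurable borel"
proof -
  note [measurable] = borel_measurable_fourier_measure[OF prob_space_\<phi> sets_\<phi>]
  show ?thesis unfolding \<psi>_def by measurable
qed

lemma norm_\<psi>_le_1: "norm (\<psi> k \<xi>) \<le> 1"
  unfolding \<psi>_def by (rule norm_fourier_measure_le_1[OF prob_space_\<phi>])

lemma norm_\<psi>_diff_1_le: "norm (\<psi> k \<xi> - 1) \<le> 2 * pi * 2 powr (- real k) * norm \<xi>"
proof -
  interpret prob_space \<phi> by (rule prob_space_\<phi>)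
  note [measurable_cong] = sets_\<phi>
  define \<eta> where "\<eta> = 2 powr (- real k) *\<^sub>R \<xi>"
  have int: "integrable \<phi> (\<lambda>y. cis (- 2 * pi * (y \<bullet> \<eta>)))"
    by (rule integrable_const_bound[of _ 1]) auto
  have "\<psi> k \<xi> - 1 = (\<integral>y. cis (- 2 * pi * (y \<bullet> \<eta>)) - 1 \<partial>\<phi>)"
    using int by (simp add: \<psi>_def fourier_measure_def \<eta>_def prob_space)
  also have "norm \<dots> \<le> (\<integral>y. norm (cis (- 2 * pi * (y \<bullet> \<eta>)) - 1) \<partial>\<phi>)"
    by (rule integral_norm_bound)
  also have "\<dots> \<le> (\<integral>y. 2 * pi * norm \<eta> \<partial>\<phi>)"
  proof (rule integral_mono_AE)
    show "AE y in \<phi>. norm (cis (- 2 * pi * (y \<bullet> \<eta>)) - 1) \<le> 2 * pi * norm \<eta>"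
      using \<phi>_bounded
    proof eventually_elim
      case (elim y)
      have "norm (cis (- 2 * pi * (y \<bullet> \<eta>)) - 1) \<le> 2 * pi * \<bar>y \<bullet> \<eta>\<bar>"
        using norm_cis_diff_one_le[of "- 2 * pi * (y \<bullet> \<eta>)"] by (simp add: abs_mult)
      also have "\<bar>y \<bullet> \<eta>\<bar> \<le> 1 * norm \<eta>"
        by (rule order_trans[OF Cauchy_Schwarz_ineq2 mult_right_mono[OF elim]]) simp
      finally show ?case by simp
    qed
  qed (use int in auto)
  also have "\<dots> = 2 * pi * 2 powr (- real k) * norm \<xi>" by (simp add: prob_space \<eta>_def)
  finally show ?thesis .
qed

lemma \<psi>_weighted_integral:
  "(\<integral>\<^sup>+\<xi>. ennreal ((norm (\<psi> k \<xi>) * (1 + 2 powr (- real k) * norm \<xi>)^(CARD('n)+1))^r) \<partial>lborel)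
    \<le> ennreal (I\<^sub>\<psi>^r * 2 powr (real k * d))"
proof -
  note [measurable] = borel_measurable_fourier_measure[OF prob_space_\<phi> sets_\<phi>]
  define c where "c = 2 powr (- real k)"
  define f where "f = (\<lambda>\<xi>. ennreal ((norm (fourier_measure \<phi> \<xi>) * (1 + norm \<xi>)^(CARD('n)+1))^r))"
  have [measurable]: "f \<in> borel_measurable borel" unfolding f_def by measurable
  have c: "c > 0" by (simp add: c_def)
  have "(\<integral>\<^sup>+\<xi>. ennreal ((norm (\<psi> k \<xi>) * (1 + 2 powr (- real k) * norm \<xi>)^(CARD('n)+1))^r) \<partial>lborel) = (\<integral>\<^sup>+\<xi>. f (c *\<^sub>R \<xi>) \<partial>lborel)"
    using c by (simp add: f_def \<psi>_def c_def)
  also have "\<dots> = ennreal ((1/c) ^ CARD('n)) * (\<integral>\<^sup>+\<xi>. f \<xi> \<partial>lborel)"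
    using c by (subst nn_integral_scale) auto
  also have "(1/c) ^ CARD('n) = 2 powr (real k * d)"
    by (simp add: c_def d_def powr_minus divide_inverse two_powr_power)
  finally have eq: "(\<integral>\<^sup>+\<xi>. ennreal ((norm (\<psi> k \<xi>) * (1 + 2 powr (- real k) * norm \<xi>)^(CARD('n)+1))^r) \<partial>lborel)
    = ennreal (2 powr (real k * d)) * (\<integral>\<^sup>+\<xi>. f \<xi> \<partial>lborel)" .
  have "(\<integral>\<^sup>+\<xi>. f \<xi> \<partial>lborel) \<le> ennreal (I\<^sub>\<psi>^r)"
  proof -
    have "(\<integral>\<^sup>+\<xi>. f \<xi> \<partial>lborel) = ennreal (I\<^sub>\<psi> - 1)"
      using \<phi>_decay by (simp add: I\<^sub>\<psi>_def f_def less_top)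
    also have "\<dots> \<le> ennreal I\<^sub>\<psi>" by (intro ennreal_leI) simp
    also have "\<dots> \<le> ennreal (I\<^sub>\<psi>^r)"
      using r_pos by (intro ennreal_leI self_le_power) (auto simp: I\<^sub>\<psi>_def)
    finally show ?thesis .
  qed
  then have "ennreal (2 powr (real k * d)) * (\<integral>\<^sup>+\<xi>. f \<xi> \<partial>lborel) \<le> ennreal (2 powr (real k * d)) * ennreal (I\<^sub>\<psi>^r)"
    by (rule mult_left_mono) simp
  also have "\<dots> = ennreal (I\<^sub>\<psi>^r * 2 powr (real k * d))"
    using I\<psi>_pos by (simp add: mult.commute flip: ennreal_mult)
  finally show ?thesis unfolding eq .
qed

text \<open>The noise has one power of its weight to spare, so g may exceed a multiple of \<psi> k
  by the factor 1 + 2^-k norm \<xi>. This room is needed for \<psi> \<kappa> - 1, whose bound grows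
  linearly.\<close>

lemma tail_bound_by_\<psi>:
  assumes g: "g \<in> borel_measurable borel" and V: "V > 0"
    and le: "\<And>\<xi>. norm (g \<xi>) \<le> V * (norm (\<psi> k \<xi>) * (1 + 2 powr (- real k) * norm \<xi>))"
  shows "tail_bound r p g (\<lambda>j. V * I\<^sub>\<psi> * 2 powr (real k * d / p) * 2 powr (- \<gamma> * \<bar>real j - real k\<bar>))"
proof -
  have "(\<integral>\<^sup>+\<xi>. ennreal ((norm (g \<xi>) * (1 + 2 powr (- real k) * norm \<xi>) ^ CARD('n)) ^ r) \<partial>lborel)
    \<le> (\<integral>\<^sup>+\<xi>. ennreal (V^r) * ennreal ((norm (\<psi> k \<xi>) * (1 + 2 powr (- real k) * norm \<xi>)^(CARD('n)+1))^r) \<partial>lborel)"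
  proof (intro nn_integral_mono)
    fix \<xi>
    have "norm (g \<xi>) * (1 + 2 powr (- real k) * norm \<xi>) ^ CARD('n) \<le> V * (norm (\<psi> k \<xi>) * (1 + 2 powr (- real k) * norm \<xi>)) * (1 + 2 powr (- real k) * norm \<xi>) ^ CARD('n)"
      by (intro mult_right_mono le) auto
    then have "(norm (g \<xi>) * (1 + 2 powr (- real k) * norm \<xi>) ^ CARD('n))^r \<le> (V * (norm (\<psi> k \<xi>) * (1 + 2 powr (- real k) * norm \<xi>)^(CARD('n)+1)))^r"
      by (intro power_mono) (auto simp: mult_ac)
    then show "ennreal ((norm (g \<xi>) * (1 + 2 powr (- real k) * norm \<xi>) ^ CARD('n))^r) \<le>
      ennreal (V^r) * ennreal ((norm (\<psi> k \<xi>) * (1 + 2 powr (- real k) * norm \<xi>)^(CARD('n)+1))^r)"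
      using V by (subst ennreal_mult'[symmetric]) (auto simp: power_mult_distrib intro!: ennreal_leI)
  qed
  also have "\<dots> \<le> ennreal (V^r) * ennreal (I\<^sub>\<psi>^r * 2 powr (real k * d))"
    by (subst nn_integral_cmult, measurable) (intro mult_left_mono \<psi>_weighted_integral, simp)
  also have "\<dots> = ennreal ((V * I\<^sub>\<psi>)^r * 2 powr (real k * d))"
    using V by (simp add: power_mult_distrib mult_ac flip: ennreal_mult')
  finally show ?thesis
    using tail_bound_of_weighted_integral[OF g, of p r "V * I\<^sub>\<psi>" k] V I\<psi>_pos p_gt_2 r_pos
    by (simp add: d_def \<gamma>_def mult_ac)
qed

text \<open>The Fourier transform of the equidistributed mixture of noises centred at $x_a$ with scale
  $2^{-k_a}$, $a < L$; repeated cells encode unequal weights.\<close>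
definition F :: "nat \<Rightarrow> (nat \<Rightarrow> real^'n) \<Rightarrow> (nat \<Rightarrow> nat) \<Rightarrow> real^'n \<Rightarrow> complex" where
  "F L x k \<xi> = (\<Sum>a<L. cis (-2 * pi * (x a \<bullet> \<xi>)) * \<psi> (k a) \<xi>) / of_nat L"

lemma F_measurable [measurable]: "F L x k \<in> borel_measurable borel"
  unfolding F_def by measurable

text \<open>Stratified sampling: each cell contributes exactly n samples drawn from its own noise,
  so the expected sum is exactly L n F and every sample stays close to its parent. The N = L n
  independent terms give an error of order N^(-1/2) at each frequency. The factor \<psi> \<kappa>,
  of a scale unrelated to the k a, confines the error essentially to frequencies up to
  2^\<kappa>.\<close>

lemma single_scale_sampling:
  assumes L: "L \<ge> 1" and n: "n \<ge> 1"
  shows "\<exists>y. (\<forall>a<L. \<forall>l<n. norm (y a l - x a) \<le> 2 powr (- real (k a))) \<and>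
    tail_bound r p (\<lambda>\<xi>. ((\<Sum>a<L. \<Sum>l<n. cis (-2 * pi * (y a l \<bullet> \<xi>))) / of_nat (L * n) - F L x k \<xi>) * \<psi> \<kappa> \<xi>)
      (\<lambda>j. (1 + selection_const (r div 2)) * I\<^sub>\<psi> / sqrt (real (L * n)) * 2 powr (real \<kappa> * d / p) * 2 powr (- \<gamma> * \<bar>real j - real \<kappa>\<bar>))"
proof -
  note [measurable_cong] = sets_\<phi>
  define h where "h = r div 2"
  have rh: "r = 2 * h" using even_r by (simp add: h_def)
  define J where "J = {..<L} \<times> {..<n}"
  define N where "N = real (L * n)"
  have N: "N > 0" using L n by (simp add: N_def)
  have J: "finite J" "J \<noteq> {}" "real (card J) = N" using L n by (auto simp: J_def N_def lessThan_empty_iff bot_nat_def)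
  define P where "P = (\<lambda>(a, l::nat). distr \<phi> borel (\<lambda>y. x a + 2 powr (- real (k a)) *\<^sub>R y))"
  define W where "W = (\<lambda>\<xi>. ennreal ((norm (\<psi> \<kappa> \<xi>) * (1 + 2 powr (- real \<kappa>) * norm \<xi>) ^ CARD('n))^r))"
  have [measurable]: "W \<in> borel_measurable borel" unfolding W_def by measurable
  have W_le: "(\<integral>\<^sup>+\<xi>. W \<xi> \<partial>lborel) \<le> ennreal (I\<^sub>\<psi>^r * 2 powr (real \<kappa> * d))"
  proof -
    have "(\<integral>\<^sup>+\<xi>. W \<xi> \<partial>lborel) \<le> (\<integral>\<^sup>+\<xi>. ennreal ((norm (\<psi> \<kappa> \<xi>) * (1 + 2 powr (- real \<kappa>) * norm \<xi>) ^ (CARD('n) + 1))^r) \<partial>lborel)"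
      unfolding W_def by (intro nn_integral_mono ennreal_leI power_mono mult_left_mono power_increasing) auto
    also note \<psi>_weighted_integral
    finally show ?thesis .
  qed
  have "\<exists>y. (\<forall>i\<in>J. norm (y i - x (fst i)) \<le> 2 powr (- real (k (fst i)))) \<and>
    (\<integral>\<^sup>+\<xi>. ennreal (norm (\<Sum>i\<in>J. cis (-2 * pi * (y i \<bullet> \<xi>)) - fourier_measure (P i) \<xi>) ^ (2*h)) * W \<xi> \<partial>lborel)
      \<le> ennreal (selection_const h * real (card J) ^ h) * (\<integral>\<^sup>+\<xi>. W \<xi> \<partial>lborel)"
  proof (rule random_frequency_selection)
    show "prob_space (P i)" for i
      unfolding P_def by (cases i) (auto intro!: prob_space.prob_space_distr prob_space_\<phi>)
    show "sets (P i) = sets borel" for i by (cases i) (simp add: P_def)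
    show "AE y in P i. norm (y - x (fst i)) \<le> 2 powr (- real (k (fst i)))" for i
    proof -
      have "AE y in distr \<phi> borel (\<lambda>y. x (fst i) + 2 powr (- real (k (fst i))) *\<^sub>R y). norm (y - x (fst i)) \<le> 2 powr (- real (k (fst i)))"
        by (subst AE_distr_iff) (use \<phi>_bounded in \<open>auto elim!: eventually_mono simp: mult_left_le\<close>)
      then show ?thesis unfolding P_def by (simp only: case_prod_unfold)
    qed
    show "(\<integral>\<^sup>+\<xi>. W \<xi> \<partial>lborel) < \<infinity>" using W_le by (simp add: le_less_trans)
  qed (use J in auto)
  then obtain y where y: "\<And>i. i \<in> J \<Longrightarrow> norm (y i - x (fst i)) \<le> 2 powr (- real (k (fst i)))"
    and y_int: "(\<integral>\<^sup>+\<xi>. ennreal (norm (\<Sum>i\<in>J. cis (-2 * pi * (y i \<bullet> \<xi>)) - fourier_measure (P i) \<xi>) ^ (2*h)) * W \<xi> \<partial>lborel)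
      \<le> ennreal (selection_const h * N ^ h) * (\<integral>\<^sup>+\<xi>. W \<xi> \<partial>lborel)" using J(3) by auto
  define E where "E = (\<lambda>\<xi>. (\<Sum>a<L. \<Sum>l<n. cis (-2 * pi * (y (a, l) \<bullet> \<xi>))) / of_nat (L * n) - F L x k \<xi>)"
  have [measurable]: "E \<in> borel_measurable borel" unfolding E_def by measurable
  have sumE: "(\<Sum>i\<in>J. cis (-2 * pi * (y i \<bullet> \<xi>)) - fourier_measure (P i) \<xi>) = of_real N * E \<xi>" for \<xi>
  proof -
    have "(\<Sum>i\<in>J. fourier_measure (P i) \<xi>) = (\<Sum>a<L. \<Sum>l<n. cis (-2 * pi * (x a \<bullet> \<xi>)) * \<psi> (k a) \<xi>)"
      unfolding J_def sum.cartesian_product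
      by (intro sum.cong refl) (auto simp: P_def \<psi>_def fourier_measure_affine[OF prob_space_\<phi> sets_\<phi>])
    also have "\<dots> = of_real N * F L x k \<xi>"
      using L by (simp add: F_def N_def sum_distrib_left[symmetric] field_simps)
    finally have a: "(\<Sum>i\<in>J. fourier_measure (P i) \<xi>) = of_real N * F L x k \<xi>" .
    have "(\<Sum>i\<in>J. cis (-2 * pi * (y i \<bullet> \<xi>))) = (\<Sum>a<L. \<Sum>l<n. cis (-2 * pi * (y (a, l) \<bullet> \<xi>)))"
      unfolding J_def sum.cartesian_product by (intro sum.cong) auto
    also have "\<dots> = of_real N * ((\<Sum>a<L. \<Sum>l<n. cis (-2 * pi * (y (a, l) \<bullet> \<xi>))) / of_nat (L * n))"
      using L n by (simp add: N_def)
    finally show ?thesis unfolding sum_subtractf a E_def by (simp add: right_diff_distrib)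
  qed
  define V where "V = (1 + selection_const h) * I\<^sub>\<psi> / sqrt N"
  have V: "V > 0" using N I\<psi>_pos selection_const_pos[of h] by (simp add: V_def)
  have "(\<integral>\<^sup>+\<xi>. ennreal ((norm (E \<xi> * \<psi> \<kappa> \<xi>) * (1 + 2 powr (- real \<kappa>) * norm \<xi>) ^ CARD('n)) ^ r) \<partial>lborel)
    = (\<integral>\<^sup>+\<xi>. ennreal ((1/N)^r) * (ennreal (norm (of_real N * E \<xi>) ^ (2*h)) * W \<xi>) \<partial>lborel)"
  proof (intro nn_integral_cong)
    fix \<xi>
    have "(norm (E \<xi> * \<psi> \<kappa> \<xi>) * (1 + 2 powr (- real \<kappa>) * norm \<xi>) ^ CARD('n)) ^ r =
      (1/N)^r * (norm (of_real N * E \<xi>) ^ r * (norm (\<psi> \<kappa> \<xi>) * (1 + 2 powr (- real \<kappa>) * norm \<xi>) ^ CARD('n))^r)"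
      unfolding power_mult_distrib[symmetric] using N by (simp add: norm_mult mult.assoc)
    then show "ennreal ((norm (E \<xi> * \<psi> \<kappa> \<xi>) * (1 + 2 powr (- real \<kappa>) * norm \<xi>) ^ CARD('n)) ^ r) =
      ennreal ((1/N)^r) * (ennreal (norm (of_real N * E \<xi>) ^ (2*h)) * W \<xi>)"
      using N unfolding W_def rh by (simp add: ennreal_mult')
  qed
  also have "\<dots> = ennreal ((1/N)^r) * (\<integral>\<^sup>+\<xi>. ennreal (norm (of_real N * E \<xi>) ^ (2*h)) * W \<xi> \<partial>lborel)"
    by (rule nn_integral_cmult) measurable
  also have "\<dots> \<le> ennreal ((1/N)^r) * (ennreal (selection_const h * N ^ h) * ennreal (I\<^sub>\<psi>^r * 2 powr (real \<kappa> * d)))"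
    using y_int mult_left_mono[OF W_le, of "ennreal (selection_const h * N ^ h)"] unfolding sumE
    by (intro mult_left_mono) auto
  also have "\<dots> = ennreal ((1/N)^r * ((selection_const h * N ^ h) * (I\<^sub>\<psi>^r * 2 powr (real \<kappa> * d))))"
    using N selection_const_pos[of h] by (simp add: ennreal_mult' less_imp_le)
  also have "\<dots> \<le> ennreal (V^r * 2 powr (real \<kappa> * d))"
  proof (intro ennreal_leI)
    have "(1/N)^r * N^h = (1 / sqrt N)^r" using N by (simp add: rh power_mult power_divide power2_eq_square power_mult_distrib)
    moreover have "(1/N)^r * ((selection_const h * N ^ h) * (I\<^sub>\<psi>^r * 2 powr (real \<kappa> * d)))
      = selection_const h * (((1/N)^r * N^h) * I\<^sub>\<psi>^r) * 2 powr (real \<kappa> * d)"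
      by (simp only: mult_ac)
    ultimately have "(1/N)^r * ((selection_const h * N ^ h) * (I\<^sub>\<psi>^r * 2 powr (real \<kappa> * d)))
      = selection_const h * (I\<^sub>\<psi> / sqrt N)^r * 2 powr (real \<kappa> * d)"
      by (simp add: power_divide)
    \<comment> \<open>Avoids an r-th root: after adding 1 the constant can be absorbed into the base
      V.\<close>
    also have "selection_const h \<le> (1 + selection_const h)^r"
      using self_le_power[of "1 + selection_const h" r] selection_const_pos[of h] r_pos by simp
    then have "selection_const h * (I\<^sub>\<psi> / sqrt N)^r * 2 powr (real \<kappa> * d) \<le> (1 + selection_const h)^r * (I\<^sub>\<psi> / sqrt N)^r * 2 powr (real \<kappa> * d)"
      using N I\<psi>_pos by (intro mult_right_mono) auto
    also have "\<dots> = V^r * 2 powr (real \<kappa> * d)" by (simp add: V_def power_mult_distrib power_divide)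
    finally show "(1/N)^r * ((selection_const h * N ^ h) * (I\<^sub>\<psi>^r * 2 powr (real \<kappa> * d))) \<le> V^r * 2 powr (real \<kappa> * d)" .
  qed
  finally have "tail_bound r p (\<lambda>\<xi>. E \<xi> * \<psi> \<kappa> \<xi>) (\<lambda>j. V * 2 powr (real \<kappa> * d / p) * 2 powr (- \<gamma> * \<bar>real j - real \<kappa>\<bar>))"
    using tail_bound_of_weighted_integral[of "\<lambda>\<xi>. E \<xi> * \<psi> \<kappa> \<xi>" p r V \<kappa>] V p_gt_2 r_pos
    by (simp add: d_def \<gamma>_def)
  then show ?thesis unfolding E_def V_def N_def h_def
    using y by (intro exI[of _ "\<lambda>a l. y (a, l)"]) (auto simp: J_def)
qed

section \<open>The smoothing error and the superposition of scales\<close>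

lemma two_powr_abs_diff_le: "2 powr (- \<gamma> * \<bar>real j - real k\<bar>) \<le> 2 powr (\<gamma> * real k) * 2 powr (- \<gamma> * real j)"
proof -
  have "\<gamma> * (real j - real k) \<le> \<gamma> * \<bar>real j - real k\<bar>" using \<gamma>_pos by (intro mult_left_mono) auto
  then show ?thesis by (simp add: powr_add[symmetric] algebra_simps)
qed

text \<open>D may depend on the old configuration in any way, since it is fixed before \<kappa>; the
  gain 2^-\<kappa> then makes the perturbation caused by smoothing negligible.\<close>

lemma smoothing_error_tail_bound:
  assumes L: "L \<ge> 1"
  shows "\<exists>D>0. \<forall>\<kappa>. tail_bound r p (\<lambda>\<xi>. F L x k \<xi> * (\<psi> \<kappa> \<xi> - 1)) (\<lambda>j. 2 powr (- real \<kappa>) * (D * 2 powr (- \<gamma> * real j)))"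
proof -
  define D where "D = (\<Sum>a<L. 2 * pi * 2 powr (real (k a)) * I\<^sub>\<psi> * 2 powr (real (k a) * d / p) * 2 powr (\<gamma> * real (k a)))"
  have D: "D > 0" unfolding D_def using L I\<psi>_pos by (intro sum_pos) (auto intro!: mult_pos_pos simp: lessThan_empty_iff)
  have "tail_bound r p (\<lambda>\<xi>. F L x k \<xi> * (\<psi> \<kappa> \<xi> - 1)) (\<lambda>j. 2 powr (- real \<kappa>) * (D * 2 powr (- \<gamma> * real j)))" for \<kappa>
  proof -
    define g where "g = (\<lambda>a \<xi>. cis (-2 * pi * (x a \<bullet> \<xi>)) * \<psi> (k a) \<xi> * (\<psi> \<kappa> \<xi> - 1))"
    \<comment> \<open>Writes 2^-\<kappa> norm \<xi> as 2^(k a - \<kappa>) times 2^(-k a) norm \<xi>,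
      the form that \<open>tail_bound_by_\<psi>\<close> absorbs.\<close>
    define V where "V = (\<lambda>a. 2 * pi * 2 powr (real (k a) - real \<kappa>))"
    have tb: "tail_bound r p (g a) (\<lambda>j. V a * I\<^sub>\<psi> * 2 powr (real (k a) * d / p) * 2 powr (- \<gamma> * \<bar>real j - real (k a)\<bar>))" for a
    proof (rule tail_bound_by_\<psi>)
      show "g a \<in> borel_measurable borel" unfolding g_def by measurable
      fix \<xi>
      have "norm (g a \<xi>) = norm (\<psi> (k a) \<xi>) * norm (\<psi> \<kappa> \<xi> - 1)" by (simp add: g_def norm_mult)
      also have "\<dots> \<le> norm (\<psi> (k a) \<xi>) * (2 * pi * 2 powr (- real \<kappa>) * norm \<xi>)"
        by (intro mult_left_mono norm_\<psi>_diff_1_le) auto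
      also have "\<dots> = V a * (norm (\<psi> (k a) \<xi>) * (2 powr (- real (k a)) * norm \<xi>))"
        by (simp add: V_def powr_diff powr_minus divide_simps)
      also have "\<dots> \<le> V a * (norm (\<psi> (k a) \<xi>) * (1 + 2 powr (- real (k a)) * norm \<xi>))"
        by (intro mult_left_mono) (auto simp: V_def)
      finally show "norm (g a \<xi>) \<le> V a * (norm (\<psi> (k a) \<xi>) * (1 + 2 powr (- real (k a)) * norm \<xi>))" .
    qed (simp add: V_def)
    have "tail_bound r p (\<lambda>\<xi>. (1 / of_nat L) * (\<Sum>a<L. g a \<xi>)) (\<lambda>j. norm (1 / of_nat L :: complex) *
      (\<Sum>a<L. V a * I\<^sub>\<psi> * 2 powr (real (k a) * d / p) * 2 powr (- \<gamma> * \<bar>real j - real (k a)\<bar>)))"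
      using L by (intro tail_bound_cmult tail_bound_sum tb even_r r_pos) (auto simp: lessThan_empty_iff)
    then show ?thesis
    proof (rule tail_bound_mono)
      fix j
      have "norm (1 / of_nat L :: complex) * (\<Sum>a<L. V a * I\<^sub>\<psi> * 2 powr (real (k a) * d / p) * 2 powr (- \<gamma> * \<bar>real j - real (k a)\<bar>))
        \<le> 1 * (\<Sum>a<L. V a * I\<^sub>\<psi> * 2 powr (real (k a) * d / p) * (2 powr (\<gamma> * real (k a)) * 2 powr (- \<gamma> * real j)))"
        using L I\<psi>_pos by (intro mult_mono sum_mono mult_left_mono two_powr_abs_diff_le)
          (auto simp: norm_divide V_def intro!: sum_nonneg)
      also have "\<dots> = 2 powr (- real \<kappa>) * (D * 2 powr (- \<gamma> * real j))"
        by (simp add: D_def V_def sum_distrib_left sum_distrib_right powr_diff powr_minus field_simps)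
      finally show "norm (1 / of_nat L :: complex) * (\<Sum>a<L. V a * I\<^sub>\<psi> * 2 powr (real (k a) * d / p) * 2 powr (- \<gamma> * \<bar>real j - real (k a)\<bar>))
        \<le> 2 powr (- real \<kappa>) * (D * 2 powr (- \<gamma> * real j))" .
    qed (auto simp: F_def g_def sum_distrib_right)
  qed
  then show ?thesis using D by blast
qed

definition G\<^sub>0 :: real where "G\<^sub>0 = 2 / (1 - 2 powr (- \<gamma>))"

lemma G0_pos: "G\<^sub>0 > 0"
  using \<gamma>_pos by (simp add: G\<^sub>0_def powr_less_one)

text \<open>Schur-type estimate: rows and columns of the kernel 2^(-\<gamma> |j - i|) sum to at most
  \<open>G\<^sub>0\<close>, so the q-th power costs \<open>G\<^sub>0\<close> to the q - 1 and the
  sum over j one more \<open>G\<^sub>0\<close>. Errors of M distinct scales thus add like sequences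
  with disjoint supports, to M A^q instead of (M A)^q.\<close>

lemma sum_powr_superposition_le:
  assumes q: "1 < q" and A: "A \<ge> 0"
  shows "(\<Sum>j<m. (A * (\<Sum>i<M. 2 powr (- \<gamma> * \<bar>real j - real (K + i)\<bar>))) powr q) \<le> G\<^sub>0 powr q * (real M * A powr q)"
proof -
  define X where "X = (\<lambda>j. \<Sum>i<M. 2 powr (- \<gamma> * \<bar>real j - real (K + i)\<bar>))"
  have X0: "X j \<ge> 0" for j unfolding X_def by (intro sum_nonneg) auto
  have XG: "X j \<le> G\<^sub>0" for j
  proof -
    have "X j = (\<Sum>i\<in>(\<lambda>i. K + i) ` {..<M}. 2 powr (- \<gamma> * \<bar>real i - real j\<bar>))"
      unfolding X_def by (subst sum.reindex) (auto simp: abs_minus_commute)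
    also have "\<dots> \<le> G\<^sub>0" unfolding G\<^sub>0_def by (rule two_sided_geometric_sum_le[OF \<gamma>_pos]) auto
    finally show ?thesis .
  qed
  have "(A * X j) powr q \<le> A powr q * G\<^sub>0 powr (q - 1) * X j" for j
  proof (cases "X j = 0")
    case False
    then have "X j > 0" using X0[of j] by simp
    then have "X j powr q = X j powr (q - 1) * X j" by (simp add: powr_diff)
    also have "\<dots> \<le> G\<^sub>0 powr (q - 1) * X j" using X0 XG q by (intro mult_right_mono powr_mono2) auto
    finally have "A powr q * X j powr q \<le> A powr q * (G\<^sub>0 powr (q - 1) * X j)" by (intro mult_left_mono) auto
    then show ?thesis using A X0 by (simp add: powr_mult mult_ac)
  qed simp
  then have "(\<Sum>j<m. (A * X j) powr q) \<le> (\<Sum>j<m. A powr q * G\<^sub>0 powr (q - 1) * X j)" by (rule sum_mono)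
  also have "\<dots> = A powr q * G\<^sub>0 powr (q - 1) * (\<Sum>i<M. \<Sum>j<m. 2 powr (- \<gamma> * \<bar>real j - real (K + i)\<bar>))"
    unfolding X_def sum_distrib_left[symmetric] by (subst sum.swap) simp
  also have "\<dots> \<le> A powr q * G\<^sub>0 powr (q - 1) * (\<Sum>i<M. G\<^sub>0)"
    unfolding G\<^sub>0_def by (intro mult_left_mono sum_mono two_sided_geometric_sum_le[OF \<gamma>_pos]) auto
  also have "\<dots> = G\<^sub>0 powr q * (real M * A powr q)" using G0_pos by (simp add: powr_diff field_simps)
  finally show ?thesis unfolding X_def .
qed

text \<open>Order of choices: M and s without regard to the old configuration, then D from that
  configuration, and K last. Scale i uses noise of size 2^-(K+i) and about s 2^((K+i) \<alpha>)
  samples in total.\<close>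

lemma refinement_step:
  fixes \<Phi> :: "real \<Rightarrow> real" and x :: "nat \<Rightarrow> real^'n" and k :: "nat \<Rightarrow> nat"
  assumes q: "1 < q" and \<Phi>0: "\<Phi> 0 = 0"
    and lim: "((\<lambda>t. \<Phi> t / t powr ((q / (q - 1)) / 2)) \<longlongrightarrow> 0) (at_right 0)"
    and L: "L \<ge> 1" and \<epsilon>: "\<epsilon> > 0" and \<delta>: "\<delta> > 0"
  shows "\<exists>B x' k' \<beta>. B \<ge> 1 \<and>
    (\<forall>a<L. \<forall>b<B. norm (x' (a * B + b) - x a) \<le> 2 powr (- real (k a)) \<and> k a + 2 \<le> k' (a * B + b)) \<and>
    (\<forall>c<L * B. K\<^sub>0 \<le> k' c) \<and>
    tail_bound r p (\<lambda>\<xi>. F (L * B) x' k' \<xi> - F L x k \<xi>) \<beta> \<and>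
    (\<forall>m. (\<Sum>j<m. \<beta> j powr q) \<le> \<epsilon>) \<and>
    H_content_delta (2 * d / p) \<Phi> (\<Union>c<L * B. ball (x' c) (2 powr (1 - real (k' c)))) \<delta> \<le> ennreal \<epsilon>"
proof -
  define \<alpha> where "\<alpha> = 2 * d / p"
  have \<alpha>: "\<alpha> > 0" using d_pos p_gt_2 by (simp add: \<alpha>_def)
  define Cs where "Cs = (1 + selection_const (r div 2)) * I\<^sub>\<psi>"
  have Cs: "Cs > 0" using selection_const_pos[of "r div 2"] I\<psi>_pos by (simp add: Cs_def)
  \<comment> \<open>Budget: 2^q for \<open>add_powr_le\<close>, the power of
    \<open>G\<^sub>0\<close> for the sampling errors, and 1 for the smoothing error.\<close>
  define \<epsilon>\<^sub>1 where "\<epsilon>\<^sub>1 = \<epsilon> / (2 powr q * (G\<^sub>0 powr q + 1))"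
  have den: "2 powr q * (G\<^sub>0 powr q + 1) \<ge> 1"
  proof -
    have "1 * 1 \<le> 2 powr q * (G\<^sub>0 powr q + 1)" using q by (intro mult_mono) (auto simp: ge_one_powr_ge_zero)
    then show ?thesis by simp
  qed
  have \<epsilon>1: "\<epsilon>\<^sub>1 > 0" "\<epsilon>\<^sub>1 \<le> \<epsilon>"
  proof -
    show "\<epsilon>\<^sub>1 > 0" unfolding \<epsilon>\<^sub>1_def using \<epsilon> den by (intro divide_pos_pos) linarith+
    have "\<epsilon> * 1 \<le> \<epsilon> * (2 powr q * (G\<^sub>0 powr q + 1))" using \<epsilon> den by (intro mult_left_mono) auto
    then show "\<epsilon>\<^sub>1 \<le> \<epsilon>" unfolding \<epsilon>\<^sub>1_def using den by (subst pos_divide_le_eq) linarith+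
  qed
  \<comment> \<open>The factor sqrt 2 pays for rounding the number of samples down to an
    integer.\<close>
  have C2: "Cs * sqrt 2 > 0" using Cs by simp
  obtain M :: nat and s where M: "M \<ge> 1" and s: "s > 0" and Ms: "M * (Cs * sqrt 2 / (M * sqrt s)) powr q \<le> \<epsilon>\<^sub>1"
    and M\<Phi>: "\<And>t. 0 < t \<Longrightarrow> t \<le> 4 powr \<alpha> * s \<Longrightarrow> M * \<Phi> t \<le> \<epsilon>\<^sub>1"
    by (rule scale_parameters[OF q C2 \<epsilon>1(1) lim, of \<alpha>]) (rule that)
  from smoothing_error_tail_bound[OF L, of x k] obtain D where D: "D > 0"
    and D': "\<forall>\<kappa>. tail_bound r p (\<lambda>\<xi>. F L x k \<xi> * (\<psi> \<kappa> \<xi> - 1)) (\<lambda>j. 2 powr (- real \<kappa>) * (D * 2 powr (- \<gamma> * real j)))"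
    by (elim exE conjE) (rule that)
  note D_tail = D'[THEN spec]
  define SB where "SB = D powr q * (2 / (1 - 2 powr (- (\<gamma> * q))))"
  have SB: "(\<Sum>j<m. (D * 2 powr (- \<gamma> * real j)) powr q) \<le> SB" for m
  proof -
    have "(\<Sum>j<m. (D * 2 powr (- \<gamma> * real j)) powr q) = D powr q * (\<Sum>j<m. 2 powr (- (\<gamma> * q) * \<bar>real j - real 0\<bar>))"
      using D by (simp add: powr_mult powr_powr sum_distrib_left mult_ac)
    also have "\<dots> \<le> SB"
      unfolding SB_def using \<gamma>_pos q by (intro mult_left_mono two_sided_geometric_sum_le) auto
    finally show ?thesis .
  qed
  define z where "z = (\<lambda>K::nat. 2 powr (- real K))"
  have zpos: "0 \<le> z K" for K by (simp add: z_def)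
  have z0: "z \<longlonglongrightarrow> 0"
  proof -
    have "z = (\<lambda>K. (1/2)^K)" by (simp add: z_def fun_eq_iff powr_minus powr_realpow power_one_over inverse_eq_divide)
    then show ?thesis using LIMSEQ_power_zero[of "1/2::real"] by simp
  qed
  have "(\<lambda>K. z K powr \<alpha>) \<longlonglongrightarrow> 0 powr \<alpha>" using \<alpha> by (intro tendsto_powr' z0) (auto simp: zpos)
  then have e1: "eventually (\<lambda>K. z K powr \<alpha> < s / L) sequentially"
    using s L \<alpha> by (intro order_tendstoD(2)) auto
  have "(\<lambda>K. z K powr q * SB) \<longlonglongrightarrow> 0 powr q * SB" using q by (intro tendsto_intros tendsto_powr' z0) (auto simp: zpos)
  then have e2: "eventually (\<lambda>K. z K powr q * SB < \<epsilon>\<^sub>1) sequentially"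
    using \<epsilon>1 q by (intro order_tendstoD(2)) auto
  have "(\<lambda>K. 4 * z K) \<longlonglongrightarrow> 4 * 0" by (intro tendsto_intros z0)
  then have e3: "eventually (\<lambda>K. 4 * z K < \<delta>) sequentially"
    using \<delta> by (intro order_tendstoD(2)) auto
  \<comment> \<open>In turn: at least one sample per old cell at every scale, a small smoothing
    error, balls finer than \<delta>, and scales at least \<open>K\<^sub>0\<close> and two beyond
    every old one. The sum of the k a stands in for their maximum.\<close>
  have "eventually (\<lambda>K. z K powr \<alpha> < s / L \<and> z K powr q * SB < \<epsilon>\<^sub>1 \<and> 4 * z K < \<delta> \<and> K\<^sub>0 + (\<Sum>a<L. k a) + 2 \<le> K) sequentially"
    by (intro eventually_conj e1 e2 e3 eventually_ge_at_top)
  then obtain K where K1: "z K powr \<alpha> < s / L" and K2: "z K powr q * SB < \<epsilon>\<^sub>1" and K3: "4 * z K < \<delta>"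
    and K4: "K\<^sub>0 + (\<Sum>a<L. k a) + 2 \<le> K"
    by (metis (mono_tags, lifting) eventually_happens' sequentially_bot)
  have K5: "k a + 2 \<le> K" if "a < L" for a
    using K4 member_le_sum[of a "{..<L}" k] that by simp
  \<comment> \<open>The intended number of samples at scale K + i, shared evenly among the L cells
    and rounded down. As v i / L >= 1, rounding loses at most a factor 2.\<close>
  define v where "v = (\<lambda>i::nat. s * 2 powr (real (K + i) * \<alpha>))"
  define n where "n = (\<lambda>i. nat \<lfloor>v i / L\<rfloor>)"
  have vL: "v i / L \<ge> 1" for i
  proof -
    have "1 = z K powr \<alpha> * 2 powr (real K * \<alpha>)" by (simp add: z_def powr_powr powr_add[symmetric])
    also have "\<dots> \<le> (s / L) * 2 powr (real (K + i) * \<alpha>)"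
      using K1 \<alpha> s L by (intro mult_mono) auto
    finally show ?thesis by (simp add: v_def)
  qed
  have n_bounds: "n i \<ge> 1" "real (n i) \<le> v i / L" "v i / L \<le> 2 * real (n i)" for i
  proof -
    have f: "\<lfloor>v i / L\<rfloor> \<ge> 1" using vL[of i] by simp
    then show 1: "n i \<ge> 1" unfolding n_def by linarith
    have "real (n i) = of_int \<lfloor>v i / L\<rfloor>" using f by (simp add: n_def)
    then show "real (n i) \<le> v i / L" "v i / L \<le> 2 * real (n i)" using 1 by linarith+
  qed
  have N: "real (L * n i) \<le> v i" "v i \<le> 2 * real (L * n i)" for i
    using n_bounds[of i] L by (auto simp: field_simps)
  have "\<forall>i. \<exists>y. (\<forall>a<L. \<forall>l<n i. norm (y a l - x a) \<le> 2 powr (- real (k a))) \<and>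
    tail_bound r p (\<lambda>\<xi>. ((\<Sum>a<L. \<Sum>l<n i. cis (-2 * pi * (y a l \<bullet> \<xi>))) / of_nat (L * n i) - F L x k \<xi>) * \<psi> (K + i) \<xi>)
      (\<lambda>j. Cs / sqrt (real (L * n i)) * 2 powr (real (K + i) * d / p) * 2 powr (- \<gamma> * \<bar>real j - real (K + i)\<bar>))"
    unfolding Cs_def by (intro allI single_scale_sampling[OF L n_bounds(1)])
  from choice[OF this] obtain y where Y: "\<forall>i. (\<forall>a<L. \<forall>l<n i. norm (y i a l - x a) \<le> 2 powr (- real (k a))) \<and>
    tail_bound r p (\<lambda>\<xi>. ((\<Sum>a<L. \<Sum>l<n i. cis (-2 * pi * (y i a l \<bullet> \<xi>))) / of_nat (L * n i) - F L x k \<xi>) * \<psi> (K + i) \<xi>)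
      (\<lambda>j. Cs / sqrt (real (L * n i)) * 2 powr (real (K + i) * d / p) * 2 powr (- \<gamma> * \<bar>real j - real (K + i)\<bar>))"
    by (elim exE) (rule that)
  note y = Y[THEN spec, THEN conjunct1, rule_format]
  note y_tail = Y[THEN spec, THEN conjunct2]
  define E where "E = (\<lambda>i \<xi>. ((\<Sum>a<L. \<Sum>l<n i. cis (-2 * pi * (y i a l \<bullet> \<xi>))) / of_nat (L * n i) - F L x k \<xi>) * \<psi> (K + i) \<xi>)"
  have E_tail: "tail_bound r p (E i) (\<lambda>j. Cs * sqrt 2 / sqrt s * 2 powr (- \<gamma> * \<bar>real j - real (K + i)\<bar>))" for i
    unfolding E_def
  proof (rule tail_bound_mono[OF y_tail])
    fix j
    \<comment> \<open>As \<alpha> = 2 d / p, w is the square root of v i / s. The gain N^(-1/2) from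
      sampling therefore cancels the growth 2^((K+i) d / p), and all scales contribute
      equally.\<close>
    define w where "w = 2 powr (real (K + i) * d / p)"
    have w: "w > 0" by (simp add: w_def)
    have v: "v i = s * w^2" by (simp add: v_def w_def \<alpha>_def two_powr_power mult_ac)
    have "sqrt s * w \<le> sqrt 2 * sqrt (real (L * n i))"
    proof -
      have "sqrt s * w = sqrt (v i)" using w s by (simp add: v real_sqrt_mult)
      also have "\<dots> \<le> sqrt (2 * real (L * n i))" using N(2)[of i] by (rule real_sqrt_le_mono)
      finally show ?thesis by (simp add: real_sqrt_mult)
    qed
    moreover have "sqrt (real (L * n i)) > 0" using L n_bounds(1)[of i] by simp
    ultimately have "w / sqrt (real (L * n i)) \<le> sqrt 2 / sqrt s" using s by (simp add: field_simps)
    then have "Cs * (w / sqrt (real (L * n i))) * 2 powr (- \<gamma> * \<bar>real j - real (K + i)\<bar>) \<le> Cs * (sqrt 2 / sqrt s) * 2 powr (- \<gamma> * \<bar>real j - real (K + i)\<bar>)"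
      using Cs by (intro mult_right_mono mult_left_mono) auto
    then show "Cs / sqrt (real (L * n i)) * 2 powr (real (K + i) * d / p) * 2 powr (- \<gamma> * \<bar>real j - real (K + i)\<bar>)
      \<le> Cs * sqrt 2 / sqrt s * 2 powr (- \<gamma> * \<bar>real j - real (K + i)\<bar>)"
      by (simp add: w_def)
  qed measurable
  define P where "P = (\<Prod>i<M. n i)"
  define B where "B = P * M"
  have P: "P > 0" unfolding P_def using n_bounds(1) by (intro prod_pos) (auto simp: Suc_le_eq)
  have B: "B \<ge> 1" using P M by (simp add: B_def Suc_le_eq)
  define x' where "x' = (\<lambda>c. y (c mod B mod M) (c div B) (c mod B div M mod n (c mod B mod M)))"
  define k' where "k' = (\<lambda>c. K + c mod B mod M)"
  have nM: "b mod n i < n i" for b i using n_bounds(1)[of i] by simp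
  have F': "F (L * B) x' k' \<xi> = (\<Sum>i<M. (\<Sum>a<L. \<Sum>l<n i. cis (-2 * pi * (y i a l \<bullet> \<xi>)) * \<psi> (K + i) \<xi>) / of_nat (L * n i)) / of_nat M" for \<xi>
    using average_over_digits[OF M L n_bounds(1), of "\<lambda>a i l. cis (-2 * pi * (y i a l \<bullet> \<xi>)) * \<psi> (K + i) \<xi>"]
    unfolding F_def x'_def k'_def B_def P_def by simp
  \<comment> \<open>At each scale, new minus old is the sampling error times \<psi> plus the old
    transform times \<psi> - 1.\<close>
  have diff: "F (L * B) x' k' \<xi> - F L x k \<xi> = (1 / of_nat M) * (\<Sum>i<M. E i \<xi>) + (1 / of_nat M) * (\<Sum>i<M. F L x k \<xi> * (\<psi> (K + i) \<xi> - 1))" for \<xi>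
  proof -
    have "(\<Sum>i<M. E i \<xi>) + (\<Sum>i<M. F L x k \<xi> * (\<psi> (K + i) \<xi> - 1)) =
      (\<Sum>i<M. (\<Sum>a<L. \<Sum>l<n i. cis (-2 * pi * (y i a l \<bullet> \<xi>)) * \<psi> (K + i) \<xi>) / of_nat (L * n i) - F L x k \<xi>)"
      unfolding sum.distrib[symmetric] E_def
      by (intro sum.cong refl) (simp add: algebra_simps sum_distrib_left sum_distrib_right)
    also have "\<dots> = of_nat M * (F (L * B) x' k' \<xi> - F L x k \<xi>)"
      using M by (simp add: F' sum_subtractf right_diff_distrib)
    finally show ?thesis using M by (simp add: field_simps)
  qed
  define A where "A = Cs * sqrt 2 / (M * sqrt s)"
  define \<beta> where "\<beta> = (\<lambda>j. A * (\<Sum>i<M. 2 powr (- \<gamma> * \<bar>real j - real (K + i)\<bar>)) + z K * (D * 2 powr (- \<gamma> * real j)))"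
  have M0: "(1 / of_nat M :: complex) \<noteq> 0" "{..<M} \<noteq> {}" using M by (auto simp: lessThan_empty_iff bot_nat_def)
  have "tail_bound r p (\<lambda>\<xi>. F (L * B) x' k' \<xi> - F L x k \<xi>)
    (\<lambda>j. norm (1 / of_nat M :: complex) * (\<Sum>i<M. Cs * sqrt 2 / sqrt s * 2 powr (- \<gamma> * \<bar>real j - real (K + i)\<bar>))
      + norm (1 / of_nat M :: complex) * (\<Sum>i<M. 2 powr (- real (K + i)) * (D * 2 powr (- \<gamma> * real j))))"
    unfolding diff by (intro tail_bound_add tail_bound_cmult tail_bound_sum E_tail D_tail even_r r_pos M0) auto
  then have tail: "tail_bound r p (\<lambda>\<xi>. F (L * B) x' k' \<xi> - F L x k \<xi>) \<beta>"
  proof (rule tail_bound_mono)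
    fix j
    have "(\<Sum>i<M. 2 powr (- real (K + i)) * (D * 2 powr (- \<gamma> * real j))) \<le> (\<Sum>i<M. z K * (D * 2 powr (- \<gamma> * real j)))"
      using D by (intro sum_mono mult_right_mono) (auto simp: z_def)
    also have "\<dots> = M * (z K * (D * 2 powr (- \<gamma> * real j)))" by simp
    finally have "(1 / M) * (\<Sum>i<M. 2 powr (- real (K + i)) * (D * 2 powr (- \<gamma> * real j))) \<le> (1 / M) * (M * (z K * (D * 2 powr (- \<gamma> * real j))))"
      by (intro mult_left_mono) auto
    then have "(1 / M) * (\<Sum>i<M. 2 powr (- real (K + i)) * (D * 2 powr (- \<gamma> * real j))) \<le> z K * (D * 2 powr (- \<gamma> * real j))"
      using M by simp
    moreover have "(1 / M) * (\<Sum>i<M. Cs * sqrt 2 / sqrt s * 2 powr (- \<gamma> * \<bar>real j - real (K + i)\<bar>)) = A * (\<Sum>i<M. 2 powr (- \<gamma> * \<bar>real j - real (K + i)\<bar>))"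
      by (simp add: A_def sum_distrib_left)
    ultimately show "norm (1 / of_nat M :: complex) * (\<Sum>i<M. Cs * sqrt 2 / sqrt s * 2 powr (- \<gamma> * \<bar>real j - real (K + i)\<bar>))
      + norm (1 / of_nat M :: complex) * (\<Sum>i<M. 2 powr (- real (K + i)) * (D * 2 powr (- \<gamma> * real j))) \<le> \<beta> j"
      by (simp add: \<beta>_def norm_divide)
  qed auto
  have sum\<beta>: "(\<Sum>j<m. \<beta> j powr q) \<le> \<epsilon>" for m
  proof -
    define X where "X = (\<lambda>j. A * (\<Sum>i<M. 2 powr (- \<gamma> * \<bar>real j - real (K + i)\<bar>)))"
    define Y where "Y = (\<lambda>j. D * 2 powr (- \<gamma> * real j))"
    have A: "A \<ge> 0" using Cs s by (simp add: A_def)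
    have X: "X j \<ge> 0" for j unfolding X_def using A by (intro mult_nonneg_nonneg sum_nonneg) auto
    have Y: "Y j \<ge> 0" for j using D by (simp add: Y_def)
    have zK: "z K \<ge> 0" by (simp add: z_def)
    have "(\<Sum>j<m. \<beta> j powr q) \<le> (\<Sum>j<m. 2 powr q * (X j powr q + (z K * Y j) powr q))"
    proof (rule sum_mono)
      fix j
      have "\<beta> j = X j + z K * Y j" by (simp add: \<beta>_def X_def Y_def)
      then show "\<beta> j powr q \<le> 2 powr q * (X j powr q + (z K * Y j) powr q)"
        using X[of j] Y[of j] zK q by (simp add: add_powr_le)
    qed
    also have "\<dots> = 2 powr q * ((\<Sum>j<m. X j powr q) + z K powr q * (\<Sum>j<m. Y j powr q))"
      using Y zK by (simp add: sum_distrib_left sum.distrib distrib_left powr_mult)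
    also have "\<dots> \<le> 2 powr q * (G\<^sub>0 powr q * (real M * A powr q) + z K powr q * SB)"
      unfolding X_def Y_def using q A by (intro mult_left_mono add_mono sum_powr_superposition_le SB) auto
    also have "\<dots> \<le> 2 powr q * (G\<^sub>0 powr q * \<epsilon>\<^sub>1 + \<epsilon>\<^sub>1)"
      using Ms K2 by (intro mult_left_mono add_mono) (auto simp: A_def)
    also have "\<dots> = \<epsilon>\<^sub>1 * (2 powr q * (G\<^sub>0 powr q + 1))" by (simp add: algebra_simps)
    also have "\<dots> = \<epsilon>" unfolding \<epsilon>\<^sub>1_def using den by (intro nonzero_eq_divide_eq[THEN iffD1] refl) linarith
    finally show ?thesis .
  qed
  \<comment> \<open>The cover is indexed by triples of scale, parent and sample: the list of L * B
    cells contains repetitions, which would inflate the block sums entering \<Phi>.\<close>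
  define J where "J = Sigma {..<M} (\<lambda>i. {..<L} \<times> {..<n i})"
  have J: "finite J" by (simp add: J_def)
  have "H_content_delta \<alpha> \<Phi> (\<Union>c<L * B. ball (x' c) (2 powr (1 - real (k' c)))) \<delta>
    \<le> (\<Sum>i\<in>(\<lambda>t. K + fst t) ` J. ennreal (\<Phi> (card {t\<in>J. K + fst t = i} * (2 powr (2 - real i)) powr \<alpha>)))"
  proof (rule H_content_delta_finite_cover[where c = "\<lambda>(i, a, l). y i a l" and k = "\<lambda>t. K + fst t" and J = J and \<Phi> = \<Phi>])
    show "finite J" "\<delta> > 0" "\<Phi> 0 = 0" by fact+
    fix t :: "nat \<times> nat \<times> nat"
    have "2 powr (2 - real (K + fst t)) \<le> 2 powr (2 - real K)" by simp
    also have "\<dots> = 4 * z K" by (simp add: z_def powr_diff powr_minus divide_inverse)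
    finally show "2 powr (2 - real (K + fst t)) < \<delta>" using K3 by simp
  next
    show "(\<Union>c<L * B. ball (x' c) (2 powr (1 - real (k' c)))) \<subseteq> (\<Union>t\<in>J. ball (case t of (i, a, l) \<Rightarrow> y i a l) (2 powr (1 - real (K + fst t))))"
    proof (rule UN_least)
      fix c assume c: "c \<in> {..<L * B}"
      define t where "t = (c mod B mod M, c div B, c mod B div M mod n (c mod B mod M))"
      have "t \<in> J" using c M nM by (auto simp: t_def J_def less_mult_imp_div_less)
      then show "ball (x' c) (2 powr (1 - real (k' c))) \<subseteq> (\<Union>t\<in>J. ball (case t of (i, a, l) \<Rightarrow> y i a l) (2 powr (1 - real (K + fst t))))"
        by (intro SUP_upper2[of t]) (auto simp: t_def x'_def k'_def)
    qed
  qed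
  \<comment> \<open>Each of the M scales i' carries at most s 2^(i' \<alpha>) balls of diameter 4 *
    2^-i', so its block sum is at most 4^\<alpha> s, where \<Phi> is at most \<epsilon> / M.\<close>
  also have "\<dots> \<le> (\<Sum>i\<in>(\<lambda>t. K + fst t) ` J. ennreal (\<epsilon> / M))"
  proof (intro sum_mono ennreal_leI)
    fix i' assume "i' \<in> (\<lambda>t. K + fst t) ` J"
    then obtain i where i: "i < M" "i' = K + i" by (auto simp: J_def)
    have "{t\<in>J. K + fst t = i'} = {i} \<times> ({..<L} \<times> {..<n i})" using i by (auto simp: J_def)
    then have card: "card {t\<in>J. K + fst t = i'} = L * n i" by (simp add: card_cartesian_product)
    define t where "t = real (L * n i) * (2 powr (2 - real i')) powr \<alpha>"
    have "t > 0" using L n_bounds(1)[of i] by (simp add: t_def Suc_le_eq)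
    moreover have "t \<le> 4 powr \<alpha> * s"
    proof -
      have "t \<le> v i * (2 powr (2 - real i')) powr \<alpha>" unfolding t_def by (intro mult_right_mono N) auto
      also have "2 powr (2 - real i') = 4 * 2 powr (- real i')" by (simp add: powr_diff powr_minus divide_inverse)
      also have "v i * (4 * 2 powr (- real i')) powr \<alpha> = 4 powr \<alpha> * s * (2 powr (real i' * \<alpha>) * 2 powr (- real i' * \<alpha>))"
        by (simp add: v_def i powr_mult powr_powr)
      also have "\<dots> = 4 powr \<alpha> * s" by (simp add: powr_add[symmetric])
      finally show ?thesis .
    qed
    ultimately have "M * \<Phi> t \<le> \<epsilon>\<^sub>1" by (rule M\<Phi>)
    then have "\<Phi> t \<le> \<epsilon> / M" using M \<epsilon>1 by (simp add: field_simps)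
    then show "\<Phi> (real (card {t\<in>J. K + fst t = i'}) * (2 powr (2 - real i')) powr \<alpha>) \<le> \<epsilon> / M"
      by (simp add: t_def card)
  qed
  also have "\<dots> \<le> (\<Sum>i\<in>{K..<K+M}. ennreal (\<epsilon> / M))"
    by (intro sum_mono2) (auto simp: J_def)
  also have "\<dots> = ennreal \<epsilon>"
    using M \<epsilon> by (simp add: ennreal_of_nat_eq_real_of_nat flip: ennreal_mult')
  finally have content: "H_content_delta \<alpha> \<Phi> (\<Union>c<L * B. ball (x' c) (2 powr (1 - real (k' c)))) \<delta> \<le> ennreal \<epsilon>" .
  have near: "norm (x' (a * B + b) - x a) \<le> 2 powr (- real (k a)) \<and> k a + 2 \<le> k' (a * B + b)" if "a < L" "b < B" for a b
    using that y[of a, OF that(1) nM] K5[OF that(1)] by (auto simp: x'_def k'_def intro: trans_le_add1)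
  have "K\<^sub>0 \<le> k' c" for c using K4 by (simp add: k'_def)
  then show ?thesis
    using B near tail sum\<beta> content unfolding \<alpha>_def by blast
qed

section \<open>The limit measure\<close>

text \<open>Dependent choice with tolerance 4^(-n q), the rate expected by
  \<open>summable_superposition\<close>, and mesh 1/(n+1) tending to 0. Asking for scales of at
  least n in generation n makes the cells shrink.\<close>

lemma refinement_sequence:
  fixes \<Phi> :: "real \<Rightarrow> real"
  assumes q: "1 < q" and \<Phi>0: "\<Phi> 0 = 0"
    and lim: "((\<lambda>t. \<Phi> t / t powr ((q / (q - 1)) / 2)) \<longlongrightarrow> 0) (at_right 0)"
  obtains L B :: "nat \<Rightarrow> nat" and x :: "nat \<Rightarrow> nat \<Rightarrow> real^'n" and k :: "nat \<Rightarrow> nat \<Rightarrow> nat" and \<beta> :: "nat \<Rightarrow> nat \<Rightarrow> real"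
  where "\<And>n. L n \<ge> 1" "\<And>n. B n \<ge> 1" "\<And>n. L (Suc n) = L n * B n" "\<And>n c. c < L n \<Longrightarrow> n \<le> k n c"
    "\<And>n a b. a < L n \<Longrightarrow> b < B n \<Longrightarrow> norm (x (Suc n) (a * B n + b) - x n a) \<le> 2 powr (- real (k n a))"
    "\<And>n a b. a < L n \<Longrightarrow> b < B n \<Longrightarrow> k n a + 2 \<le> k (Suc n) (a * B n + b)"
    "\<And>n. tail_bound r p (\<lambda>\<xi>. F (L (Suc n)) (x (Suc n)) (k (Suc n)) \<xi> - F (L n) (x n) (k n) \<xi>) (\<beta> n)"
    "\<And>n m. (\<Sum>j<m. \<beta> n j powr q) \<le> 4 powr (- (real n * q))"
    "\<And>n. H_content_delta (2 * d / p) \<Phi> (\<Union>c<L (Suc n). ball (x (Suc n) c) (2 powr (1 - real (k (Suc n) c)))) (1 / (real n + 1)) \<le> ennreal (4 powr (- (real n * q)))"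
    "L 0 = 1" "x 0 = (\<lambda>_. 0)" "k 0 = (\<lambda>_. 0)"
proof -
  \<comment> \<open>The clause for n = 0 pins down the starting configuration, one cell of scale 1
    at the origin, which the choice principle would otherwise forget.\<close>
  define P where "P = (\<lambda>n (L::nat, x::nat \<Rightarrow> real^'n, k::nat \<Rightarrow> nat). L \<ge> 1 \<and> (\<forall>c<L. n \<le> k c) \<and>
    (n = 0 \<longrightarrow> L = 1 \<and> x = (\<lambda>_. 0) \<and> k = (\<lambda>_. 0)))"
  define R where "R = (\<lambda>n (L::nat, x::nat \<Rightarrow> real^'n, k::nat \<Rightarrow> nat) (L'::nat, x', k') B \<beta>. B \<ge> 1 \<and> L' = L * B \<and>
    (\<forall>a<L. \<forall>b<B. norm (x' (a * B + b) - x a) \<le> 2 powr (- real (k a)) \<and> k a + 2 \<le> k' (a * B + b)) \<and>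
    tail_bound r p (\<lambda>\<xi>. F L' x' k' \<xi> - F L x k \<xi>) \<beta> \<and>
    (\<forall>m. (\<Sum>j<m. \<beta> j powr q) \<le> 4 powr (- (real n * q))) \<and>
    H_content_delta (2 * d / p) \<Phi> (\<Union>c<L'. ball (x' c) (2 powr (1 - real (k' c)))) (1 / (real n + 1)) \<le> ennreal (4 powr (- (real n * q))))"
  have "\<exists>f. \<forall>n. P n (f n) \<and> (\<exists>B \<beta>. R n (f n) (f (Suc n)) B \<beta>)"
  proof (rule dependent_nat_choice)
    show "\<exists>s. P 0 s" by (intro exI[of _ "(1, \<lambda>_. 0, \<lambda>_. 0)"]) (simp add: P_def)
    fix s n assume s: "P n s"
    obtain L x k where [simp]: "s = (L, x, k)" by (cases s)
    have "L \<ge> 1" using s by (simp add: P_def)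
    from refinement_step[OF q \<Phi>0 lim this, of "4 powr (- (real n * q))" "1 / (real n + 1)" x k "Suc n"]
    obtain B x' k' \<beta> where *: "B \<ge> 1"
      "\<forall>a<L. \<forall>b<B. norm (x' (a * B + b) - x a) \<le> 2 powr (- real (k a)) \<and> k a + 2 \<le> k' (a * B + b)"
      "\<forall>c<L * B. Suc n \<le> k' c"
      "tail_bound r p (\<lambda>\<xi>. F (L * B) x' k' \<xi> - F L x k \<xi>) \<beta>"
      "\<forall>m. (\<Sum>j<m. \<beta> j powr q) \<le> 4 powr (- (real n * q))"
      "H_content_delta (2 * d / p) \<Phi> (\<Union>c<L * B. ball (x' c) (2 powr (1 - real (k' c)))) (1 / (real n + 1)) \<le> ennreal (4 powr (- (real n * q)))"
      by auto
    have "P (Suc n) (L * B, x', k')" using * \<open>L \<ge> 1\<close> by (auto simp: P_def Suc_le_eq)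
    moreover have "R n s (L * B, x', k') B \<beta>" unfolding R_def using * by simp
    ultimately show "\<exists>s'. P (Suc n) s' \<and> (\<exists>B \<beta>. R n s s' B \<beta>)" by blast
  qed
  then obtain f where f: "\<And>n. P n (f n)" "\<forall>n. \<exists>B \<beta>. R n (f n) (f (Suc n)) B \<beta>" by blast
  from choice[OF f(2)] obtain B where "\<forall>n. \<exists>\<beta>. R n (f n) (f (Suc n)) (B n) \<beta>" by blast
  from choice[OF this] obtain \<beta> where R: "\<And>n. R n (f n) (f (Suc n)) (B n) (\<beta> n)" by blast
  define L x k where "L n = fst (f n)" and "x n = fst (snd (f n))" and "k n = snd (snd (f n))" for n
  have fn: "f n = (L n, x n, k n)" for n by (simp add: L_def x_def k_def)
  note P = f(1)[unfolded fn P_def prod.case]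
  note R = R[unfolded fn R_def prod.case]
  show ?thesis
  proof (rule that[of L B k x \<beta>])
    fix n
    show "tail_bound r p (\<lambda>\<xi>. F (L (Suc n)) (x (Suc n)) (k (Suc n)) \<xi> - F (L n) (x n) (k n) \<xi>) (\<beta> n)"
      using R[of n] by (elim conjE)
    show "H_content_delta (2 * d / p) \<Phi> (\<Union>c<L (Suc n). ball (x (Suc n) c) (2 powr (1 - real (k (Suc n) c)))) (1 / (real n + 1)) \<le> ennreal (4 powr (- (real n * q)))"
      using R[of n] by (elim conjE)
  qed (use P[of 0] P R in auto)
qed

theorem exists_measure_on_null_set:
  fixes \<Phi> :: "real \<Rightarrow> real"
  assumes q: "1 < q" and \<Phi>0: "\<Phi> 0 = 0"
    and lim: "((\<lambda>t. \<Phi> t / t powr ((q / (q - 1)) / 2)) \<longlongrightarrow> 0) (at_right 0)"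
  shows "\<exists>(S :: (real^'n) set) \<mu>. compact S \<and> prob_space \<mu> \<and> sets \<mu> = sets borel \<and> measure_support \<mu> \<subseteq> S \<and>
    in_Lorentz p q (fourier_measure \<mu>) \<and> H_content (2 * d / p) \<Phi> S = 0"
proof -
  obtain L B :: "nat \<Rightarrow> nat" and x :: "nat \<Rightarrow> nat \<Rightarrow> real^'n" and k :: "nat \<Rightarrow> nat \<Rightarrow> nat" and \<beta> :: "nat \<Rightarrow> nat \<Rightarrow> real"
  where L: "\<And>n. L n \<ge> 1" and B: "\<And>n. B n \<ge> 1" and LB: "\<And>n. L (Suc n) = L n * B n" and kn: "\<And>n c. c < L n \<Longrightarrow> n \<le> k n c"
    and x_near: "\<And>n a b. a < L n \<Longrightarrow> b < B n \<Longrightarrow> norm (x (Suc n) (a * B n + b) - x n a) \<le> 2 powr (- real (k n a))"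
    and k_incr: "\<And>n a b. a < L n \<Longrightarrow> b < B n \<Longrightarrow> k n a + 2 \<le> k (Suc n) (a * B n + b)"
    and tail: "\<And>n. tail_bound r p (\<lambda>\<xi>. F (L (Suc n)) (x (Suc n)) (k (Suc n)) \<xi> - F (L n) (x n) (k n) \<xi>) (\<beta> n)"
    and \<beta>: "\<And>n m. (\<Sum>j<m. \<beta> n j powr q) \<le> 4 powr (- (real n * q))"
    and content: "\<And>n. H_content_delta (2 * d / p) \<Phi> (\<Union>c<L (Suc n). ball (x (Suc n) c) (2 powr (1 - real (k (Suc n) c)))) (1 / (real n + 1)) \<le> ennreal (4 powr (- (real n * q)))"
    and init: "L 0 = 1" "x 0 = (\<lambda>_. 0)" "k 0 = (\<lambda>_. 0)"
    by (rule refinement_sequence[OF q \<Phi>0 lim]) (rule that)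
  \<comment> \<open>Twice the maximal displacement 2^-k of a child's centre. A child has scale at
    least k + 2, hence radius at most half of 2^-k, so its closed ball lies in the open ball of the
    parent; a gap of 1 would only give the closed ball. Closed balls make S compact, open ones are
    what a cover consists of.\<close>
  define rad where "rad = (\<lambda>n c. 2 powr (1 - real (k n c)))"
  define K where "K = (\<lambda>n. \<Union>c<L n. cball (x n c) (rad n c))"
  define S where "S = (\<Inter>n. K n)"
  have child: "cball (x (Suc n) c) (rad (Suc n) c) \<subseteq> ball (x n (c div B n)) (rad n (c div B n))"
    if c: "c < L (Suc n)" for n c
  proof
    fix z assume z: "z \<in> cball (x (Suc n) c) (rad (Suc n) c)"
    define a b where "a = c div B n" and "b = c mod B n"
    have ab: "a < L n" "b < B n" "c = a * B n + b"
      using c B[of n] by (auto simp: a_def b_def LB less_mult_imp_div_less)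
    have "rad (Suc n) c \<le> 2 powr (- real (k n a) - 1)"
      using k_incr[OF ab(1,2)] by (simp add: rad_def ab(3))
    also have "\<dots> < 2 powr (- real (k n a))" by simp
    finally have r: "rad (Suc n) c < 2 powr (- real (k n a))" .
    have "dist (x n a) z \<le> dist (x n a) (x (Suc n) c) + dist (x (Suc n) c) z" by (rule dist_triangle)
    also have "dist (x n a) (x (Suc n) c) \<le> 2 powr (- real (k n a))"
      using x_near[OF ab(1,2)] by (simp add: ab(3) dist_norm norm_minus_commute)
    also have "dist (x (Suc n) c) z \<le> rad (Suc n) c" using z by simp
    finally have "dist (x n a) z < 2 powr (- real (k n a)) + 2 powr (- real (k n a))" using r by linarith
    then show "z \<in> ball (x n (c div B n)) (rad n (c div B n))"
      by (simp add: a_def rad_def powr_diff powr_minus divide_inverse)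
  qed
  have K_sub: "K (Suc n) \<subseteq> (\<Union>c<L n. ball (x n c) (rad n c))" for n
  proof
    fix z assume "z \<in> K (Suc n)"
    then obtain c where c: "c < L (Suc n)" "z \<in> cball (x (Suc n) c) (rad (Suc n) c)" by (auto simp: K_def)
    have "c div B n < L n" using c(1) by (simp add: LB less_mult_imp_div_less)
    then show "z \<in> (\<Union>c<L n. ball (x n c) (rad n c))" using child[OF c(1)] c(2) by blast
  qed
  have compact_K: "compact (K n)" for n unfolding K_def by (intro compact_UN) auto
  have compact_S: "compact S"
  proof -
    have "S = K 0 \<inter> (\<Inter>n. K n)" by (auto simp: S_def)
    moreover have "closed (\<Inter>n. K n)" using compact_K by (intro closed_INT ballI compact_imp_closed)
    ultimately show ?thesis using compact_Int_closed[OF compact_K[of 0]] by simp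
  qed
  have content_S: "H_content (2 * d / p) \<Phi> S = 0"
  proof -
    have "H_content_delta (2 * d / p) \<Phi> S \<delta> = 0" if \<delta>: "\<delta> > 0" for \<delta>
    proof -
      have ev: "\<forall>\<^sub>F n in sequentially. H_content_delta (2 * d / p) \<Phi> S \<delta> \<le> ennreal (4 powr (- (real n * q)))"
      proof -
        obtain n\<^sub>0 :: nat where n0: "1 / (real n\<^sub>0 + 1) < \<delta>"
          using \<delta> reals_Archimedean[of \<delta>] by (auto simp: inverse_eq_divide add.commute)
        have "H_content_delta (2 * d / p) \<Phi> S \<delta> \<le> ennreal (4 powr (- (real n * q)))" if n: "n \<ge> n\<^sub>0" for n
        proof -
          have "1 / (real n + 1) \<le> 1 / (real n\<^sub>0 + 1)" using n by (intro divide_left_mono) auto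
          \<comment> \<open>The closed cells one generation deeper lie in the open balls of
            generation Suc n, whose content has been estimated.\<close>
          moreover have "S \<subseteq> (\<Union>c<L (Suc n). ball (x (Suc n) c) (2 powr (1 - real (k (Suc n) c))))"
            using K_sub[of "Suc n"] unfolding S_def rad_def by blast
          ultimately show ?thesis using n0 by (intro order_trans[OF H_content_delta_mono content]) auto
        qed
        then show ?thesis by (auto simp: eventually_sequentially)
      qed
      have "(\<lambda>n. 4 powr (- (real n * q))) \<longlonglongrightarrow> 0"
      proof -
        have "(\<lambda>n. (4 powr (- q)) ^ n) \<longlonglongrightarrow> 0" using q by (intro LIMSEQ_power_zero) (auto simp: powr_less_one)
        moreover have "(4 powr (- q)) ^ n = 4 powr (- (real n * q))" for n
          by (simp add: powr_realpow[symmetric] powr_powr mult.commute)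
        ultimately show ?thesis by simp
      qed
      then have "(\<lambda>n. ennreal (4 powr (- (real n * q)))) \<longlonglongrightarrow> ennreal 0" by (rule tendsto_ennrealI)
      from tendsto_lowerbound[OF this ev] show ?thesis by simp
    qed
    then show ?thesis unfolding H_content_def by simp
  qed
  \<comment> \<open>Cell \<open>c\<close> of generation \<open>n\<close> corresponds to the interval \<open>{c / L n ..< (c + 1) / L n}\<close>; as the
    cells shrink, their centres converge and the limit transports Lebesgue measure to \<open>\<mu>\<close>.\<close>
  define U where "U = restrict_space lborel {0..<1::real}"
  have U: "prob_space U" by (rule prob_spaceI) (simp add: U_def emeasure_restrict_space space_restrict_space)
  interpret U: prob_space U by (rule U)
  have spU: "space U = {0..<1}" by (simp add: U_def space_restrict_space)
  define idx where "idx = (\<lambda>n u. nat \<lfloor>u * real (L n)\<rfloor>)"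
  have idx_less: "idx n u < L n" if u: "u \<in> {0..<1}" for n u
  proof -
    have "u * real (L n) < 1 * real (L n)" using u L[of n] by (intro mult_strict_right_mono) auto
    moreover have "0 \<le> u * real (L n)" using u by auto
    ultimately show ?thesis unfolding idx_def by linarith
  qed
  have idx_Suc: "idx (Suc n) u div B n = idx n u" if u: "u \<in> {0..<1}" for n u
    unfolding idx_def LB using u B by (intro floor_mult_div) auto
  define X where "X = (\<lambda>n u. x n (idx n u))"
  have meas_idx: "(\<lambda>u. h (idx n u)) \<in> borel_measurable U" for h :: "nat \<Rightarrow> 'b::topological_space" and n
  proof -
    have "(\<lambda>u::real. h (nat \<lfloor>u * real (L n)\<rfloor>)) \<in> borel_measurable borel"
      by (rule measurable_compose[where N = "count_space UNIV" and f = "\<lambda>u::real. \<lfloor>u * real (L n)\<rfloor>" and g = "\<lambda>i. h (nat i)"]) auto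
    then show ?thesis unfolding U_def idx_def by (intro measurable_restrict_space1) simp
  qed
  define cell where "cell = (\<lambda>n u. cball (x n (idx n u)) (rad n (idx n u)))"
  have cell_Suc: "cell (Suc n) u \<subseteq> cell n u" if "u \<in> {0..<1}" for n u
    using child[OF idx_less[OF that], of n] ball_subset_cball unfolding cell_def idx_Suc[OF that] by blast
  have cell_mono: "cell m u \<subseteq> cell n u" if "u \<in> {0..<1}" "n \<le> m" for n m u
    using that(2) by (rule lift_Suc_antimono_le[rotated]) (rule cell_Suc[OF that(1)])
  have X_cell: "X m u \<in> cell n u" if "u \<in> {0..<1}" "n \<le> m" for n m u
    using cell_mono[OF that] by (force simp: cell_def X_def rad_def)
  have rad_le: "rad n (idx n u) \<le> 2 * (1/2)^n" if "u \<in> {0..<1}" for n u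
  proof -
    have "rad n (idx n u) \<le> 2 powr (1 - real n)" using kn[OF idx_less[OF that]] by (simp add: rad_def)
    also have "\<dots> = 2 * (1/2)^n" by (simp add: powr_diff powr_realpow power_one_over)
    finally show ?thesis .
  qed
  have half: "(\<lambda>n. C * (1/2)^n) \<longlonglongrightarrow> 0" for C :: real
    using tendsto_mult_right_zero[OF LIMSEQ_power_zero[of "1/2::real"]] by simp
  have "convergent (\<lambda>n. X n u)" if u: "u \<in> {0..<1}" for u
  proof (rule Cauchy_convergent, rule metric_CauchyI)
    fix e :: real assume e: "e > 0"
    from order_tendstoD(2)[OF half[of 4] e] obtain N where N: "4 * (1/2)^N < e"
      by (auto simp: eventually_sequentially)
    show "\<exists>N. \<forall>m\<ge>N. \<forall>n\<ge>N. dist (X m u) (X n u) < e"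
    proof (intro exI allI impI)
      fix m n assume mn: "N \<le> m" "N \<le> n"
      have "dist (X m u) (X n u) \<le> dist (x N (idx N u)) (X m u) + dist (x N (idx N u)) (X n u)" by (rule dist_triangle3)
      also have "\<dots> \<le> rad N (idx N u) + rad N (idx N u)"
        using X_cell[OF u mn(1)] X_cell[OF u mn(2)] by (simp add: cell_def)
      also have "\<dots> < e" using rad_le[OF u, of N] N by simp
      finally show "dist (X m u) (X n u) < e" .
    qed
  qed
  then have X_lim: "(\<lambda>n. X n u) \<longlonglongrightarrow> lim (\<lambda>n. X n u)" if "u \<in> {0..<1}" for u
    using that by (simp add: convergent_LIMSEQ_iff)
  define Y where "Y = (\<lambda>u. lim (\<lambda>n. X n u))"
  have Y_lim: "(\<lambda>n. X n u) \<longlonglongrightarrow> Y u" if "u \<in> {0..<1}" for u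
    using X_lim[OF that] by (simp add: Y_def)
  have Y_cell: "Y u \<in> cell n u" if u: "u \<in> {0..<1}" for n u
  proof (rule Lim_in_closed_set[OF _ _ _ Y_lim[OF u]])
    show "closed (cell n u)" by (simp add: cell_def)
    show "\<forall>\<^sub>F m in sequentially. X m u \<in> cell n u"
      using X_cell[OF u] by (auto simp: eventually_sequentially)
  qed simp
  have Y_S: "Y u \<in> S" if u: "u \<in> {0..<1}" for u
    unfolding S_def K_def using Y_cell[OF u] idx_less[OF u] by (auto simp: cell_def)
  have Ym [measurable]: "Y \<in> borel_measurable U"
    by (rule borel_measurable_LIMSEQ_metric[of "\<lambda>n. X n"])
      (auto simp: X_def spU Y_lim[unfolded X_def] intro: meas_idx)
  define \<mu> where "\<mu> = distr U borel Y"
  have \<mu>: "prob_space \<mu>" unfolding \<mu>_def by (rule U.prob_space_distr) (rule Ym)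
  have supp: "measure_support \<mu> \<subseteq> S"
  proof
    fix z assume z: "z \<in> measure_support \<mu>"
    show "z \<in> S"
    proof (rule ccontr)
      assume "z \<notin> S"
      moreover have "open (- S)" using compact_S by (simp add: compact_imp_closed open_Compl)
      ultimately obtain e where e: "e > 0" "ball z e \<subseteq> - S" by (meson ComplI open_contains_ball)
      have "Y -` ball z e \<inter> space U = {}" using e(2) Y_S by (auto simp: spU)
      then have "emeasure \<mu> (ball z e) = 0" unfolding \<mu>_def by (subst emeasure_distr) auto
      then show False using z e(1) by (auto simp: measure_support_def)
    qed
  qed
  define F' where "F' = (\<lambda>n. F (L n) (x n) (k n))"
  have F_int: "F' n \<xi> = (\<integral>u. cis (-2 * pi * (X n u \<bullet> \<xi>)) * \<psi> (k n (idx n u)) \<xi> \<partial>U)" for n \<xi>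
    unfolding F'_def F_def X_def idx_def U_def
    by (rule integral_floor_average[OF L, of "\<lambda>c. cis (-2 * pi * (x _ c \<bullet> \<xi>)) * \<psi> (k _ c) \<xi>", symmetric])
  \<comment> \<open>Dominated convergence on the unit interval: the centres converge pointwise, and
    \<psi> tends to 1 because the scales k n c >= n shrink the noise to a point.\<close>
  have F_lim: "(\<lambda>n. F' n \<xi>) \<longlonglongrightarrow> fourier_measure \<mu> \<xi>" for \<xi>
  proof -
    have "(\<lambda>n. \<integral>u. cis (-2 * pi * (X n u \<bullet> \<xi>)) * \<psi> (k n (idx n u)) \<xi> \<partial>U) \<longlonglongrightarrow> (\<integral>u. cis (-2 * pi * (Y u \<bullet> \<xi>)) \<partial>U)"
    proof (rule integral_dominated_convergence[where w = "\<lambda>_. 1"])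
      show "(\<lambda>u. cis (-2 * pi * (X n u \<bullet> \<xi>)) * \<psi> (k n (idx n u)) \<xi>) \<in> borel_measurable U" for n
        unfolding X_def by (rule meas_idx)
      show "AE u in U. (\<lambda>n. cis (-2 * pi * (X n u \<bullet> \<xi>)) * \<psi> (k n (idx n u)) \<xi>) \<longlonglongrightarrow> cis (-2 * pi * (Y u \<bullet> \<xi>))"
      proof (rule AE_I2)
        fix u assume "u \<in> space U"
        then have u: "u \<in> {0..<1}" by (simp add: spU)
        have "(\<lambda>n. \<psi> (k n (idx n u)) \<xi> - 1) \<longlonglongrightarrow> 0"
        proof (rule Lim_null_comparison[OF _ half[of "2 * pi * norm \<xi>"]], intro always_eventually allI)
          fix n
          have "2 powr (- real (k n (idx n u))) \<le> 2 powr (- real n)" using kn[OF idx_less[OF u]] by simp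
          also have "\<dots> = (1/2)^n" by (simp add: powr_minus powr_realpow power_one_over inverse_eq_divide)
          finally have "2 * pi * norm \<xi> * 2 powr (- real (k n (idx n u))) \<le> 2 * pi * norm \<xi> * (1/2)^n"
            by (intro mult_left_mono) auto
          moreover have "norm (\<psi> (k n (idx n u)) \<xi> - 1) \<le> 2 * pi * norm \<xi> * 2 powr (- real (k n (idx n u)))"
            using norm_\<psi>_diff_1_le[of "k n (idx n u)" \<xi>] by (simp only: mult_ac)
          ultimately show "norm (\<psi> (k n (idx n u)) \<xi> - 1) \<le> 2 * pi * norm \<xi> * (1/2)^n"
            by (rule order_trans[rotated])
        qed
        then have 1: "(\<lambda>n. \<psi> (k n (idx n u)) \<xi>) \<longlonglongrightarrow> 1" by (simp add: LIM_zero_iff)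
        have 2: "(\<lambda>n. cis (-2 * pi * (X n u \<bullet> \<xi>))) \<longlonglongrightarrow> cis (-2 * pi * (Y u \<bullet> \<xi>))"
          by (intro tendsto_cis tendsto_intros Y_lim u)
        show "(\<lambda>n. cis (-2 * pi * (X n u \<bullet> \<xi>)) * \<psi> (k n (idx n u)) \<xi>) \<longlonglongrightarrow> cis (-2 * pi * (Y u \<bullet> \<xi>))"
          using tendsto_mult[OF 2 1] by simp
      qed
    qed (auto simp: norm_mult norm_\<psi>_le_1)
    then show ?thesis unfolding F_int fourier_measure_def \<mu>_def by (subst integral_distr) auto
  qed
  have \<beta>0: "0 \<le> \<beta> n j" for n j using tail_boundD(2)[OF tail] by (rule less_imp_le)
  note sup = summable_superposition[OF q \<beta>0 \<beta>]
  \<comment> \<open>The initial configuration is the noise itself, with transform \<psi> 0. The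
    other terms of b come from telescoping the refinements.\<close>
  define b\<^sub>0 where "b\<^sub>0 = (\<lambda>j::nat. I\<^sub>\<psi> * 2 powr (- \<gamma> * real j))"
  define b where "b = (\<lambda>j. b\<^sub>0 j + (\<Sum>n. \<beta> n j))"
  have F0: "tail_bound r p (F' 0) b\<^sub>0"
  proof -
    have F'0: "F' 0 = \<psi> 0" by (simp add: F'_def init F_def fun_eq_iff)
    have "norm (\<psi> 0 \<xi>) * 1 \<le> norm (\<psi> 0 \<xi>) * (1 + norm \<xi>)" for \<xi> by (intro mult_left_mono) auto
    then show ?thesis using tail_bound_by_\<psi>[OF \<psi>_measurable, of 1 0 0] by (simp add: F'0 b\<^sub>0_def)
  qed
  have partial: "tail_bound r p (F' N) (\<lambda>j. b\<^sub>0 j + (\<Sum>n<N. \<beta> n j))" for N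
  proof (induction N)
    case 0
    then show ?case using F0 by simp
  next
    case (Suc N)
    from tail_bound_add[OF Suc tail[of N] even_r r_pos] show ?case
      by (simp add: F'_def add.assoc)
  qed
  have "tail_bound r p (F' N) b" for N
  proof (rule tail_bound_mono[OF partial])
    show "F' N \<in> borel_measurable borel" unfolding F'_def by measurable
    show "b\<^sub>0 j + (\<Sum>n<N. \<beta> n j) \<le> b j" for j
      unfolding b_def using sum_le_suminf[OF sup(1)] \<beta>0 by auto
  qed auto
  then have tb: "tail_bound r p (fourier_measure \<mu>) b" by (rule tail_bound_LIMSEQ[OF _ F_lim])
  have b_summable: "summable (\<lambda>j. b j powr q)"
  proof (rule summable_comparison_test')
    have "summable (\<lambda>j. (I\<^sub>\<psi> powr q) * (2 powr (- \<gamma> * q)) ^ j)"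
      using \<gamma>_pos q by (intro summable_mult summable_geometric) (auto simp: powr_less_one)
    also have "(\<lambda>j. (I\<^sub>\<psi> powr q) * (2 powr (- \<gamma> * q)) ^ j) = (\<lambda>j. b\<^sub>0 j powr q)"
      using I\<psi>_pos by (simp add: b\<^sub>0_def powr_mult powr_powr two_powr_power mult_ac)
    finally show "summable (\<lambda>j. 2 powr q * (b\<^sub>0 j powr q + (\<Sum>n. \<beta> n j) powr q))"
      by (intro summable_mult summable_add sup(2))
    show "norm (b j powr q) \<le> 2 powr q * (b\<^sub>0 j powr q + (\<Sum>n. \<beta> n j) powr q)" if "j \<ge> 0" for j
      unfolding b_def using I\<psi>_pos q suminf_nonneg[OF sup(1) \<beta>0] by (auto simp: b\<^sub>0_def intro!: add_powr_le)
  qed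
  have "in_Lorentz p q (fourier_measure \<mu>)"
    using p_gt_2 q r_pos by (intro in_Lorentz_of_tail_bound[OF tb _ _ _ b_summable norm_fourier_measure_le_1[OF \<mu>]]) auto
  moreover have "sets \<mu> = sets borel" by (simp add: \<mu>_def)
  ultimately show ?thesis using compact_S \<mu> supp content_S by blast
qed

end

theorem theorem7p1:
  fixes p q :: real and \<Phi> :: "real \<Rightarrow> real"
  assumes "2 < p" and "1 < q"
    and "regular_fun \<Phi>"
    and "((\<lambda>t. \<Phi> t / t powr ((q / (q - 1)) / 2)) \<longlongrightarrow> 0) (at_right 0)"
  shows "\<exists>(S :: (real ^ 'n) set) (\<mu> :: (real ^ 'n) measure).
           compact S \<and> prob_space \<mu> \<and> sets \<mu> = sets borel \<and>
           measure_support \<mu> \<subseteq> S \<and>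
           in_Lorentz p q (fourier_measure \<mu>) \<and>
           H_content (2 * real CARD('n) / p) \<Phi> S = 0"
proof -
  \<comment> \<open>Even for the moment method and Minkowski's inequality, above p so that \<gamma>
    > 0.\<close>
  define r where "r = 2 * (nat \<lceil>p\<rceil> + 1)"
  have r: "2 \<le> r" "even r" "p < real r" using assms(1) by (auto simp: r_def) linarith
  obtain \<phi> :: "(real^'n) measure" where \<phi>: "prob_space \<phi>" "sets \<phi> = sets borel" "AE y in \<phi>. norm y \<le> 1"
    "(\<integral>\<^sup>+\<xi>. ennreal ((norm (fourier_measure \<phi> \<xi>) * (1 + norm \<xi>)^(CARD('n)+1))^r) \<partial>lborel) < \<infinity>"
    by (rule compactly_supported_noise[OF r(1)]) (rule that)
  interpret smoothing_noise \<phi> r p by (rule smoothing_noise.intro) (fact \<phi> r(2,3) assms(1))+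
  have "\<Phi> 0 = 0" using assms(3) by (simp add: regular_fun_def)
  from exists_measure_on_null_set[OF assms(2) this assms(4)] show ?thesis by (simp add: d_def)
qed

end
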